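(* Consider the sequence $\{\bar x_k\}$ generated by the inexact zeroth-order scheme (ZSOL$^{2s}_{cnvx}$) described in the context, applied to the two-stage implicit problem $\min_{x\in\mathcal X}f^{\rm imp}(x)$, under Assumptions (B1)--(B3), (C), (U) of the context. Let $\gamma_k=\gamma_0/(k+1)^a$ and $\eta_k=\eta_0/(k+1)^b$ for $k\ge0$ with $\gamma_0,\eta_0,a,b>0$; let $\alpha\le\mu_F/L_F^2$, $t_k=\lceil\tau\ln(k+1)\rceil$ with $\tau\ge\frac{-2(a+b)}{\ln(1-\mu_F\alpha)}$, and let $r\in[0,1)$ be arbitrary. (a) Suppose $\hat x_k\in\mathcal X+\eta_k\mathbb B$ and let $y_{t_k}$ be generated by the lower-level scheme run at $(\hat x_k,\omega_k)$. Then for suitably defined constants $\tilde d<1$ and $B>0$, the following holds for $t_k\ge1$: $$\|y_{t_k}-y(\hat x_k,\omega_k)\|^2\le\tilde\epsilon_k:=B\,\tilde d^{\,t_k}.$$ (b) Let $a=0.5$, $b\in[0.5,1)$ and $0\le r<2(1-b)$. Then for all $K\ge2^{\frac1{1-r}}-1$, $$\mathbb E[f^{\rm imp}(\bar x_K)]-f^*\le(2-r)\Big(\tfrac{D_{\mathcal X}}{\gamma_0}+\tfrac{2\theta_0\gamma_0}{1-r}\Big)\tfrac1{\sqrt{K+1}}+(2-r)\Big(\tfrac{\eta_0L_0}{1-0.5r-b}\Big)\tfrac1{(K+1)^b},$$ where $\theta_0:=D_{\mathcal X}+\frac{(2+3\gamma_0^2)n^2\tilde L_0^2B}{\eta_0^2\gamma_0^2}+1.5\,n^2L_0^2$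 with $B$ as in (a). In particular, when $b=1-\delta$ and $r=0$, where $\delta>0$ is a small scalar, for all $K\ge1$, $$\mathbb E[f^{\rm imp}(\bar x_K)]-f^*\le2\Big(\tfrac{D_{\mathcal X}}{\gamma_0}+2\theta_0\gamma_0\Big)\tfrac1{\sqrt{K+1}}+\Big(\tfrac{2\eta_0L_0}{\delta}\Big)\tfrac1{(K+1)^{1-\delta}}.$$ (c) Suppose $\gamma_0=\mathcal O(1/L_0)$, $a=0.5$, $b=0.5$, $r=0$. Let $\epsilon>0$ be an arbitrary scalar and let $K_\epsilon$ be such that $\mathbb E[f^{\rm imp}(\bar x_{K_\epsilon})]-f^*\le\epsilon$. Then: (c-1) the total number of upper-level projection steps on $\mathcal X$ is $K_\epsilon=\mathcal O(n^4L_0^2\tilde L_0^4\epsilon^{-2})$; (c-2) the total sample complexity of the upper level is $\mathcal O(n^4L_0^2\tilde L_0^4\epsilon^{-2})$; (c-3) the total number of lower-level projection steps on $\mathcal Y$ is $\mathcal O\big(n^4L_0^2\tilde L_0^4\epsilon^{-2}\ln(n^2L_0\tilde L_0^2\epsilon^{-1})\big)$. (d) For any $a\in(0.5,1]$ and $b>1-a$, there exists $x^*\in\mathcal X^*$ such that $\lim_{k\to\infty}\|\bar x_k-x^*\|^2=0$ almost surely.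
   Context: Notation. $\mathbb B$ and $\mathbb S$ are the Euclidean unit ball and unit sphere of $\mathbb R^n$; $\Pi_C$ is Euclidean projection onto $C$; $\mathcal O(\cdot)$ hides factors not depending on $\epsilon,n,L_0,\tilde L_0$. Problem. $\mathcal X\subseteq\mathbb R^n$, $\mathcal Y\subseteq\mathbb R^m$; $\omega$ is a random variable on a probability space $(\Omega,\mathcal F,\mathbb P)$; $\tilde f(x,y,\omega)\in\mathbb R$, $G(x,y,\omega)\in\mathbb R^m$. The single-valued map $y(\cdot,\cdot)$ assigns to $(x,\omega)$ the solution $y(x,\omega)$ of VI$(\mathcal Y,G(x,\cdot,\omega))$: $y\in\mathcal Y$ and $(\tilde y-y)^TG(x,y,\omega)\ge0$ for all $\tilde y\in\mathcal Y$. The two-stage implicit problem is $\min_{x\in\mathcal X}f^{\rm imp}(x):=\mathbb E[\tilde f(x,y(x,\omega),\omega)]$; $\mathcal X^*$ and $f^*$ denote its solution set and optimal value, and $D_{\mathcal X}:=\frac12\sup_{x\in\mathcal X}{\rm dist}^2(x,\mathcal X^* )$. Assumptions. (B1) For some $\eta_0>0$ and every $\omega$, $x\mapsto\tilde f(x,y(x,\omega),\omega)$ is $L_0(\omega)$-Lipschitz on $\mathcal X+\eta_0\mathbb B$ with $L_0:=\sqrt{\mathbb E[L_0^2(\omega)]}<\infty$; and $\tilde f(x,\cdot,\omega)$ is $\tilde L_0(\omega)$-Lipschitz for all $x\in\mathcal X+\eta_0\mathbb B$, with $\tilde L_0:=\sqrt{\mathbb E[\tilde L_0^2(\omega)]}<\infty$.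 (B2) $\mathcal X,\mathcal Y$ are nonempty, closed, bounded, convex. (B3) $G(x,\cdot,\omega)$ is $\mu_F(\omega)$-strongly monotone and $L_F(\omega)$-Lipschitz on $\mathcal Y$, uniformly in $x\in\mathcal X$, for every $\omega$, with $\inf_\omega\mu_F(\omega)\ge\mu_F$ and $\sup_\omega L_F(\omega)\le L_F$ for some $\mu_F,L_F\in(0,\infty)$. (C) $f^{\rm imp}$ is convex on $\mathcal X$. (U) The $v_k$ are independent with $v_k$ uniformly distributed on $\eta_k\mathbb S$, the $\omega_k$ are iid replicates of $\omega$, and $v_k$, $\omega_k$ are independent of each other. Scheme (ZSOL$^{2s}_{cnvx}$, inexact). Given $x_0\in\mathcal X$, $\bar x_0=x_0$, $S_0=\gamma_0^r$. For $k=0,1,\dots$: draw $\omega_k$ and $v_k\in\eta_k\mathbb S$; obtain $y_{\tilde\epsilon_k}(x_k,\omega_k)$ and $y_{\tilde\epsilon_k}(x_k+v_k,\omega_k)$ as outputs of the lower-level scheme with $\hat x_k=x_k$ and $\hat x_k=x_k+v_k$ and $\omega=\omega_k$; set $$g_k=\frac{n\big(\tilde f(x_k+v_k,y_{\tilde\epsilon_k}(x_k+v_k,\omega_k),\omega_k)-\tilde f(x_k,y_{\tilde\epsilon_k}(x_k,\omega_k),\omega_k)\big)v_k}{\|v_k\|\eta_k},\quad x_{k+1}=\Pi_{\mathcal X}[x_k-\gamma_kg_k],$$ $S_{k+1}=S_k+\gamma_{k+1}^r$, $\bar x_{k+1}=(S_k\bar x_k+\gamma_{k+1}^rx_{k+1})/S_{k+1}$.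 Lower-level scheme at $(\hat x_k,\omega)$. Take any $y_0\in\mathcal Y$; for $t=0,\dots,t_k-1$ set $y_{t+1}=\Pi_{\mathcal Y}[y_t-\alpha G(\hat x_k,y_t,\omega)]$, where $\alpha>0$; return $y_{t_k}$.
   Formalization: (B3) and (C) are assumed on X+η_0B rather than X; in (c), γ_0=O(1/L_0) means c_1/L_0≤γ_0≤c_2/L_0, L_0 and L̃_0 are at least some l>0, K_ε is the least such K, and in (c-3) the logarithm's argument is at least some z>1; in (d), x* is an X*-valued random variable. *)

theory Defs
  imports "HOL-Probability.Probability"
begin

definition VI_sol :: "'b::real_inner set \<Rightarrow> ('b \<Rightarrow> 'b) \<Rightarrow> 'b set" where
  "VI_sol Y F = {y \<in> Y. \<forall>z\<in>Y. 0 \<le> (z - y) \<bullet> F y}"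

definition strongly_monotone_on :: "'b::real_inner set \<Rightarrow> real \<Rightarrow> ('b \<Rightarrow> 'b) \<Rightarrow> bool" where
  "strongly_monotone_on Y \<mu> F \<longleftrightarrow>
     (\<forall>y\<in>Y. \<forall>z\<in>Y. \<mu> * (norm (y - z))\<^sup>2 \<le> (y - z) \<bullet> (F y - F z))"

primrec proj_iter :: "'b::euclidean_space set \<Rightarrow> real \<Rightarrow> ('b \<Rightarrow> 'b) \<Rightarrow> 'b \<Rightarrow> nat \<Rightarrow> 'b" where
  "proj_iter Y \<alpha> F y\<^sub>0 0 = y\<^sub>0"
| "proj_iter Y \<alpha> F y\<^sub>0 (Suc t) =
     closest_point Y (proj_iter Y \<alpha> F y\<^sub>0 t - \<alpha> *\<^sub>R F (proj_iter Y \<alpha> F y\<^sub>0 t))"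

(* The normalised surface measure of the sphere of radius e is the cone measure: the radial
   projection of the uniform distribution on the unit ball.  The centre of the ball, where the
   radial projection is undefined, is a null set. *)
definition uniform_sphere :: "real \<Rightarrow> 'a::euclidean_space measure" where
  "uniform_sphere e = distr (uniform_measure lborel (ball 0 1)) borel (\<lambda>x. (e / norm x) *\<^sub>R x)"

definition argmin_on :: "'a set \<Rightarrow> ('a \<Rightarrow> real) \<Rightarrow> 'a set" where
  "argmin_on X \<phi> = {x \<in> X. \<forall>x'\<in>X. \<phi> x \<le> \<phi> x'}"

(* B bounds the squared distance of any starting point in Y to the solution; the case split only
   serves to keep B positive when Y is a singleton. *)
definition lower_level_const :: "'b::euclidean_space set \<Rightarrow> real" where
  "lower_level_const Y = (if diameter Y = 0 then 1 else (diameter Y)\<^sup>2)"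

(* The factors hidden in the complexity bounds.  They have to be uniform in the dimension n, which
   is a type here, so "there is a constant such that for all n" cannot be written as a formula;
   instead the factors are closed expressions in the hidden quantities only: D = D_X, B, \<eta>\<^sub>0,
   c\<^sub>1 and c\<^sub>2 with c\<^sub>1 / L\<^sub>0 \<le> \<gamma>\<^sub>0 \<le> c\<^sub>2 / L\<^sub>0, a positive lower bound l of both Lipschitz moduli, and
   (for the lower level) \<tau> and a lower bound z > 1 of the argument of the logarithm.
   hidden_const bounds the coefficient of 1 / sqrt (K + 1) divided by n^2 * L\<^sub>0 * Lt\<^sub>0^2. *)
definition hidden_const :: "real \<Rightarrow> real \<Rightarrow> real \<Rightarrow> real \<Rightarrow> real \<Rightarrow> real \<Rightarrow> real" where
  "hidden_const l c\<^sub>1 c\<^sub>2 \<eta>\<^sub>0 D B =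
     2 * D / (c\<^sub>1 * l^2) + 4 * c\<^sub>2 * D / l^4 + 8 * B / (\<eta>\<^sub>0^2 * c\<^sub>1)
     + 12 * c\<^sub>2 * B / (\<eta>\<^sub>0^2 * l^2) + 6 * c\<^sub>2 / l^2 + 4 * \<eta>\<^sub>0 / l^2"

definition upper_hidden :: "real \<Rightarrow> real \<Rightarrow> real \<Rightarrow> real \<Rightarrow> real \<Rightarrow> real \<Rightarrow> real" where
  "upper_hidden l c\<^sub>1 c\<^sub>2 \<eta>\<^sub>0 D B = (hidden_const l c\<^sub>1 c\<^sub>2 \<eta>\<^sub>0 D B)\<^sup>2"

definition lower_hidden ::
    "real \<Rightarrow> real \<Rightarrow> real \<Rightarrow> real \<Rightarrow> real \<Rightarrow> real \<Rightarrow> real \<Rightarrow> real \<Rightarrow> real" where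
  "lower_hidden l c\<^sub>1 c\<^sub>2 \<eta>\<^sub>0 D B \<tau> z =
     2 * upper_hidden l c\<^sub>1 c\<^sub>2 \<eta>\<^sub>0 D B
       * (2 * \<tau> + (2 * \<tau> * \<bar>ln (hidden_const l c\<^sub>1 c\<^sub>2 \<eta>\<^sub>0 D B)\<bar> + 1) / ln z)"

(* Cost of the iterations 0, ..., K - 1, which produce the K-th iterate: one projection on X and
   one sample of \<omega> per iteration, and two runs of the lower-level scheme with t k projections
   each. *)
definition upper_projections :: "nat \<Rightarrow> nat" where
  "upper_projections K = (\<Sum>k<K. 1)"

definition upper_samples :: "nat \<Rightarrow> nat" where
  "upper_samples K = (\<Sum>k<K. 1)"

definition lower_projections :: "(nat \<Rightarrow> nat) \<Rightarrow> nat \<Rightarrow> nat" where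
  "lower_projections t K = (\<Sum>k<K. 2 * t k)"

end

theory Submission
  imports Defs
begin

text \<open>
  The projected lower-level iteration is a contraction, so the error of the inexact gradient
  estimate is of order \<open>\<gamma> k\<close>. The exact estimate is, conditionally on the past, a subgradient up to
  \<open>\<eta> k * L\<^sub>0\<close>: by convexity of difference quotients the mean of \<open>F(u) - F(u - d)\<close> over the ball is at
  most the mean of the directional derivative along \<open>d\<close>, and the latter is a sphere average. The
  divergence theorem that is needed here is obtained by integrating against a radial ramp function
  supported in the ball and letting its width tend to zero.

  For the rates, the squared distance to the solution set satisfies a descent recursion which is
  weighted with \<open>\<gamma> k powr (r - 1)\<close> and summed by parts. For almost sure convergence, the noise
  terms are square-summable martingale differences, whose series converges by Kolmogorov's maximal
  inequality applied to a stopped sum. Hence the distance of the iterates to each point of a countable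
  dense subset of the solution set converges, and an Opial argument together with the divergence
  of \<open>\<Sum> \<gamma> k\<close> identifies the limit.
\<close>

section \<open>Contraction of the lower-level projection scheme\<close>

text \<open>The objective is only convex and Lipschitz, so there need not be a gradient for the
  two-point estimate to approximate. The descent argument consumes something weaker and one-sided:
  the mean of \<open>g \<bullet> (x - z)\<close> must be at least \<open>fimp x - fimp z\<close>
  minus a bias. This is why the derivative may fall on the ramp, which is explicit, and never on the
  objective. The bias is \<open>\<eta> k * L\<^sub>0\<close>: symmetry of the ball bounds the mean
  around \<open>x\<close> below by the central value for free, and the Lipschitz bound is spent only
  around \<open>z\<close>. Convexity is assumed for the expectation of the integrand, not for its
  realisations. The drift is therefore computed with the iterate frozen and with \<omega> averaged
  before the direction. The inexactness enters the squared error of the estimate through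
  \<open>B * dt ^ t k / (\<eta> k)\<^sup>2\<close>. To be of order
  \<open>(\<gamma> k)\<^sup>2\<close>, the power of \<open>dt\<close> has to match both
  \<open>(\<eta> k)\<^sup>2\<close> and \<open>(\<gamma> k)\<^sup>2\<close>, which is the origin of
  \<open>2 * (a + b)\<close> in the lower bound on \<tau>.\<close>

lemma VI_sol_fixed_point:
  fixes Y :: "'b::euclidean_space set"
  assumes Y: "convex Y" "closed Y" and "0 \<le> \<alpha>" and y: "y \<in> VI_sol Y F"
  shows "closest_point Y (y - \<alpha> *\<^sub>R F y) = y"
proof -
  have yY: "y \<in> Y" and vi: "\<And>z. z \<in> Y \<Longrightarrow> 0 \<le> (z - y) \<bullet> F y"
    using y by (auto simp: VI_sol_def)
  have "dist (y - \<alpha> *\<^sub>R F y) y \<le> dist (y - \<alpha> *\<^sub>R F y) z" if "z \<in> Y" for z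
  proof -
    \<comment> \<open>The cross term is nonnegative by the variational inequality, and the squares
      complete it to the squared distance from the unprojected point to \<open>z\<close>.\<close>
    have "(norm (\<alpha> *\<^sub>R F y))\<^sup>2 \<le> (norm (\<alpha> *\<^sub>R F y))\<^sup>2 + 2 * \<alpha> * ((z - y) \<bullet> F y) + (norm (z - y))\<^sup>2"
      using vi[OF that] \<open>0 \<le> \<alpha>\<close> by simp
    also have "\<dots> = (norm (\<alpha> *\<^sub>R F y + (z - y)))\<^sup>2"
      by (simp only: power2_norm_eq_inner inner_add_left inner_add_right inner_scaleR_right
          inner_scaleR_left inner_commute[of "F y" "z - y"]) (simp add: algebra_simps)
    finally have "norm (\<alpha> *\<^sub>R F y) \<le> norm (\<alpha> *\<^sub>R F y + (z - y))"
      by (rule power2_le_imp_le) simp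
    moreover have "dist (y - \<alpha> *\<^sub>R F y) z = norm (\<alpha> *\<^sub>R F y + (z - y))"
      by (metis dist_commute dist_norm add_diff_eq diff_diff_eq2 add.commute)
    moreover have "dist (y - \<alpha> *\<^sub>R F y) y = norm (\<alpha> *\<^sub>R F y)"
      by (simp add: dist_norm)
    ultimately show ?thesis by simp
  qed
  then show ?thesis
    using closest_point_unique[OF Y yY] by metis
qed

lemma proj_iter_in:
  assumes "closed Y" "Y \<noteq> {}" "z \<in> Y"
  shows "proj_iter Y \<alpha> F z t \<in> Y"
  using assms by (induction t) (auto intro: closest_point_in_set)

lemma strongly_monotone_on_mono:
  assumes "strongly_monotone_on Y m F" "\<mu> \<le> m"
  shows "strongly_monotone_on Y \<mu> F"
  unfolding strongly_monotone_on_def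
proof (intro ballI)
  fix y z assume "y \<in> Y" "z \<in> Y"
  then have "m * (norm (y - z))\<^sup>2 \<le> (y - z) \<bullet> (F y - F z)"
    using assms(1) by (auto simp: strongly_monotone_on_def)
  moreover have "\<mu> * (norm (y - z))\<^sup>2 \<le> m * (norm (y - z))\<^sup>2"
    using assms(2) by (intro mult_right_mono) auto
  ultimately show "\<mu> * (norm (y - z))\<^sup>2 \<le> (y - z) \<bullet> (F y - F z)" by linarith
qed

text \<open>The projection is nonexpansive and the solution is a fixed point of the step, so one
  step multiplies the squared error by at most
  \<open>1 - 2 * \<mu> * \<alpha> + \<alpha>\<^sup>2 * L\<^sup>2\<close>. The restriction
  \<open>\<alpha> * L\<^sup>2 \<le> \<mu>\<close> spends half of the linear gain on the quadratic
  term; \<open>\<mu> * \<alpha> \<le> 1\<close> keeps the factor nonnegative for the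
  induction.\<close>

lemma proj_iter_contraction:
  fixes Y :: "'b::euclidean_space set"
  assumes Y: "Y \<noteq> {}" "closed Y" "convex Y"
    and mono: "strongly_monotone_on Y \<mu> F" and lip: "L-lipschitz_on Y F"
    and \<alpha>: "0 \<le> \<alpha>" "\<alpha> * L\<^sup>2 \<le> \<mu>" "\<mu> * \<alpha> \<le> 1"
    and sol: "y \<in> VI_sol Y F" and z: "z \<in> Y"
  shows "(norm (proj_iter Y \<alpha> F z t - y))\<^sup>2 \<le> (norm (z - y))\<^sup>2 * (1 - \<mu> * \<alpha>) ^ t"
proof (induction t)
  case (Suc t)
  define p where "p = proj_iter Y \<alpha> F z t"
  have pY: "p \<in> Y" and yY: "y \<in> Y"
    using proj_iter_in[OF Y(2,1) z] sol by (auto simp: p_def VI_sol_def)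
  have "norm (proj_iter Y \<alpha> F z (Suc t) - y)
      = dist (closest_point Y (p - \<alpha> *\<^sub>R F p)) (closest_point Y (y - \<alpha> *\<^sub>R F y))"
    using VI_sol_fixed_point[OF Y(3,2) \<alpha>(1) sol] by (simp add: p_def dist_norm)
  also have "\<dots> \<le> norm ((p - y) - \<alpha> *\<^sub>R (F p - F y))"
    using closest_point_lipschitz[OF Y(3,2,1), of "p - \<alpha> *\<^sub>R F p" "y - \<alpha> *\<^sub>R F y"]
    by (simp add: dist_norm algebra_simps)
  finally have "(norm (proj_iter Y \<alpha> F z (Suc t) - y))\<^sup>2 \<le> (norm ((p - y) - \<alpha> *\<^sub>R (F p - F y)))\<^sup>2"
    by (intro power_mono) auto
  also have "\<dots> = (norm (p - y))\<^sup>2 - 2 * \<alpha> * ((p - y) \<bullet> (F p - F y)) + \<alpha>\<^sup>2 * (norm (F p - F y))\<^sup>2"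
    by (simp only: power2_norm_eq_inner inner_diff_left inner_diff_right inner_scaleR_left
        inner_scaleR_right) (simp add: inner_commute algebra_simps power2_eq_square)
  also have "\<dots> \<le> (norm (p - y))\<^sup>2 - 2 * \<alpha> * (\<mu> * (norm (p - y))\<^sup>2) + \<alpha>\<^sup>2 * (L * norm (p - y))\<^sup>2"
  proof -
    have "\<mu> * (norm (p - y))\<^sup>2 \<le> (p - y) \<bullet> (F p - F y)"
      using mono pY yY by (auto simp: strongly_monotone_on_def)
    then have "\<alpha> * (\<mu> * (norm (p - y))\<^sup>2) \<le> \<alpha> * ((p - y) \<bullet> (F p - F y))"
      using \<alpha>(1) by (rule mult_left_mono)
    moreover have "(norm (F p - F y))\<^sup>2 \<le> (L * norm (p - y))\<^sup>2"
      using lipschitz_onD[OF lip pY yY] by (intro power_mono) (auto simp: dist_norm)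
    then have "\<alpha>\<^sup>2 * (norm (F p - F y))\<^sup>2 \<le> \<alpha>\<^sup>2 * (L * norm (p - y))\<^sup>2"
      by (intro mult_left_mono) auto
    ultimately show ?thesis by linarith
  qed
  also have "\<dots> = (norm (p - y))\<^sup>2 * (1 - 2 * (\<mu> * \<alpha>) + \<alpha> * (\<alpha> * L\<^sup>2))"
    by (simp add: algebra_simps power2_eq_square)
  also have "\<dots> \<le> (norm (p - y))\<^sup>2 * (1 - \<mu> * \<alpha>)"
    using mult_left_mono[OF \<alpha>(2,1)] by (intro mult_left_mono) (auto simp: mult.commute)
  also have "\<dots> \<le> (norm (z - y))\<^sup>2 * (1 - \<mu> * \<alpha>) ^ t * (1 - \<mu> * \<alpha>)"
    using Suc.IH \<alpha>(3) by (intro mult_right_mono) (auto simp: p_def)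
  finally show ?case by (simp add: mult_ac)
qed simp

lemma norm_diff_le_lower_level_const:
  assumes "bounded Y" "y \<in> Y" "z \<in> Y"
  shows "(norm (y - z))\<^sup>2 \<le> lower_level_const Y"
proof -
  have "norm (y - z) \<le> diameter Y"
    using diameter_bounded_bound[OF assms] by (simp add: dist_norm)
  then have "(norm (y - z))\<^sup>2 \<le> (diameter Y)\<^sup>2" by (intro power_mono) auto
  then show ?thesis by (auto simp: lower_level_const_def)
qed

lemma lower_level_const_pos: "0 < lower_level_const Y"
  by (simp add: lower_level_const_def)

section \<open>Sphere averages of convex functions\<close>

lemma lborel_integrable_affine:
  fixes f :: "'a::euclidean_space \<Rightarrow> real" and t :: 'a
  assumes f: "integrable lborel f" and c: "c \<noteq> 0"
  shows "integrable lborel (\<lambda>x. f (t + c *\<^sub>R x))"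
proof -
  have [measurable]: "f \<in> borel_measurable borel"
    using f by simp
  have "integrable (density (distr lborel borel (\<lambda>x. t + c *\<^sub>R x)) (\<lambda>_. \<bar>c\<bar> ^ DIM('a))) f"
    using f unfolding lborel_affine[OF c, of t, symmetric] .
  then show ?thesis
    using c by (simp add: integrable_density integrable_distr_eq)
qed

lemma lborel_integral_affine:
  fixes f :: "'a::euclidean_space \<Rightarrow> real" and t :: 'a
  assumes f: "f \<in> borel_measurable borel" and c: "c \<noteq> 0"
  shows "(\<integral>x. f x \<partial>lborel) = \<bar>c\<bar> ^ DIM('a) * (\<integral>x. f (t + c *\<^sub>R x) \<partial>lborel)"
proof -
  note f[measurable]
  have "(\<integral>x. f x \<partial>lborel) = (\<integral>x. f x \<partial>density (distr lborel borel (\<lambda>x. t + c *\<^sub>R x)) (\<lambda>_. \<bar>c\<bar> ^ DIM('a)))"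
    unfolding lborel_affine[OF c, of t, symmetric] ..
  also have "\<dots> = \<bar>c\<bar> ^ DIM('a) * (\<integral>x. f (t + c *\<^sub>R x) \<partial>lborel)"
    by (simp add: integral_density integral_distr)
  finally show ?thesis .
qed

lemma integrable_lborel_bounded_support:
  fixes f :: "'a::euclidean_space \<Rightarrow> real"
  assumes [measurable]: "f \<in> borel_measurable borel"
    and "\<And>u. norm u \<le> R \<Longrightarrow> \<bar>f u\<bar> \<le> M" and "\<And>u. R < norm u \<Longrightarrow> f u = 0"
  shows "integrable lborel f"
proof (rule Bochner_Integration.integrable_bound)
  show "integrable lborel (\<lambda>u. M * indicat_real (cball (0::'a) R) u)"
    by (intro integrable_mult_right integrable_real_indicator emeasure_lborel_cball_finite) auto
  show "AE u in lborel. norm (f u) \<le> norm (M * indicat_real (cball 0 R) u)"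
  proof (intro AE_I2)
    fix u show "norm (f u) \<le> norm (M * indicat_real (cball 0 R) u)"
      using assms(2)[of u] assms(3)[of u] by (cases "norm u \<le> R") auto
  qed
qed simp

text \<open>When \<open>g\<close> depends on the direction alone, scaling produces nothing but the
  Jacobian. This replaces polar coordinates: a shell of width \<delta> carries the share
  \<open>1 - (1 - \<delta>) ^ DIM('a)\<close> of the integral over the unit ball.\<close>

lemma integral_homogeneous_ball:
  fixes g :: "'a::euclidean_space \<Rightarrow> real"
  assumes [measurable]: "g \<in> borel_measurable borel"
    and hom: "\<And>s u. 0 < s \<Longrightarrow> g (s *\<^sub>R u) = g u" and s: "0 < s"
  shows "(\<integral>u. indicator (ball 0 s) u * g u \<partial>lborel)
       = s ^ DIM('a) * (\<integral>u. indicator (ball 0 1) u * g u \<partial>lborel)"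
proof -
  have *: "indicator (ball 0 s) (s *\<^sub>R u) = (indicator (ball 0 1) u :: real)" for u :: 'a
    using s by (auto simp: indicator_def)
  have "(\<lambda>u. indicator (ball 0 s) u * g u) \<in> borel_measurable borel"
    by (intro borel_measurable_times borel_measurable_indicator assms) auto
  from lborel_integral_affine[OF this, of s 0] show ?thesis
    using s by (simp add: * hom)
qed

text \<open>A piecewise linear cutoff of the unit ball with a transition layer of width \<delta>.
  Its radial slope on the layer is \<open>- 1 / \<delta>\<close>, so for small \<delta> minus its
  gradient acts like the outward normal times surface measure, while for fixed \<delta> it is
  Lipschitz.\<close>

definition ramp :: "real \<Rightarrow> 'a::real_normed_vector \<Rightarrow> real" where
  "ramp \<delta> u = max 0 (min 1 ((1 - norm u) / \<delta>))"

lemma ramp_bounds: "0 \<le> ramp \<delta> u" "ramp \<delta> u \<le> 1"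
  by (auto simp: ramp_def)

lemma ramp_eq_0: "0 < \<delta> \<Longrightarrow> 1 \<le> norm u \<Longrightarrow> ramp \<delta> u = 0"
  by (auto simp: ramp_def field_simps min_def max_def)

lemma ramp_eq_1: "0 < \<delta> \<Longrightarrow> norm u \<le> 1 - \<delta> \<Longrightarrow> ramp \<delta> u = 1"
  by (auto simp: ramp_def field_simps min_def max_def)

lemma ramp_eq: "0 < \<delta> \<Longrightarrow> 1 - \<delta> \<le> norm u \<Longrightarrow> norm u \<le> 1 \<Longrightarrow> ramp \<delta> u = (1 - norm u) / \<delta>"
  by (auto simp: ramp_def field_simps min_def max_def)

lemma ramp_measurable [measurable]: "ramp \<delta> \<in> borel_measurable borel"
  unfolding ramp_def by measurable

lemma ramp_lipschitz:
  assumes "0 < \<delta>"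
  shows "\<bar>ramp \<delta> u - ramp \<delta> v\<bar> \<le> norm (u - v) / \<delta>"
proof -
  have "\<bar>ramp \<delta> u - ramp \<delta> v\<bar> \<le> \<bar>(1 - norm u) / \<delta> - (1 - norm v) / \<delta>\<bar>"
    unfolding ramp_def by linarith
  also have "\<dots> = \<bar>norm v - norm u\<bar> / \<delta>"
    using assms by (simp add: diff_divide_distrib[symmetric])
  also have "\<dots> \<le> norm (u - v) / \<delta>"
    using assms norm_triangle_ineq3[of v u] by (simp add: divide_right_mono norm_minus_commute)
  finally show ?thesis .
qed

text \<open>The two excluded spheres are the kinks of the ramp. The quotient has reversed sign
  because the shift is transferred from the objective to the ramp by a translation.\<close>

lemma ramp_difference_quotient:
  fixes u d :: "'a::real_inner"
  assumes \<delta>: "0 < \<delta>" "\<delta> < 1" and u: "norm u \<noteq> 1" "norm u \<noteq> 1 - \<delta>"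
  shows "((\<lambda>h. (ramp \<delta> u - ramp \<delta> (u + h *\<^sub>R d)) / h) \<longlongrightarrow>
          (if 1 - \<delta> < norm u \<and> norm u < 1 then (u \<bullet> d) / norm u / \<delta> else 0)) (at_right 0)"
proof -
  have cont: "((\<lambda>h. norm (u + h *\<^sub>R d)) \<longlongrightarrow> norm (u + 0 *\<^sub>R d)) (at_right 0)"
    by (intro tendsto_intros)
  consider "norm u < 1 - \<delta>" | "1 < norm u" | "1 - \<delta> < norm u" "norm u < 1"
    using u by linarith
  then show ?thesis
  proof cases
    case 1
    then have "\<forall>\<^sub>F h in at_right 0. norm (u + h *\<^sub>R d) < 1 - \<delta>"
      using cont by (intro order_tendstoD(2)[OF cont]) auto
    then have "\<forall>\<^sub>F h in at_right 0. (ramp \<delta> u - ramp \<delta> (u + h *\<^sub>R d)) / h = 0"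
      by eventually_elim (use 1 \<delta> in \<open>simp add: ramp_eq_1\<close>)
    with 1 show ?thesis by (simp add: tendsto_eventually)
  next
    case 2
    then have "\<forall>\<^sub>F h in at_right 0. 1 < norm (u + h *\<^sub>R d)"
      using cont by (intro order_tendstoD(1)[OF cont]) auto
    then have "\<forall>\<^sub>F h in at_right 0. (ramp \<delta> u - ramp \<delta> (u + h *\<^sub>R d)) / h = 0"
      by eventually_elim (use 2 \<delta> in \<open>simp add: ramp_eq_0\<close>)
    with 2 show ?thesis by (simp add: tendsto_eventually)
  next
    case 3
    then have u0: "u \<noteq> 0" using \<delta> by auto
    have "((\<lambda>h. norm (u + h *\<^sub>R d)) has_real_derivative (u \<bullet> d) / norm u) (at 0 within {0<..})"
    proof -
      have "(norm has_derivative (\<lambda>k. k \<bullet> sgn (u + 0 *\<^sub>R d))) (at (u + 0 *\<^sub>R d))"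
        using has_derivative_norm[of u] u0 by simp
      moreover have "((\<lambda>h. u + h *\<^sub>R d) has_derivative (\<lambda>h. h *\<^sub>R d)) (at 0 within {0<..})"
        by (auto intro!: derivative_eq_intros)
      ultimately have "((\<lambda>h. norm (u + h *\<^sub>R d)) has_derivative (\<lambda>k. (k *\<^sub>R d) \<bullet> sgn (u + 0 *\<^sub>R d))) (at 0 within {0<..})"
        using has_derivative_compose[of "\<lambda>h. u + h *\<^sub>R d" "\<lambda>h. h *\<^sub>R d" 0 "{0<..}" norm
            "\<lambda>k. k \<bullet> sgn (u + 0 *\<^sub>R d)"] by simp
      then show ?thesis
        unfolding has_field_derivative_def
        by (rule has_derivative_eq_rhs) (auto simp: sgn_div_norm inner_commute divide_inverse fun_eq_iff)
    qed
    then have lim: "((\<lambda>h. (norm (u + h *\<^sub>R d) - norm u) / h) \<longlongrightarrow> (u \<bullet> d) / norm u) (at_right 0)"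
      by (simp add: has_field_derivative_iff)
    have "\<forall>\<^sub>F h in at_right 0. 1 - \<delta> < norm (u + h *\<^sub>R d)" "\<forall>\<^sub>F h in at_right 0. norm (u + h *\<^sub>R d) < 1"
      using 3 by (intro order_tendstoD[OF cont]; simp)+
    then have "\<forall>\<^sub>F h in at_right 0. (norm (u + h *\<^sub>R d) - norm u) / h / \<delta> = (ramp \<delta> u - ramp \<delta> (u + h *\<^sub>R d)) / h"
      by eventually_elim (use 3 \<delta> in \<open>simp add: ramp_eq diff_divide_distrib[symmetric]\<close>)
    moreover have "((\<lambda>h. (norm (u + h *\<^sub>R d) - norm u) / h / \<delta>) \<longlongrightarrow> (u \<bullet> d) / norm u / \<delta>) (at_right 0)"
      using \<delta> by (intro tendsto_divide lim tendsto_const) auto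
    ultimately show ?thesis
      using 3 Lim_transform_eventually by fastforce
  qed
qed

text \<open>A one-sided divergence theorem for nonsmooth \<open>F\<close>. For
  \<open>0 < h \<le> 1\<close> convexity gives
  \<open>F u - F (u - h *\<^sub>R d) \<ge> h * (F u - F (u - d))\<close>. Averaged against the ramp,
  the right side is at least \<open>h * (F 0 - F (- d) - L)\<close> times the mass of the ramp, and
  a translation moves the difference on the left to the ramp. Then \<open>h\<close>, and afterwards
  the width of the ramp, tend to zero.\<close>

lemma sphere_mean_subgradient:
  fixes F :: "'a::euclidean_space \<Rightarrow> real"
  assumes conv: "convex_on C F" and lip: "L-lipschitz_on C F" and C: "closed C"
    and B0: "cball 0 1 \<subseteq> C" and Bd: "cball (-d) 1 \<subseteq> C"
  shows "(F 0 - F (-d) - L) * measure lborel (ball 0 1 :: 'a set)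
     \<le> DIM('a) * (\<integral>u. indicator (ball 0 1) u * (F (u /\<^sub>R norm u) * ((u \<bullet> d) / norm u)) \<partial>lborel)"
proof -
  \<comment> \<open>\<open>F\<close> is controlled only on the closed set \<open>C\<close>; cutting
    it off there makes it Borel on the whole space. The unit ball and its translates by
    \<open>- (h *\<^sub>R d)\<close> with \<open>0 \<le> h \<le> 1\<close> lie in \<open>C\<close>
    by convexity, so the cutoff does not change the values that matter.\<close>
  define F0 where "F0 u = indicator C u * F u" for u
  define c where "c = F 0 - F (-d) - L"
  define V where "V = measure lborel (ball 0 1 :: 'a set)"
  define n where "n = DIM('a)"
  define H where "H u = F0 (u /\<^sub>R norm u) * ((u \<bullet> d) / norm u)" for u
  define I where "I = (\<integral>u. indicator (ball 0 1) u * H u \<partial>lborel)"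
  have L0: "0 \<le> L" using lip by (rule lipschitz_on_nonneg)
  have F_meas [measurable]: "F0 \<in> borel_measurable borel"
    unfolding F0_def using borel_measurable_continuous_on_indicator[of C F]
      lipschitz_on_continuous_on[OF lip] C by simp
  have [measurable]: "H \<in> borel_measurable borel"
    unfolding H_def by measurable
  have zC: "0 \<in> C" using B0 by auto
  have F0_bound: "\<bar>F0 u\<bar> \<le> \<bar>F 0\<bar> + L * norm u" for u
    using lipschitz_onD[OF lip _ zC, of u] L0 by (auto simp: F0_def dist_norm indicator_def)
  have F0_bound1: "\<bar>F0 u\<bar> \<le> \<bar>F 0\<bar> + L * R" if "norm u \<le> R" for u R
    using F0_bound[of u] mult_left_mono[OF that L0] by linarith
  have H_bound: "\<bar>H u\<bar> \<le> (\<bar>F 0\<bar> + L) * norm d" for u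
  proof -
    have 1: "\<bar>F0 (u /\<^sub>R norm u)\<bar> \<le> \<bar>F 0\<bar> + L * 1"
      by (rule F0_bound1) (cases "u = 0"; simp)
    have 2: "\<bar>(u \<bullet> d) / norm u\<bar> \<le> norm d"
    proof (cases "u = 0")
      case False
      then show ?thesis using Cauchy_Schwarz_ineq2[of u d] by (simp add: pos_divide_le_eq mult.commute)
    qed simp
    have "\<bar>F0 (u /\<^sub>R norm u)\<bar> * \<bar>(u \<bullet> d) / norm u\<bar> \<le> (\<bar>F 0\<bar> + L * 1) * norm d"
      using 1 2 L0 by (intro mult_mono) auto
    then show ?thesis by (simp add: H_def abs_mult)
  qed
  have H_hom: "H (s *\<^sub>R u) = H u" if "0 < s" for s u
  proof -
    have eq: "(s *\<^sub>R u) /\<^sub>R norm (s *\<^sub>R u) = u /\<^sub>R norm u"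
      using that by simp
    show ?thesis unfolding H_def using that by (simp only: eq) simp
  qed
  have V0: "0 \<le> V" by (simp add: V_def)
  have int_ball: "integrable lborel (\<lambda>u. indicator (ball 0 s) u * g u)"
    if [measurable]: "g \<in> borel_measurable borel" and "\<And>u. \<bar>g u\<bar> \<le> M"
    for s and g :: "'a \<Rightarrow> real" and M
  proof (rule integrable_lborel_bounded_support[where R = "\<bar>s\<bar>" and M = M])
    have "0 \<le> M" using that(2)[of 0] by linarith
    then show "\<bar>indicator (ball 0 s) u * g u\<bar> \<le> M" for u
      using that(2)[of u] by (cases "u \<in> ball 0 s") auto
    show "(\<lambda>u. indicator (ball 0 s) u * g u) \<in> borel_measurable borel"
      by (intro borel_measurable_times borel_measurable_indicator that) auto
  qed auto

  \<comment> \<open>The inequality before the limit. The mass of the ramp lies between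
    \<open>(1 - \<delta>) ^ n * V\<close> and \<open>V\<close>; as \<open>c\<close> may be negative,
    this uncertainty is charged with the factor \<open>\<bar>c\<bar>\<close>. The last term on the
    right pays for moving the argument of \<open>F\<close> radially to the sphere.\<close>
  have ineq: "c * (V * (1 - \<delta>) ^ n) - \<bar>c\<bar> * V * (1 - (1 - \<delta>) ^ n)
      \<le> (1 - (1 - \<delta>) ^ n) / \<delta> * I
        + L * norm d * V * (1 - (1 - \<delta>) ^ n)"
    if \<delta>: "0 < \<delta>" "\<delta> < 1" for \<delta>
  proof -
    define p where "p = (ramp \<delta> :: 'a \<Rightarrow> real)"
    \<comment> \<open>Outside this radius both \<open>u\<close> and \<open>u + h *\<^sub>R d\<close>
      with \<open>0 < h \<le> 1\<close> are off the support of the ramp, so one ball contains all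
      supports.\<close>
    define R where "R = 1 + norm d"
    define K where "K = \<bar>F 0\<bar> + L * R"
    have [measurable]: "p \<in> borel_measurable borel" by (simp add: p_def)
    have p: "0 \<le> p u" "p u \<le> 1" "1 \<le> norm u \<Longrightarrow> p u = 0" for u
      using ramp_bounds[of \<delta> u] ramp_eq_0[of \<delta> u] \<delta> by (auto simp: p_def)
    have K0: "0 \<le> K" using L0 by (simp add: K_def R_def)
    have F0K: "\<bar>F0 u\<bar> \<le> K" if "norm u \<le> R" for u
      using F0_bound1[OF that] by (simp add: K_def)
    have R1: "1 \<le> R" by (simp add: R_def)
    define q where "q = (\<integral>u. p u \<partial>lborel)"
    have int_p: "integrable lborel p"
      by (rule integrable_lborel_bounded_support[where R = 1 and M = 1]) (use p in auto)
    have int_p_mult: "integrable lborel (\<lambda>u. p u * g u)"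
      if [measurable]: "g \<in> borel_measurable borel" and "\<And>u. norm u \<le> 1 \<Longrightarrow> \<bar>g u\<bar> \<le> M" for g M
    proof (rule integrable_lborel_bounded_support[where R = 1 and M = M])
      show "\<bar>p u * g u\<bar> \<le> M" if "norm u \<le> 1" for u
      proof -
        have "p u * \<bar>g u\<bar> \<le> 1 * M"
          using p[of u] \<open>\<And>u. norm u \<le> 1 \<Longrightarrow> \<bar>g u\<bar> \<le> M\<close>[OF that] by (intro mult_mono) auto
        then show ?thesis using p[of u] by (simp add: abs_mult)
      qed
    qed (use p in auto)
    have int_pF: "integrable lborel (\<lambda>u. p u * F0 (u + w))" if "norm w \<le> norm d" for w
    proof (rule int_p_mult)
      show "\<bar>F0 (u + w)\<bar> \<le> K" if "norm u \<le> 1" for u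
        using norm_triangle_ineq[of u w] that \<open>norm w \<le> norm d\<close> by (intro F0K) (auto simp: R_def)
    qed simp
    have quot: "c * q \<le> (\<integral>u. F0 u * ((p u - p (u + h *\<^sub>R d)) / h) \<partial>lborel)"
      if h: "0 < h" "h \<le> 1" for h
    proof -
      have hd: "norm (- (h *\<^sub>R d)) \<le> norm d"
        using h by (simp add: mult_left_le_one_le)
      \<comment> \<open>Reflection leaves the ramp unchanged. Pairing \<open>u\<close> with
        \<open>- u\<close>, midpoint convexity bounds the weighted mean below by the value at the
        centre without any Lipschitz loss.\<close>
      have sym: "F 0 * q \<le> (\<integral>u. p u * F0 u \<partial>lborel)"
      proof -
        have "(\<integral>u. p u * F0 u \<partial>lborel) = (\<integral>u. p u * F0 (- u) \<partial>lborel)"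
          using lborel_integral_affine[of "\<lambda>u. p u * F0 u" "-1" 0] by (simp add: p_def ramp_def)
        moreover have "integrable lborel (\<lambda>u. p u * F0 (- u))"
          by (rule int_p_mult[where M = K]) (use R1 in \<open>auto intro!: F0K\<close>)
        moreover have "integrable lborel (\<lambda>u. p u * F0 u)"
          using int_pF[of 0] by simp
        ultimately have "2 * (\<integral>u. p u * F0 u \<partial>lborel) = (\<integral>u. p u * (F0 u + F0 (- u)) \<partial>lborel)"
          by (simp add: distrib_left)
        also have "\<dots> \<ge> (\<integral>u. p u * (2 * F 0) \<partial>lborel)"
        proof (rule integral_mono)
          show "integrable lborel (\<lambda>u. p u * (2 * F 0))" using int_p by simp
          show "integrable lborel (\<lambda>u. p u * (F0 u + F0 (- u)))"
            using \<open>integrable lborel (\<lambda>u. p u * F0 (- u))\<close> \<open>integrable lborel (\<lambda>u. p u * F0 u)\<close>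
            by (simp add: distrib_left)
          show "p u * (2 * F 0) \<le> p u * (F0 u + F0 (- u))" for u
          proof (cases "norm u \<le> 1")
            case True
            then have uC: "u \<in> C" "- u \<in> C" using B0 by auto
            have "F ((1/2) *\<^sub>R u + (1/2) *\<^sub>R (- u)) \<le> (1/2) * F u + (1/2) * F (- u)"
              using convex_onD[OF conv _ _ uC, of "1/2"] by simp
            then show ?thesis using uC p[of u] by (intro mult_left_mono) (auto simp: F0_def)
          qed (simp add: p)
        qed
        finally show ?thesis by (simp add: mult.commute q_def)
      qed
      \<comment> \<open>Translation invariance: from here on the difference quotient is that of the
        ramp.\<close>
      have shift: "(\<integral>u. p u * F0 (u - h *\<^sub>R d) \<partial>lborel) = (\<integral>u. F0 u * p (u + h *\<^sub>R d) \<partial>lborel)"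
        and int_shift: "integrable lborel (\<lambda>u. F0 u * p (u + h *\<^sub>R d))"
        using lborel_integral_affine[of "\<lambda>u. p u * F0 (u - h *\<^sub>R d)" 1 "h *\<^sub>R d"]
          lborel_integrable_affine[OF int_pF[OF hd], of 1 "h *\<^sub>R d"] by (simp_all add: ac_simps)
      have "h * (c * q)
          \<le> h * ((\<integral>u. p u * F0 u \<partial>lborel) - (F (-d) + L) * q)"
        using sym h by (intro mult_left_mono) (auto simp: c_def algebra_simps)
      also have "\<dots> = (\<integral>u. p u * (h * (F0 u - (F (-d) + L))) \<partial>lborel)"
        using int_pF[of 0] int_p by (simp add: right_diff_distrib mult.left_commute mult.commute q_def)
      also have "\<dots> \<le> (\<integral>u. p u * (F0 u - F0 (u + - (h *\<^sub>R d))) \<partial>lborel)"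
      proof (rule integral_mono)
        show "integrable lborel (\<lambda>u. p u * (h * (F0 u - (F (-d) + L))))"
          using int_pF[of 0] int_p by (simp add: right_diff_distrib mult.left_commute)
        show "integrable lborel (\<lambda>u. p u * (F0 u - F0 (u + - (h *\<^sub>R d))))"
          using int_pF[of 0] int_pF[OF hd] by (simp add: right_diff_distrib)
        show "p u * (h * (F0 u - (F (-d) + L))) \<le> p u * (F0 u - F0 (u + - (h *\<^sub>R d)))" for u
        proof (cases "norm u \<le> 1")
          case True
          then have uC: "u \<in> C" "u - d \<in> C" "- d \<in> C" using B0 Bd by (auto simp: dist_norm)
          \<comment> \<open>The shifted point lies on the segment from \<open>u\<close> to
            \<open>u - d\<close>, whose ends belong to the two balls contained in
            \<open>C\<close>.\<close>
          have eq: "u + - (h *\<^sub>R d) = (1 - h) *\<^sub>R u + h *\<^sub>R (u - d)" by (simp add: algebra_simps)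
          have "u + - (h *\<^sub>R d) \<in> C"
            unfolding eq using uC h convex_on_imp_convex[OF conv] by (intro convexD) auto
          moreover have "F (u + - (h *\<^sub>R d)) \<le> (1 - h) * F u + h * F (u - d)"
            unfolding eq using convex_onD[OF conv _ _ uC(1,2), of h] h by simp
          moreover have "F (u - d) \<le> F (-d) + L"
          proof -
            have "\<bar>F (u - d) - F (- d)\<bar> \<le> L * norm u"
              using lipschitz_onD[OF lip uC(2,3)] by (simp add: dist_norm)
            then show ?thesis using mult_left_mono[OF True L0] by linarith
          qed
          then have "h * F (u - d) \<le> h * (F (-d) + L)" using h by (intro mult_left_mono) auto
          ultimately show ?thesis
            using uC p[of u] by (intro mult_left_mono) (auto simp: F0_def algebra_simps)
        qed (simp add: p)
      qed
      also have "\<dots> = (\<integral>u. p u * F0 u \<partial>lborel) - (\<integral>u. p u * F0 (u + - (h *\<^sub>R d)) \<partial>lborel)"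
        using int_pF[of 0] int_pF[OF hd] by (simp add: right_diff_distrib)
      also have "\<dots> = (\<integral>u. F0 u * p u \<partial>lborel) - (\<integral>u. F0 u * p (u + h *\<^sub>R d) \<partial>lborel)"
        using shift by (simp add: mult.commute)
      also have "\<dots> = (\<integral>u. F0 u * p u - F0 u * p (u + h *\<^sub>R d) \<partial>lborel)"
        using int_shift int_pF[of 0] by (simp add: mult.commute)
      also have "\<dots> = (\<integral>u. h * (F0 u * ((p u - p (u + h *\<^sub>R d)) / h)) \<partial>lborel)"
        using h by (intro Bochner_Integration.integral_cong) (auto simp: right_diff_distrib[symmetric])
      also have "\<dots> = h * (\<integral>u. F0 u * ((p u - p (u + h *\<^sub>R d)) / h) \<partial>lborel)"
        by (rule integral_mult_right_zero)
      finally show ?thesis using h by (simp only: mult_le_cancel_left_pos)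
    qed
    define sh where "sh u = (indicator (ball 0 1) u - indicator (ball 0 (1 - \<delta>)) u :: real)" for u :: 'a
    have sh: "sh u = (if 1 - \<delta> \<le> norm u \<and> norm u < 1 then 1 else 0)" for u
      using \<delta> by (auto simp: sh_def indicator_def)
    have [measurable]: "sh \<in> borel_measurable borel" unfolding sh_def by (intro borel_measurable_diff borel_measurable_indicator) auto
    \<comment> \<open>\<open>H\<close> evaluates \<open>F\<close> at the radial projection to the
      sphere. On the layer this moves the argument by at most \<delta>, and the added constant
      absorbs the error; the sum still depends on the direction alone, so the scaling lemma
      applies.\<close>
    define H' where "H' u = H u + L * \<delta> * norm d" for u
    have [measurable]: "H' \<in> borel_measurable borel" unfolding H'_def by measurable
    have int_H: "integrable lborel (\<lambda>u. indicator (ball 0 s) u * H' u)" for s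
    proof (rule int_ball)
      show "\<bar>H' u\<bar> \<le> (\<bar>F 0\<bar> + L) * norm d + \<bar>L * \<delta> * norm d\<bar>" for u
        using H_bound[of u] unfolding H'_def by linarith
    qed simp
    define h where "h i = inverse (real (Suc i))" for i
    have h: "0 < h i" "h i \<le> 1" for i by (auto simp: h_def field_simps)
    have h_lim: "filterlim h (at_right 0) sequentially"
      unfolding h_def filterlim_at
      using LIMSEQ_inverse_real_of_nat by (auto simp del: of_nat_Suc)
    have "(\<lambda>i. \<integral>u. F0 u * ((p u - p (u + h i *\<^sub>R d)) / h i) \<partial>lborel)
        \<longlonglongrightarrow> (\<integral>u. F0 u * (sh u * ((u \<bullet> d) / norm u / \<delta>)) \<partial>lborel)"
    proof (rule integral_dominated_convergence)
      show "integrable lborel (\<lambda>u. K * (norm d / \<delta>) * indicat_real (cball (0::'a) R) u)"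
        by (intro integrable_mult_right integrable_real_indicator emeasure_lborel_cball_finite) auto
      have "AE u in lborel. u \<notin> sphere (0::'a) 1" "AE u in lborel. u \<notin> sphere (0::'a) (1 - \<delta>)"
        using AE_not_in[of "sphere (0::'a) 1" lborel] AE_not_in[of "sphere (0::'a) (1 - \<delta>)" lborel]
          negligible_sphere[of "0::'a"]
        by (simp_all add: negligible_iff_null_sets null_sets_completion_iff)
      then show "AE u in lborel. (\<lambda>i. F0 u * ((p u - p (u + h i *\<^sub>R d)) / h i))
          \<longlonglongrightarrow> F0 u * (sh u * ((u \<bullet> d) / norm u / \<delta>))"
      proof eventually_elim
        case (elim u)
        then have u: "norm u \<noteq> 1" "norm u \<noteq> 1 - \<delta>" by auto
        have eq: "(if 1 - \<delta> < norm u \<and> norm u < 1 then (u \<bullet> d) / norm u / \<delta> else 0)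
            = sh u * ((u \<bullet> d) / norm u / \<delta>)"
          using u by (auto simp: sh)
        show ?case
          using filterlim_compose[OF ramp_difference_quotient[OF \<delta> u, of d] h_lim]
          unfolding eq p_def by (intro tendsto_mult tendsto_const)
      qed
      show "AE u in lborel. norm (F0 u * ((p u - p (u + h i *\<^sub>R d)) / h i))
          \<le> K * (norm d / \<delta>) * indicat_real (cball 0 R) u" for i
      proof (intro AE_I2)
        fix u :: 'a
        have hd: "norm (h i *\<^sub>R d) \<le> norm d" using h[of i] by (simp add: mult_left_le_one_le)
        show "norm (F0 u * ((p u - p (u + h i *\<^sub>R d)) / h i)) \<le> K * (norm d / \<delta>) * indicat_real (cball 0 R) u"
        proof (cases "norm u \<le> R")
          case True
          have "\<bar>p u - p (u + h i *\<^sub>R d)\<bar> \<le> norm (u - (u + h i *\<^sub>R d)) / \<delta>"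
            unfolding p_def by (rule ramp_lipschitz[OF \<delta>(1)])
          also have "\<dots> = norm d / \<delta> * h i" using h[of i] by simp
          finally have "\<bar>(p u - p (u + h i *\<^sub>R d)) / h i\<bar> \<le> norm d / \<delta>"
            using h[of i] by (simp add: pos_divide_le_eq)
          then have "\<bar>F0 u\<bar> * \<bar>(p u - p (u + h i *\<^sub>R d)) / h i\<bar> \<le> K * (norm d / \<delta>)"
            using F0K[OF True] K0 by (intro mult_mono) auto
          then show ?thesis using True by (simp add: abs_mult)
        next
          case False
          have "norm u \<le> norm (u + h i *\<^sub>R d) + norm (h i *\<^sub>R d)"
            using norm_triangle_ineq4[of "u + h i *\<^sub>R d" "h i *\<^sub>R d"] by simp
          then have "1 \<le> norm u" "1 \<le> norm (u + h i *\<^sub>R d)"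
            using False hd norm_ge_zero[of d] unfolding R_def by linarith+
          then show ?thesis using False by (simp add: p)
        qed
      qed
    qed simp_all
    then have "c * q \<le> (\<integral>u. F0 u * (sh u * ((u \<bullet> d) / norm u / \<delta>)) \<partial>lborel)"
      by (rule LIMSEQ_le_const) (use quot h in blast)
    also have "\<dots> \<le> (\<integral>u. sh u * H' u / \<delta> \<partial>lborel)"
    proof (rule integral_mono)
      show "integrable lborel (\<lambda>u. sh u * H' u / \<delta>)"
        using int_H[of 1] int_H[of "1 - \<delta>"] by (simp add: sh_def left_diff_distrib)
      have "norm (u \<bullet> d) / norm u \<le> norm d" if "u \<noteq> 0" for u :: 'a
        using that Cauchy_Schwarz_ineq2[of u d] by (simp add: pos_divide_le_eq mult.commute)
      then have ud: "\<bar>(u \<bullet> d) / norm u\<bar> \<le> norm d" for u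
        by (cases "u = 0") auto
      show "integrable lborel (\<lambda>u. F0 u * (sh u * ((u \<bullet> d) / norm u / \<delta>)))"
      proof (rule integrable_lborel_bounded_support[where R = 1 and M = "K * (1 * (norm d / \<delta>))"])
        show "\<bar>F0 u * (sh u * ((u \<bullet> d) / norm u / \<delta>))\<bar> \<le> K * (1 * (norm d / \<delta>))" if "norm u \<le> 1" for u
          unfolding abs_mult
        proof (intro mult_mono)
          show "\<bar>F0 u\<bar> \<le> K" using that R1 by (intro F0K) auto
          show "\<bar>(u \<bullet> d) / norm u / \<delta>\<bar> \<le> norm d / \<delta>"
            using divide_right_mono[OF ud[of u], of \<delta>] \<delta> by (simp add: abs_divide)
        qed (use K0 \<delta> in \<open>auto simp: sh\<close>)
      qed (use \<delta> in \<open>auto simp: sh\<close>)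
      show "F0 u * (sh u * ((u \<bullet> d) / norm u / \<delta>)) \<le> sh u * H' u / \<delta>" for u
      proof (cases "1 - \<delta> \<le> norm u \<and> norm u < 1")
        case True
        then have u0: "u \<noteq> 0" using \<delta> by auto
        have uC: "u \<in> C" using B0 True by auto
        have "norm (u /\<^sub>R norm u) \<le> 1" by (cases "u = 0") auto
        then have uC': "u /\<^sub>R norm u \<in> C" using B0 by (auto simp del: norm_scaleR)
        have "norm (u - u /\<^sub>R norm u) \<le> \<delta>"
        proof -
          have "u - u /\<^sub>R norm u = (1 - inverse (norm u)) *\<^sub>R u" by (simp add: algebra_simps)
          then have "norm (u - u /\<^sub>R norm u) = \<bar>(1 - inverse (norm u)) * norm u\<bar>" by (simp add: abs_mult)
          also have "\<dots> = \<bar>norm u - 1\<bar>" using u0 by (simp add: algebra_simps)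
          finally show ?thesis using True by simp
        qed
        then have "\<bar>F0 u - F0 (u /\<^sub>R norm u)\<bar> \<le> L * \<delta>"
          using lipschitz_onD[OF lip uC uC'] mult_left_mono[OF _ L0] uC uC'
          by (fastforce simp: F0_def dist_norm)
        then have "\<bar>F0 u - F0 (u /\<^sub>R norm u)\<bar> * \<bar>(u \<bullet> d) / norm u\<bar> \<le> L * \<delta> * norm d"
          using ud[of u] L0 \<delta> by (intro mult_mono) auto
        then have "(F0 u - F0 (u /\<^sub>R norm u)) * ((u \<bullet> d) / norm u) \<le> L * \<delta> * norm d"
          unfolding abs_mult[symmetric] by linarith
        then have "F0 u * ((u \<bullet> d) / norm u) \<le> H' u"
          unfolding H_def H'_def left_diff_distrib by linarith
        then have "F0 u * ((u \<bullet> d) / norm u) / \<delta> \<le> H' u / \<delta>"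
          using \<delta> by (intro divide_right_mono) auto
        then show ?thesis using True by (simp add: sh)
      qed (auto simp: sh)
    qed
    \<comment> \<open>The layer is the difference of two concentric balls, and the integral of a
      function of the direction scales with the \<open>n\<close>-th power of the radius.\<close>
    also have "\<dots> = (1 - (1 - \<delta>) ^ n) / \<delta> * (\<integral>u. indicator (ball 0 1) u * H' u \<partial>lborel)"
    proof -
      have "(\<integral>u. sh u * H' u / \<delta> \<partial>lborel)
        = ((\<integral>u. indicator (ball 0 1) u * H' u \<partial>lborel)
          - (\<integral>u. indicator (ball 0 (1 - \<delta>)) u * H' u \<partial>lborel)) / \<delta>"
        unfolding sh_def left_diff_distrib using int_H by (simp add: diff_divide_distrib)
      also have "(\<integral>u. indicator (ball 0 (1 - \<delta>)) u * H' u \<partial>lborel)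
          = (1 - \<delta>) ^ n * (\<integral>u. indicator (ball 0 1) u * H' u \<partial>lborel)"
        unfolding n_def using \<delta> by (intro integral_homogeneous_ball) (auto simp: H'_def H_hom)
      finally show ?thesis by (simp add: algebra_simps diff_divide_distrib)
    qed
    also have "(\<integral>u. indicator (ball 0 1) u * H' u \<partial>lborel)
        = I + L * \<delta> * norm d * V"
    proof -
      have "integrable lborel (\<lambda>u. indicator (ball 0 1) u * H u)"
        using H_bound by (intro int_ball) auto
      moreover have "integrable lborel (\<lambda>u. indicator (ball (0::'a) 1) u * (L * \<delta> * norm d))"
        by (rule int_ball[of "\<lambda>_. L * \<delta> * norm d" "\<bar>L * \<delta> * norm d\<bar>"]) auto
      moreover have "(\<integral>u. indicator (ball (0::'a) 1) u * (L * \<delta> * norm d) \<partial>lborel) = L * \<delta> * norm d * V"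
        by (simp add: V_def)
      ultimately show ?thesis
        unfolding H'_def distrib_left I_def by (subst Bochner_Integration.integral_add) simp_all
    qed
    also have "(1 - (1 - \<delta>) ^ n) / \<delta> * (I + L * \<delta> * norm d * V)
       = (1 - (1 - \<delta>) ^ n) / \<delta> * I
        + L * norm d * V * (1 - (1 - \<delta>) ^ n)"
      using \<delta> by (simp add: distrib_left)
    finally have upper: "c * q
       \<le> (1 - (1 - \<delta>) ^ n) / \<delta> * I
        + L * norm d * V * (1 - (1 - \<delta>) ^ n)" .
    have "q \<le> (\<integral>u. indicator (ball (0::'a) 1) u * 1 \<partial>lborel)"
      unfolding q_def using int_p int_ball[of "\<lambda>_. 1" 1 1] p by (intro integral_mono) (auto simp: indicator_def)
    then have p_V: "q \<le> V" by (simp add: V_def)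
    have "(1 - \<delta>) ^ n * V = (\<integral>u. indicator (ball (0::'a) (1 - \<delta>)) u * 1 \<partial>lborel)"
      unfolding n_def using \<delta> by (subst integral_homogeneous_ball) (auto simp: V_def)
    also have "\<dots> \<le> q"
      unfolding q_def using int_p int_ball[of "\<lambda>_. 1" 1 "1 - \<delta>"] p \<delta>
      by (intro integral_mono) (auto simp: indicator_def p_def ramp_eq_1)
    finally have V_p: "(1 - \<delta>) ^ n * V \<le> q" .
    have "\<bar>c\<bar> * \<bar>q - (1 - \<delta>) ^ n * V\<bar> \<le> \<bar>c\<bar> * (V - (1 - \<delta>) ^ n * V)"
      using p_V V_p by (intro mult_left_mono) auto
    then have "- (\<bar>c\<bar> * (V - (1 - \<delta>) ^ n * V)) \<le> c * (q - (1 - \<delta>) ^ n * V)"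
      unfolding abs_mult[symmetric] by linarith
    then show ?thesis using upper by (simp add: algebra_simps)
  qed
  have lim: "((\<lambda>\<delta>. c * (V * (1 - \<delta>) ^ n) - \<bar>c\<bar> * V * (1 - (1 - \<delta>) ^ n)) \<longlongrightarrow>
       c * (V * (1 - 0) ^ n) - \<bar>c\<bar> * V * (1 - (1 - 0) ^ n)) (at_right 0)"
    by (intro tendsto_intros)
  \<comment> \<open>This derivative is, up to sign, the ratio of surface to volume of the unit ball
    and the source of the dimension factor in the gradient estimate.\<close>
  have "((\<lambda>\<delta>. (1 - \<delta>) ^ n) has_real_derivative - real n) (at 0 within {0<..})"
    by (auto intro!: derivative_eq_intros)
  then have "((\<lambda>\<delta>. - (((1 - \<delta>) ^ n - 1) / \<delta>)) \<longlongrightarrow> - (- real n)) (at_right 0)"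
    by (intro tendsto_minus) (simp add: has_field_derivative_iff)
  then have lim': "((\<lambda>\<delta>. (1 - (1 - \<delta>) ^ n) / \<delta>) \<longlongrightarrow> real n) (at_right 0)"
    by (simp add: minus_divide_left)
  have "((\<lambda>\<delta>. (1 - (1 - \<delta>) ^ n) / \<delta> * I
        + L * norm d * V * (1 - (1 - \<delta>) ^ n)) \<longlongrightarrow>
       real n * I
        + L * norm d * V * (1 - (1 - 0) ^ n)) (at_right 0)"
    by (intro tendsto_intros lim')
  moreover have "\<forall>\<^sub>F \<delta> in at_right (0::real). 0 < \<delta> \<and> \<delta> < 1"
    by (rule eventually_at_rightI[of 0 1]) auto
  ultimately have "c * (V * (1 - 0) ^ n) - \<bar>c\<bar> * V * (1 - (1 - 0) ^ n)
      \<le> real n * I + L * norm d * V * (1 - (1 - 0) ^ n)"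
    using ineq by (intro tendsto_le[OF trivial_limit_at_right_real _ lim])
      (auto elim!: eventually_mono simp del: times_divide_eq_left)
  also have "I = (\<integral>u. indicator (ball 0 1) u * (F (u /\<^sub>R norm u) * ((u \<bullet> d) / norm u)) \<partial>lborel)"
    unfolding I_def
  proof (intro Bochner_Integration.integral_cong refl)
    fix u :: 'a
    have "norm (u /\<^sub>R norm u) \<le> 1" by (cases "u = 0") auto
    then have "u /\<^sub>R norm u \<in> C" using B0 by (auto simp del: norm_scaleR)
    then show "indicator (ball 0 1) u * H u
        = indicator (ball 0 1) u * (F (u /\<^sub>R norm u) * ((u \<bullet> d) / norm u))"
      by (simp add: H_def F0_def)
  qed
  finally show ?thesis by (simp add: c_def V_def n_def)
qed

section \<open>The uniform law on a sphere\<close>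

lemma integral_uniform_sphere:
  fixes g :: "'a::euclidean_space \<Rightarrow> real"
  assumes [measurable]: "g \<in> borel_measurable borel"
  shows "(\<integral>v. g v \<partial>uniform_sphere e)
    = (\<integral>u. indicator (ball 0 1) u * g ((e / norm u) *\<^sub>R u) \<partial>lborel) / measure lborel (ball 0 1 :: 'a set)"
proof -
  define V where "V = measure lborel (ball 0 1 :: 'a set)"
  have V: "0 < V" by (simp add: V_def)
  have [measurable]: "ball (0::'a) 1 \<in> sets borel" by simp
  have "uniform_measure lborel (ball 0 1 :: 'a set) = density lborel (\<lambda>u. ennreal (indicator (ball 0 1) u / V))"
    unfolding uniform_measure_def
  proof (rule density_cong)
    have "emeasure lborel (ball 0 1 :: 'a set) = ennreal V"
      unfolding V_def using emeasure_lborel_ball_finite[of "0::'a" 1]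
      by (intro emeasure_eq_ennreal_measure) (metis infinity_ennreal_def less_irrefl)
    then show "AE u in lborel. indicator (ball 0 1) u / emeasure lborel (ball 0 1 :: 'a set) = ennreal (indicator (ball 0 1) u / V)"
      using V by (auto simp: indicator_def divide_ennreal ennreal_1[symmetric] simp del: ennreal_1)
  qed measurable
  then have "(\<integral>v. g v \<partial>uniform_sphere e) = (\<integral>u. indicator (ball 0 1) u / V * g ((e / norm u) *\<^sub>R u) \<partial>lborel)"
    unfolding uniform_sphere_def using V by (simp add: integral_distr integral_density)
  then show ?thesis by (simp add: V_def)
qed

text \<open>Substituting \<open>x + e *\<^sub>R u\<close> with
  \<open>d = (x - z) /\<^sub>R e\<close> places \<open>x\<close> at the origin and \<open>z\<close>
  at \<open>- d\<close>, and it turns the Lipschitz constant into \<open>e * L\<close>, which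
  becomes the bias. Subtracting \<open>f x\<close> leaves the left side unchanged and produces the
  two-point difference of the estimate.\<close>

lemma uniform_sphere_mean_subgradient:
  fixes f :: "'a::euclidean_space \<Rightarrow> real"
  assumes [measurable]: "f \<in> borel_measurable borel"
    and conv: "convex_on C f" and lip: "L-lipschitz_on C f" and C: "closed C"
    and e: "0 < e" and x: "cball x e \<subseteq> C" and z: "cball z e \<subseteq> C"
  shows "f x - f z - e * L
    \<le> (\<integral>v. DIM('a) * (f (x + v) - f x) / (norm v * e) * (v \<bullet> (x - z)) \<partial>uniform_sphere e)"
proof -
  define F where "F u = f (x + e *\<^sub>R u) - f x" for u
  define d where "d = (x - z) /\<^sub>R e"
  define D where "D = (\<lambda>u. x + e *\<^sub>R u) -` C"
  define V where "V = measure lborel (ball 0 1 :: 'a set)"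
  have V: "0 < V" by (simp add: V_def)
  have "closed D"
    unfolding D_def using C by (intro closed_vimage continuous_intros)
  moreover have "cball 0 1 \<subseteq> D" using x e by (auto simp: D_def dist_norm subset_iff)
  moreover have "cball (- d) 1 \<subseteq> D"
  proof
    fix u assume "u \<in> cball (- d) 1"
    then have "norm (u + d) \<le> 1" by (simp add: dist_norm norm_minus_commute add.commute)
    moreover have "z - (x + e *\<^sub>R u) = - (e *\<^sub>R (u + d))" using e by (simp add: d_def scaleR_add_right)
    then have "norm (z - (x + e *\<^sub>R u)) = e * norm (u + d)" using e by (simp only: norm_minus_cancel) simp
    ultimately have "x + e *\<^sub>R u \<in> cball z e" using e by (simp add: dist_norm)
    then show "u \<in> D" using z by (auto simp: D_def)
  qed
  moreover have "convex_on D F"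
  proof (rule convex_onI)
    show "convex D"
    proof (rule convexI)
      fix u v and a b :: real assume uv: "u \<in> D" "v \<in> D" and ab: "0 \<le> a" "0 \<le> b" "a + b = 1"
      have "x + e *\<^sub>R (a *\<^sub>R u + b *\<^sub>R v) = (a + b) *\<^sub>R x + e *\<^sub>R (a *\<^sub>R u + b *\<^sub>R v)"
        using ab by simp
      also have "\<dots> = a *\<^sub>R (x + e *\<^sub>R u) + b *\<^sub>R (x + e *\<^sub>R v)" by (simp add: algebra_simps)
      finally show "a *\<^sub>R u + b *\<^sub>R v \<in> D"
        using convexD[OF convex_on_imp_convex[OF conv] _ _ ab] uv by (simp add: D_def)
    qed
    fix t u v assume t: "0 < t" "t < (1::real)" and uv: "u \<in> D" "v \<in> D"
    have eq: "x + e *\<^sub>R ((1 - t) *\<^sub>R u + t *\<^sub>R v) = (1 - t) *\<^sub>R (x + e *\<^sub>R u) + t *\<^sub>R (x + e *\<^sub>R v)"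
      by (simp add: algebra_simps)
    have "f (x + e *\<^sub>R ((1 - t) *\<^sub>R u + t *\<^sub>R v)) \<le> (1 - t) * f (x + e *\<^sub>R u) + t * f (x + e *\<^sub>R v)"
      unfolding eq using convex_onD[OF conv, of t "x + e *\<^sub>R u" "x + e *\<^sub>R v"] t uv by (auto simp: D_def)
    then show "F ((1 - t) *\<^sub>R u + t *\<^sub>R v) \<le> (1 - t) * F u + t * F v"
      by (simp add: F_def algebra_simps)
  qed
  moreover have "(e * L)-lipschitz_on D F"
  proof (rule lipschitz_onI)
    fix u v assume uv: "u \<in> D" "v \<in> D"
    have "dist (F u) (F v) = dist (f (x + e *\<^sub>R u)) (f (x + e *\<^sub>R v))" by (simp add: F_def dist_norm)
    also have "\<dots> \<le> L * dist (x + e *\<^sub>R u) (x + e *\<^sub>R v)"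
      using uv by (intro lipschitz_onD[OF lip]) (auto simp: D_def)
    also have "\<dots> = e * L * dist u v" using e by (simp add: dist_norm scaleR_diff_right[symmetric])
    finally show "dist (F u) (F v) \<le> e * L * dist u v" .
  qed (use e lipschitz_on_nonneg[OF lip] in simp)
  ultimately have "(F 0 - F (- d) - e * L) * V
     \<le> DIM('a) * (\<integral>u. indicator (ball 0 1) u * (F (u /\<^sub>R norm u) * ((u \<bullet> d) / norm u)) \<partial>lborel)"
    unfolding V_def by (intro sphere_mean_subgradient) auto
  also have "\<dots> = (\<integral>u. indicator (ball 0 1) u *
      (DIM('a) * (f (x + (e / norm u) *\<^sub>R u) - f x) / (norm ((e / norm u) *\<^sub>R u) * e)
         * (((e / norm u) *\<^sub>R u) \<bullet> (x - z))) \<partial>lborel)"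
    unfolding integral_mult_right_zero[symmetric]
  proof (intro Bochner_Integration.integral_cong refl)
    fix u :: 'a
    show "DIM('a) * (indicator (ball 0 1) u * (F (u /\<^sub>R norm u) * ((u \<bullet> d) / norm u)))
      = indicator (ball 0 1) u * (DIM('a) * (f (x + (e / norm u) *\<^sub>R u) - f x)
         / (norm ((e / norm u) *\<^sub>R u) * e) * (((e / norm u) *\<^sub>R u) \<bullet> (x - z)))"
    proof (cases "u = 0")
      case False
      then have "norm ((e / norm u) *\<^sub>R u) = e" using e by simp
      moreover have "F (u /\<^sub>R norm u) = f (x + (e / norm u) *\<^sub>R u) - f x" by (simp add: F_def divide_inverse)
      moreover have "(u \<bullet> d) / norm u = ((e / norm u) *\<^sub>R u) \<bullet> (x - z) / (e * e)"
        using e by (simp add: d_def divide_inverse)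
      ultimately show ?thesis by (simp only:) (simp add: mult_ac)
    qed simp
  qed
  also have "\<dots> = (\<integral>v. DIM('a) * (f (x + v) - f x) / (norm v * e) * (v \<bullet> (x - z)) \<partial>uniform_sphere e) * V"
    using V by (subst integral_uniform_sphere) (simp_all add: V_def)
  finally have "F 0 - F (- d) - e * L
      \<le> (\<integral>v. DIM('a) * (f (x + v) - f x) / (norm v * e) * (v \<bullet> (x - z)) \<partial>uniform_sphere e)"
    using V by simp
  moreover have "F 0 - F (- d) = f x - f z" using e by (simp add: F_def d_def)
  ultimately show ?thesis by simp
qed

lemma prob_space_uniform_sphere: "prob_space (uniform_sphere e :: 'a::euclidean_space measure)"
proof -
  have "unit_ball_vol (real DIM('a)) \<noteq> 0"
    using unit_ball_vol_pos[of "real DIM('a)"] by (metis less_irrefl of_nat_0_le_iff)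
  then have "prob_space (uniform_measure lborel (ball 0 1 :: 'a set))"
    by (intro prob_space_uniform_measure) (auto simp: emeasure_ball)
  then show ?thesis
    unfolding uniform_sphere_def by (rule prob_space.prob_space_distr) simp
qed

lemma AE_uniform_sphere_norm:
  assumes "0 \<le> e"
  shows "AE v in (uniform_sphere e :: 'a::euclidean_space measure). norm v = e"
proof -
  have "AE u in lborel. u \<noteq> (0::'a)" by (rule AE_lborel_singleton)
  then have "AE u in uniform_measure lborel (ball 0 1 :: 'a set). u \<noteq> 0"
    by (intro AE_uniform_measureI) auto
  then have "AE u in uniform_measure lborel (ball 0 1 :: 'a set). norm ((e / norm u) *\<^sub>R u) = e"
    by eventually_elim (use assms in simp)
  then show ?thesis
    unfolding uniform_sphere_def by (subst AE_distr_iff) auto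
qed

lemma sets_uniform_sphere [measurable_cong, simp]: "sets (uniform_sphere e) = sets borel"
  and space_uniform_sphere [simp]: "space (uniform_sphere e) = UNIV"
  by (simp_all add: uniform_sphere_def)

section \<open>Independence of the past and series of martingale differences\<close>

lemma (in prob_space) distr_Pair_eq_pair_measure:
  assumes [measurable]: "random_variable S X" "random_variable T Y"
    and prob: "\<And>A B. A \<in> sets S \<Longrightarrow> B \<in> sets T \<Longrightarrow>
      prob ((X -` A \<inter> space M) \<inter> (Y -` B \<inter> space M)) = prob (X -` A \<inter> space M) * prob (Y -` B \<inter> space M)"
  shows "distr M (S \<Otimes>\<^sub>M T) (\<lambda>s. (X s, Y s)) = distr M S X \<Otimes>\<^sub>M distr M T Y"
proof -
  interpret X: prob_space "distr M S X" by (rule prob_space_distr) simp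
  interpret Y: prob_space "distr M T Y" by (rule prob_space_distr) simp
  have "distr M S X \<Otimes>\<^sub>M distr M T Y = distr M (S \<Otimes>\<^sub>M T) (\<lambda>s. (X s, Y s))"
  proof (rule pair_measure_eqI)
    fix A B assume A: "A \<in> sets (distr M S X)" and B: "B \<in> sets (distr M T Y)"
    then have [measurable]: "A \<in> sets S" "B \<in> sets T" by auto
    have "(\<lambda>s. (X s, Y s)) -` (A \<times> B) \<inter> space M = (X -` A \<inter> space M) \<inter> (Y -` B \<inter> space M)"
      by auto
    then show "emeasure (distr M S X) A * emeasure (distr M T Y) B
        = emeasure (distr M (S \<Otimes>\<^sub>M T) (\<lambda>s. (X s, Y s))) (A \<times> B)"
      using prob[of A B] by (simp add: emeasure_distr emeasure_eq_measure ennreal_mult)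
  qed (simp_all add: X.sigma_finite_measure_axioms Y.sigma_finite_measure_axioms)
  then show ?thesis ..
qed

lemma vimage_in_vimage_algebra_PiM:
  assumes U: "\<And>k. U k \<in> measurable M N" and [measurable]: "A \<in> sets N"
  shows "U j -` A \<inter> space M \<in> sets (vimage_algebra (space M) (\<lambda>s k. U k s) (\<Pi>\<^sub>M k\<in>UNIV. N))"
proof -
  have "{h \<in> space (\<Pi>\<^sub>M k\<in>UNIV. N). h j \<in> A} \<in> sets (\<Pi>\<^sub>M k\<in>UNIV. N)" by measurable
  from in_vimage_algebra[OF this, of "\<lambda>s k. U k s" "space M"] show ?thesis
    by (rule back_subst[where P = "\<lambda>S. S \<in> _"])
      (use U[THEN measurable_space] in \<open>auto simp: space_PiM\<close>)
qed

text \<open>Independence of \<open>U\<close> and \<open>W\<close> holds between the whole sequences,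
  so the probability of finitely many rectangle events splits first into the two sequences, then
  along each, and is reassembled index by index. Rectangles are an intersection-stable generator of
  the product.\<close>

lemma (in prob_space) indep_vars_Pair:
  fixes U :: "'i \<Rightarrow> 'a \<Rightarrow> 'b" and W :: "'i \<Rightarrow> 'a \<Rightarrow> 'c"
  assumes U: "indep_vars (\<lambda>_. N) U UNIV" and W: "indep_vars (\<lambda>_. N') W UNIV"
    and UW: "indep_set
      (sets (vimage_algebra (space M) (\<lambda>s k. U k s) (\<Pi>\<^sub>M k\<in>UNIV. N)))
      (sets (vimage_algebra (space M) (\<lambda>s k. W k s) (\<Pi>\<^sub>M k\<in>UNIV. N')))"
  shows "indep_vars (\<lambda>_. N \<Otimes>\<^sub>M N') (\<lambda>k s. (U k s, W k s)) UNIV"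
    and "distr M (N \<Otimes>\<^sub>M N') (\<lambda>s. (U k s, W k s)) = distr M N (U k) \<Otimes>\<^sub>M distr M N' (W k)"
proof -
  have rv [measurable]: "\<And>k. random_variable N (U k)" "\<And>k. random_variable N' (W k)"
    using U W by (auto simp: indep_vars_def)
  note in_U = vimage_in_vimage_algebra_PiM[OF rv(1)] and in_W = vimage_in_vimage_algebra_PiM[OF rv(2)]
  define E where "E i = {(U i -` A \<inter> space M) \<inter> (W i -` B \<inter> space M) | A B. A \<in> sets N \<and> B \<in> sets N'}" for i
  have "indep_sets E UNIV"
  proof (rule indep_setsI)
    show "E i \<subseteq> events" for i by (auto simp: E_def)
    fix D J assume J: "J \<noteq> {}" "finite J" and "\<forall>j\<in>J. D j \<in> E j"
    then obtain A B where A: "\<And>j. j \<in> J \<Longrightarrow> A j \<in> sets N" and B: "\<And>j. j \<in> J \<Longrightarrow> B j \<in> sets N'"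
      and D: "\<And>j. j \<in> J \<Longrightarrow> D j = (U j -` A j \<inter> space M) \<inter> (W j -` B j \<inter> space M)"
      unfolding E_def by simp metis
    have "(\<Inter>j\<in>J. U j -` A j \<inter> space M) \<in> sets (vimage_algebra (space M) (\<lambda>s k. U k s) (\<Pi>\<^sub>M k\<in>UNIV. N))"
      "(\<Inter>j\<in>J. W j -` B j \<inter> space M) \<in> sets (vimage_algebra (space M) (\<lambda>s k. W k s) (\<Pi>\<^sub>M k\<in>UNIV. N'))"
      using J A B by (intro sets.finite_INT in_U in_W; simp)+
    from indep_setD[OF UW this] have "prob (\<Inter>j\<in>J. D j)
        = prob (\<Inter>j\<in>J. U j -` A j \<inter> space M) * prob (\<Inter>j\<in>J. W j -` B j \<inter> space M)"
      using J D by (simp add: INT_Int_distrib cong: INF_cong)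
    also have "prob (\<Inter>j\<in>J. U j -` A j \<inter> space M) = (\<Prod>j\<in>J. prob (U j -` A j \<inter> space M))"
      using U J A unfolding indep_vars_def2 by (intro indep_setsD) auto
    also have "prob (\<Inter>j\<in>J. W j -` B j \<inter> space M) = (\<Prod>j\<in>J. prob (W j -` B j \<inter> space M))"
      using W J B unfolding indep_vars_def2 by (intro indep_setsD) auto
    also have "(\<Prod>j\<in>J. prob (U j -` A j \<inter> space M)) * (\<Prod>j\<in>J. prob (W j -` B j \<inter> space M)) = (\<Prod>j\<in>J. prob (D j))"
      unfolding prod.distrib[symmetric]
      using indep_setD[OF UW in_U in_W] A B D by (intro prod.cong) auto
    finally show "prob (\<Inter>j\<in>J. D j) = (\<Prod>j\<in>J. prob (D j))" .
  qed
  moreover have "Int_stable (E i)" for i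
  proof (rule Int_stableI)
    fix a b assume "a \<in> E i" "b \<in> E i"
    then obtain A B A' B' where "A \<in> sets N" "B \<in> sets N'" "A' \<in> sets N" "B' \<in> sets N'"
      "a = (U i -` A \<inter> space M) \<inter> (W i -` B \<inter> space M)" "b = (U i -` A' \<inter> space M) \<inter> (W i -` B' \<inter> space M)"
      unfolding E_def by auto
    then show "a \<inter> b \<in> E i"
      unfolding E_def by (intro CollectI exI[of _ "A \<inter> A'"] exI[of _ "B \<inter> B'"]) auto
  qed
  ultimately have "indep_sets (\<lambda>i. sigma_sets (space M) (E i)) UNIV"
    by (intro indep_sets_sigma)
  moreover have "{(\<lambda>s. (U i s, W i s)) -` C \<inter> space M | C. C \<in> sets (N \<Otimes>\<^sub>M N')} \<subseteq> sigma_sets (space M) (E i)" for i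
  proof -
    have "{(\<lambda>s. (U i s, W i s)) -` C \<inter> space M | C. C \<in> sets (N \<Otimes>\<^sub>M N')}
      = sigma_sets (space M) {(\<lambda>s. (U i s, W i s)) -` C \<inter> space M | C. C \<in> {a \<times> b |a b. a \<in> sets N \<and> b \<in> sets N'}}"
      unfolding sets_pair_measure
      using rv[THEN measurable_space] by (intro sigma_sets_vimage_commute) auto
    also have "{(\<lambda>s. (U i s, W i s)) -` C \<inter> space M | C. C \<in> {a \<times> b |a b. a \<in> sets N \<and> b \<in> sets N'}} = E i"
    proof -
      have eq: "(U i -` A \<inter> space M) \<inter> (W i -` B \<inter> space M) = (\<lambda>s. (U i s, W i s)) -` (A \<times> B) \<inter> space M" for A B
        by auto
      show ?thesis unfolding E_def eq by blast
    qed
    finally show ?thesis by simp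
  qed
  ultimately show "indep_vars (\<lambda>_. N \<Otimes>\<^sub>M N') (\<lambda>k s. (U k s, W k s)) UNIV"
    unfolding indep_vars_def2 by (auto intro: indep_sets_mono_sets)
  show "distr M (N \<Otimes>\<^sub>M N') (\<lambda>s. (U k s, W k s)) = distr M N (U k) \<Otimes>\<^sub>M distr M N' (W k)"
    using indep_setD[OF UW in_U in_W] by (intro distr_Pair_eq_pair_measure rv) auto
qed

text \<open>The bound \<open>{..<k}\<close> is strict: the iterate with index \<open>k\<close> is
  measurable here, while the noise with index \<open>k\<close> is still independent. Pulling back a
  finite product along a single map turns the past into one random element, to which grouping of
  independent variables applies.\<close>

definition past :: "'s measure \<Rightarrow> 'z measure \<Rightarrow> (nat \<Rightarrow> 's \<Rightarrow> 'z) \<Rightarrow> nat \<Rightarrow> 's measure" where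
  "past M N Z k = vimage_algebra (space M) (\<lambda>s. \<lambda>i\<in>{..<k}. Z i s) (\<Pi>\<^sub>M i\<in>{..<k}. N)"

lemma space_past [simp]: "space (past M N Z k) = space M"
  by (simp add: past_def)

lemma past_measurable:
  assumes "\<And>i. Z i \<in> measurable M N" "i < k"
  shows "Z i \<in> measurable (past M N Z k) N"
proof -
  have "(\<lambda>s. \<lambda>i\<in>{..<k}. Z i s) \<in> measurable (past M N Z k) (\<Pi>\<^sub>M i\<in>{..<k}. N)"
    unfolding past_def using assms(1)[THEN measurable_space]
    by (intro measurable_vimage_algebra1) (auto simp: space_PiM)
  from measurable_compose[OF this measurable_component_singleton[of i "{..<k}"]]
  show ?thesis using assms(2) by simp
qed

lemma subalgebra_past:
  assumes "\<And>i. Z i \<in> measurable M N"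
  shows "subalgebra M (past M N Z k)"
proof -
  have "(\<lambda>s. s) \<in> measurable M (past M N Z k)"
    unfolding past_def using assms by (intro measurable_vimage_algebra2 measurable_restrict) auto
  from measurable_sets[OF this] show ?thesis
    unfolding subalgebra_def using sets.sets_into_space[of _ "past M N Z k"] by (auto simp: Int_absorb2)
qed

lemma past_mono:
  assumes "\<And>i. Z i \<in> measurable M N" "k \<le> l"
  shows "sets (past M N Z k) \<subseteq> sets (past M N Z l)"
proof -
  have "(\<lambda>s. s) \<in> measurable (past M N Z l) (past M N Z k)"
    unfolding past_def[of M N Z k]
  proof (intro measurable_vimage_algebra2 measurable_restrict)
    show "Z i \<in> measurable (past M N Z l) N" if "i \<in> {..<k}" for i
      using that assms by (intro past_measurable) auto
  qed auto
  from measurable_sets[OF this] show ?thesis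
    using sets.sets_into_space[of _ "past M N Z k"] by (auto simp: Int_absorb2)
qed

text \<open>The sample point itself, observed only through the past, plays the role of the first
  variable. Fubini then applies to any past-measurable quantity without factoring it through the
  earlier noise.\<close>

lemma (in prob_space) distr_past_pair:
  assumes Z: "indep_vars (\<lambda>_. N) Z UNIV"
  shows "distr M (past M N Z k \<Otimes>\<^sub>M N) (\<lambda>s. (s, Z k s)) = distr M (past M N Z k) (\<lambda>s. s) \<Otimes>\<^sub>M distr M N (Z k)"
proof (rule distr_Pair_eq_pair_measure)
  have rv: "random_variable N (Z i)" for i using Z by (auto simp: indep_vars_def)
  let ?X = "\<lambda>s. \<lambda>i\<in>{..<k}. Z i s" and ?Y = "\<lambda>s. \<lambda>i\<in>{k}. Z i s"
  have "indep_var (\<Pi>\<^sub>M i\<in>{..<k}. N) ?X (\<Pi>\<^sub>M i\<in>{k}. N) ?Y"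
    by (rule indep_var_restrict[OF Z]) auto
  then have ind: "indep_set (sigma_sets (space M) {?X -` A \<inter> space M | A. A \<in> sets (\<Pi>\<^sub>M i\<in>{..<k}. N)})
      (sigma_sets (space M) {?Y -` A \<inter> space M | A. A \<in> sets (\<Pi>\<^sub>M i\<in>{k}. N)})"
    by (simp add: indep_var_eq)
  show "random_variable N (Z k)" by (rule rv)
  show "(\<lambda>s. s) \<in> measurable M (past M N Z k)"
    using measurable_from_subalg[OF subalgebra_past[of Z M N k], of "\<lambda>s. s" "past M N Z k"] rv by simp
  fix A B assume "A \<in> sets (past M N Z k)" and B [measurable]: "B \<in> sets N"
  then obtain A' where A': "A' \<in> sets (\<Pi>\<^sub>M i\<in>{..<k}. N)" "A = ?X -` A' \<inter> space M"
    unfolding past_def using rv[THEN measurable_space]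
    by (subst (asm) sets_vimage_algebra2) (auto simp: space_PiM)
  have B': "{h \<in> space (\<Pi>\<^sub>M i\<in>{k}. N). h k \<in> B} \<in> sets (\<Pi>\<^sub>M i\<in>{k}. N)" by measurable
  have eq: "Z k -` B \<inter> space M = ?Y -` {h \<in> space (\<Pi>\<^sub>M i\<in>{k}. N). h k \<in> B} \<inter> space M"
    using rv[THEN measurable_space] by (auto simp: space_PiM)
  have "prob (A \<inter> (Z k -` B \<inter> space M)) = prob A * prob (Z k -` B \<inter> space M)"
    unfolding eq using A' B' by (intro indep_setD[OF ind] sigma_sets.Basic) blast+
  moreover have "(\<lambda>s. s) -` A \<inter> space M = A" using A' by auto
  ultimately show "prob (((\<lambda>s. s) -` A \<inter> space M) \<inter> (Z k -` B \<inter> space M))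
      = prob ((\<lambda>s. s) -` A \<inter> space M) * prob (Z k -` B \<inter> space M)" by simp
qed

text \<open>The freezing lemma: what the past determines is held fixed while the fresh noise is
  integrated out. The identity of means also holds after multiplication with the indicator of a past
  event, and this characterises the conditional expectation.\<close>

lemma (in prob_space)
  assumes ind: "distr M (F \<Otimes>\<^sub>M N) (\<lambda>s. (s, Z s)) = distr M F (\<lambda>s. s) \<Otimes>\<^sub>M distr M N Z"
    and sub: "subalgebra M F" and Z [measurable]: "random_variable N Z"
    and [measurable]: "\<Phi> \<in> borel_measurable (F \<Otimes>\<^sub>M N)"
    and int: "integrable M (\<lambda>s. \<Phi> (s, Z s) :: real)"
  shows integrable_fubini_past: "integrable M (\<lambda>s. \<integral>z. \<Phi> (s, z) \<partial>distr M N Z)"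
    and integral_fubini_past: "(\<integral>s. \<Phi> (s, Z s) \<partial>M) = (\<integral>s. (\<integral>z. \<Phi> (s, z) \<partial>distr M N Z) \<partial>M)"
    and cond_exp_fubini_past: "AE s in M. real_cond_exp M F (\<lambda>s. \<Phi> (s, Z s)) s = (\<integral>z. \<Phi> (s, z) \<partial>distr M N Z)"
proof -
  have [measurable]: "(\<lambda>s. s) \<in> measurable M F"
    using measurable_from_subalg[OF sub, of "\<lambda>s. s" F] by simp
  note law = ind[symmetric]
  interpret Z: prob_space "distr M N Z" by (rule prob_space_distr) simp
  interpret X: prob_space "distr M F (\<lambda>s. s)" by (rule prob_space_distr) simp
  interpret P: pair_prob_space "distr M F (\<lambda>s. s)" "distr M N Z" ..
  have meas [measurable]: "(\<lambda>s. \<integral>z. \<Psi> (s, z) \<partial>distr M N Z) \<in> borel_measurable F"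
    if [measurable]: "\<Psi> \<in> borel_measurable (F \<Otimes>\<^sub>M N)" for \<Psi> :: "_ \<Rightarrow> real"
    by (rule Z.borel_measurable_lebesgue_integral) simp
  have gen: "integrable M (\<lambda>s. \<integral>z. \<Psi> (s, z) \<partial>distr M N Z) \<and>
      (\<integral>s. \<Psi> (s, Z s) \<partial>M) = (\<integral>s. (\<integral>z. \<Psi> (s, z) \<partial>distr M N Z) \<partial>M)"
    if [measurable]: "\<Psi> \<in> borel_measurable (F \<Otimes>\<^sub>M N)" and int: "integrable M (\<lambda>s. \<Psi> (s, Z s))"
    for \<Psi> :: "_ \<Rightarrow> real"
  proof -
    have "integrable (distr M F (\<lambda>s. s) \<Otimes>\<^sub>M distr M N Z) \<Psi>"
      unfolding law using int by (subst integrable_distr_eq) auto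
    from P.integrable_fst'[OF this] P.integral_fst'[OF this] show ?thesis
      unfolding law by (simp add: integrable_distr_eq integral_distr)
  qed
  show "integrable M (\<lambda>s. \<integral>z. \<Phi> (s, z) \<partial>distr M N Z)"
    "(\<integral>s. \<Phi> (s, Z s) \<partial>M) = (\<integral>s. (\<integral>z. \<Phi> (s, z) \<partial>distr M N Z) \<partial>M)"
    using gen[OF _ int] by auto
  interpret S: finite_measure_subalgebra M F by unfold_locales (rule sub)
  show "AE s in M. real_cond_exp M F (\<lambda>s. \<Phi> (s, Z s)) s = (\<integral>z. \<Phi> (s, z) \<partial>distr M N Z)"
  proof (rule S.real_cond_exp_charact)
    fix A assume A [measurable]: "A \<in> sets F"
    then have [measurable]: "A \<in> sets M" using sub by (auto simp: subalgebra_def)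
    have "(\<integral>s. (indicator A (fst (s, Z s)) * \<Phi> (s, Z s)) \<partial>M)
        = (\<integral>s. (\<integral>z. indicator A (fst (s, z)) * \<Phi> (s, z) \<partial>distr M N Z) \<partial>M)"
      by (rule gen[of "\<lambda>p. indicator A (fst p) * \<Phi> p", THEN conjunct2])
        (use integrable_mult_indicator[OF \<open>A \<in> sets M\<close> int] in simp_all)
    then show "(\<integral>s\<in>A. \<Phi> (s, Z s) \<partial>M) = (\<integral>s\<in>A. (\<integral>z. \<Phi> (s, z) \<partial>distr M N Z) \<partial>M)"
      by (simp add: set_lebesgue_integral_def)
  qed (use gen[OF _ int] int in auto)
qed

section \<open>Almost sure convergence of square-summable martingale differences\<close>

lemma integrable_mult_of_squares:
  fixes f g :: "'s \<Rightarrow> real"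
  assumes [measurable]: "f \<in> borel_measurable M" "g \<in> borel_measurable M"
    and f: "integrable M (\<lambda>s. (f s)\<^sup>2)" and g: "integrable M (\<lambda>s. (g s)\<^sup>2)"
  shows "integrable M (\<lambda>s. f s * g s)"
proof (rule Bochner_Integration.integrable_bound)
  show "integrable M (\<lambda>s. (f s)\<^sup>2 + (g s)\<^sup>2)" using f g by simp
  have "\<bar>a * b\<bar> \<le> a\<^sup>2 + b\<^sup>2" for a b :: real
  proof -
    have "0 \<le> (\<bar>a\<bar> - \<bar>b\<bar>)\<^sup>2" "0 \<le> a\<^sup>2 + b\<^sup>2" by auto
    then show ?thesis unfolding power2_diff power2_abs abs_mult by linarith
  qed
  then show "AE s in M. norm (f s * g s) \<le> norm ((f s)\<^sup>2 + (g s)\<^sup>2)" by simp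
qed simp

text \<open>Each increment is orthogonal to every square-integrable factor known before it. Stopping
  therefore keeps the second moment below the sum of the variances, and Markov's inequality for the
  square of the stopped sum controls the maximum of a block of partial sums. Small variance tails
  then make almost every path Cauchy.\<close>

lemma (in prob_space) martingale_difference_series_summable:
  fixes \<zeta> :: "nat \<Rightarrow> 'a \<Rightarrow> real"
  assumes sub: "\<And>k. subalgebra M (F k)" and mono: "\<And>k. sets (F k) \<subseteq> sets (F (Suc k))"
    and adapted: "\<And>k. \<zeta> k \<in> borel_measurable (F (Suc k))"
    and sq: "\<And>k. integrable M (\<lambda>s. (\<zeta> k s)\<^sup>2)"
    and zero: "\<And>k. AE s in M. real_cond_exp M (F k) (\<zeta> k) s = 0"
    and summ: "summable (\<lambda>k. \<integral>s. (\<zeta> k s)\<^sup>2 \<partial>M)"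
  shows "AE s in M. summable (\<lambda>k. \<zeta> k s)"
proof -
  define c where "c k = (\<integral>s. (\<zeta> k s)\<^sup>2 \<partial>M)" for k
  have c0: "0 \<le> c k" for k by (simp add: c_def)
  have F_mono: "sets (F k) \<subseteq> sets (F l)" if "k \<le> l" for k l
    using mono that by (rule lift_Suc_mono_le)
  have F_meas: "\<zeta> k \<in> borel_measurable (F l)" if "k < l" for k l
  proof (rule measurable_from_subalg)
    show "subalgebra (F l) (F (Suc k))"
      using F_mono[of "Suc k" l] that sub by (auto simp: subalgebra_def)
  qed (rule adapted)
  have [measurable]: "\<zeta> k \<in> borel_measurable M" for k
    by (rule measurable_from_subalg[OF sub adapted])
  have orth: "(\<integral>s. \<phi> s * \<zeta> k s \<partial>M) = 0"
    if \<phi>: "\<phi> \<in> borel_measurable (F k)" "integrable M (\<lambda>s. (\<phi> s)\<^sup>2)" for \<phi> k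
  proof -
    interpret S: finite_measure_subalgebra M "F k" by unfold_locales (rule sub)
    have "integrable M (\<lambda>s. \<phi> s * \<zeta> k s)"
      using measurable_from_subalg[OF sub \<phi>(1)] \<phi>(2) sq by (intro integrable_mult_of_squares) auto
    from S.real_cond_exp_intg(2)[OF this \<phi>(1)]
    have "(\<integral>s. \<phi> s * \<zeta> k s \<partial>M) = (\<integral>s. \<phi> s * real_cond_exp M (F k) (\<zeta> k) s \<partial>M)" by simp
    also have "\<dots> = (\<integral>s. 0 \<partial>M)"
      using zero[of k] measurable_from_subalg[OF sub \<phi>(1)]
      by (intro integral_cong_AE) auto
    finally show ?thesis by simp
  qed
  define S where "S m n s = (\<Sum>i\<in>{m..<n}. \<zeta> i s)" for m n s
  have S_F [measurable]: "S m j \<in> borel_measurable (F k)" if "j \<le> k" for m j k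
    unfolding S_def using that F_meas by (intro borel_measurable_sum) auto
  have S_M [measurable]: "S m j \<in> borel_measurable M" for m j
    unfolding S_def by measurable
  have maximal: "prob {s \<in> space M. \<exists>j\<in>{m..n}. \<kappa> \<le> \<bar>S m j s\<bar>} \<le> (\<Sum>i\<in>{m..<n}. c i) / \<kappa>\<^sup>2"
    if \<kappa>: "0 < \<kappa>" and mn: "m \<le> n" for \<kappa> m n
  proof -
    \<comment> \<open>Equals one as long as no partial sum from \<open>m\<close> up to
      \<open>k\<close> has reached \<kappa>. Since \<open>S m k\<close> ends with index
      \<open>k - 1\<close>, \<open>T k\<close> is known before \<open>\<zeta> k\<close>, and
      \<open>R\<close> is the sum stopped at the first passage.\<close>
    define T where "T k s = (if \<forall>j\<in>{m..k}. \<bar>S m j s\<bar> < \<kappa> then 1 else 0 :: real)" for k s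
    define R where "R k s = (\<Sum>i\<in>{m..<k}. T i s * \<zeta> i s)" for k s
    have T_F: "T i \<in> borel_measurable (F k)" if "i \<le> k" for i k
    proof -
      have [measurable]: "S m j \<in> borel_measurable (F k)" if "j \<in> {m..i}" for j
        using that \<open>i \<le> k\<close> by (intro S_F) auto
      have "Measurable.pred (F k) (\<lambda>s. \<forall>j\<in>{m..i}. \<bar>S m j s\<bar> < \<kappa>)"
        by (intro pred_intros_finite) measurable
      then show ?thesis unfolding T_def by measurable
    qed
    have R_F: "R k \<in> borel_measurable (F k)" for k
      unfolding R_def by (intro borel_measurable_sum borel_measurable_times T_F F_meas) auto
    have [measurable]: "T k \<in> borel_measurable M" "R k \<in> borel_measurable M" for k
      using measurable_from_subalg[OF sub T_F] measurable_from_subalg[OF sub R_F] by auto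
    have T01: "(T k s)\<^sup>2 \<le> 1" "\<bar>T k s\<bar> \<le> 1" "T k s * T k s = T k s" for k s by (auto simp: T_def)
    have T\<zeta>: "integrable M (\<lambda>s. (T k s * \<zeta> k s)\<^sup>2)" for k
      by (rule Bochner_Integration.integrable_bound[OF sq[of k]])
        (auto simp: power_mult_distrib intro!: mult_left_le_one_le T01)
    have R_sq: "integrable M (\<lambda>s. (R k s)\<^sup>2) \<and> (\<integral>s. (R k s)\<^sup>2 \<partial>M) \<le> (\<Sum>i\<in>{m..<k}. c i)" if "m \<le> k" for k
      using that
    proof (induction k rule: dec_induct)
      case base
      show ?case by (simp add: R_def)
    next
      case (step k)
      have R_Suc: "R (Suc k) s = R k s + T k s * \<zeta> k s" for s
        using step.hyps by (simp add: R_def)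
      have RT: "integrable M (\<lambda>s. (R k s * T k s)\<^sup>2)"
        by (rule Bochner_Integration.integrable_bound[where f = "\<lambda>s. (R k s)\<^sup>2"])
          (use step.IH in \<open>auto simp: power_mult_distrib intro!: mult_right_le_one_le T01\<close>)
      have cross: "integrable M (\<lambda>s. R k s * T k s * \<zeta> k s)"
        by (rule integrable_mult_of_squares[OF _ _ RT sq]) auto
      have eq: "(R (Suc k) s)\<^sup>2 = (R k s)\<^sup>2 + 2 * (R k s * T k s * \<zeta> k s) + (T k s * \<zeta> k s)\<^sup>2" for s
        by (simp add: R_Suc power2_sum)
      have "(\<integral>s. (R (Suc k) s)\<^sup>2 \<partial>M)
          = (\<integral>s. (R k s)\<^sup>2 \<partial>M) + 2 * (\<integral>s. R k s * T k s * \<zeta> k s \<partial>M) + (\<integral>s. (T k s * \<zeta> k s)\<^sup>2 \<partial>M)"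
        unfolding eq using step.IH cross T\<zeta>[of k] by simp
      also have "(\<integral>s. R k s * T k s * \<zeta> k s \<partial>M) = 0"
        using RT by (intro orth borel_measurable_times R_F T_F) auto
      also have "(\<integral>s. (T k s * \<zeta> k s)\<^sup>2 \<partial>M) \<le> c k"
        unfolding c_def using T\<zeta>[of k] sq[of k]
        by (intro integral_mono) (auto simp: power_mult_distrib intro!: mult_left_le_one_le T01)
      finally have "(\<integral>s. (R (Suc k) s)\<^sup>2 \<partial>M) \<le> (\<Sum>i\<in>{m..<Suc k}. c i)"
        using step.IH step.hyps by simp
      moreover have "integrable M (\<lambda>s. (R (Suc k) s)\<^sup>2)"
        unfolding eq using step.IH cross T\<zeta>[of k] by simp
      ultimately show ?case by simp
    qed
    have "{s \<in> space M. \<exists>j\<in>{m..n}. \<kappa> \<le> \<bar>S m j s\<bar>} \<subseteq> {s \<in> space M. \<kappa>\<^sup>2 \<le> (R n s)\<^sup>2}"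
    proof safe
      fix s j assume j: "j \<in> {m..n}" "\<kappa> \<le> \<bar>S m j s\<bar>"
      \<comment> \<open>The first passage index: \<open>T\<close> is one before it and zero from it
        on, so the stopped sum keeps the value \<open>S m q s\<close>, whose modulus is at least
        \<kappa>.\<close>
      define q where "q = (LEAST j. m \<le> j \<and> \<kappa> \<le> \<bar>S m j s\<bar>)"
      have q: "m \<le> q" "\<kappa> \<le> \<bar>S m q s\<bar>" "q \<le> j"
        unfolding q_def using LeastI[of "\<lambda>j. m \<le> j \<and> \<kappa> \<le> \<bar>S m j s\<bar>" j]
          Least_le[of "\<lambda>j. m \<le> j \<and> \<kappa> \<le> \<bar>S m j s\<bar>" j] j by auto
      have lt: "\<bar>S m i s\<bar> < \<kappa>" if "m \<le> i" "i < q" for i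
        using not_less_Least[of i "\<lambda>j. m \<le> j \<and> \<kappa> \<le> \<bar>S m j s\<bar>"] that unfolding q_def by auto
      have "R n s = (\<Sum>i\<in>{m..<q} \<union> {q..<n}. T i s * \<zeta> i s)"
        unfolding R_def using q j by (simp add: ivl_disj_un)
      also have "\<dots> = (\<Sum>i\<in>{m..<q}. T i s * \<zeta> i s) + (\<Sum>i\<in>{q..<n}. T i s * \<zeta> i s)"
        by (rule sum.union_disjoint) auto
      also have "(\<Sum>i\<in>{q..<n}. T i s * \<zeta> i s) = 0"
      proof (rule sum.neutral, safe)
        fix i assume "i \<in> {q..<n}"
        then have "q \<in> {m..i}" using q by auto
        then have "T i s = 0" using q(2) unfolding T_def by (auto simp: not_less)
        then show "T i s * \<zeta> i s = 0" by simp
      qed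
      also have "(\<Sum>i\<in>{m..<q}. T i s * \<zeta> i s) = S m q s"
        unfolding S_def using lt by (intro sum.cong) (auto simp: T_def)
      finally show "\<kappa>\<^sup>2 \<le> (R n s)\<^sup>2" using q(2) \<kappa> by (simp add: abs_le_square_iff[symmetric])
    qed
    then have "prob {s \<in> space M. \<exists>j\<in>{m..n}. \<kappa> \<le> \<bar>S m j s\<bar>} \<le> prob {s \<in> space M. \<kappa>\<^sup>2 \<le> (R n s)\<^sup>2}"
      by (intro finite_measure_mono) auto
    also have "\<dots> \<le> (\<integral>s. (R n s)\<^sup>2 \<partial>M) / \<kappa>\<^sup>2"
      using R_sq[OF mn] \<kappa> by (intro integral_Markov_inequality_measure[where A = "space M"]) auto
    also have "\<dots> \<le> (\<Sum>i\<in>{m..<n}. c i) / \<kappa>\<^sup>2"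
      using R_sq[OF mn] by (intro divide_right_mono) auto
    finally show ?thesis .
  qed
  have small: "prob {s \<in> space M. \<forall>m. \<exists>j\<ge>m. \<kappa> \<le> \<bar>S m j s\<bar>} = 0" if \<kappa>: "0 < \<kappa>" for \<kappa>
  proof -
    have "prob {s \<in> space M. \<forall>m. \<exists>j\<ge>m. \<kappa> \<le> \<bar>S m j s\<bar>} \<le> e" if e: "0 < e" for e
    proof -
      have "0 < e * \<kappa>\<^sup>2" using e \<kappa> by simp
      moreover have "summable c" using summ unfolding c_def .
      \<comment> \<open>The starting index makes the maximal inequality yield at most
        \<open>e\<close> for every horizon at once; continuity of the measure along increasing
        horizons then covers the infinite one.\<close>
      ultimately obtain m where m: "\<And>n. (\<Sum>i\<in>{m..<n}. c i) < e * \<kappa>\<^sup>2"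
        unfolding summable_Cauchy using c0 by (metis abs_of_nonneg order_refl real_norm_def sum_nonneg)
      define A where "A n = {s \<in> space M. \<exists>j\<in>{m..m + n}. \<kappa> \<le> \<bar>S m j s\<bar>}" for n
      have A_events: "A n \<in> events" for n unfolding A_def by measurable
      have bound: "prob (A n) \<le> e" for n
      proof -
        have "prob (A n) \<le> (\<Sum>i\<in>{m..<m + n}. c i) / \<kappa>\<^sup>2"
          unfolding A_def by (rule maximal[OF \<kappa>]) simp
        also have "\<dots> \<le> e" using m[of "m + n"] \<kappa> by (simp add: pos_divide_le_eq less_imp_le)
        finally show ?thesis .
      qed
      have "(\<lambda>n. prob (A n))
          \<longlonglongrightarrow> prob (\<Union>n. A n)"
      proof (rule finite_Lim_measure_incseq)
        show "range A \<subseteq> events" using A_events by blast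
        show "incseq A"
          unfolding A_def
        proof (intro incseq_SucI Collect_mono impI)
          fix n s assume "s \<in> space M \<and> (\<exists>j\<in>{m..m + n}. \<kappa> \<le> \<bar>S m j s\<bar>)"
          then obtain j where "s \<in> space M" "j \<in> {m..m + n}" "\<kappa> \<le> \<bar>S m j s\<bar>" by blast
          then show "s \<in> space M \<and> (\<exists>j\<in>{m..m + Suc n}. \<kappa> \<le> \<bar>S m j s\<bar>)"
            by (intro conjI bexI[of _ j]) auto
        qed
      qed
      then have "prob (\<Union>n. A n) \<le> e"
        by (rule LIMSEQ_le_const2) (use bound in blast)
      moreover have "prob {s \<in> space M. \<forall>m. \<exists>j\<ge>m. \<kappa> \<le> \<bar>S m j s\<bar>}
          \<le> prob (\<Union>n. A n)"
      proof (rule finite_measure_mono)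
        show "{s \<in> space M. \<forall>m. \<exists>j\<ge>m. \<kappa> \<le> \<bar>S m j s\<bar>}
            \<subseteq> (\<Union>n. A n)"
        proof safe
          fix s assume "s \<in> space M" "\<forall>m. \<exists>j\<ge>m. \<kappa> \<le> \<bar>S m j s\<bar>"
          then obtain j where "j \<ge> m" "\<kappa> \<le> \<bar>S m j s\<bar>" by blast
          with \<open>s \<in> space M\<close> show "s \<in> (\<Union>n. A n)"
            by (intro UN_I[of "j - m"]) (auto simp: A_def)
        qed
        show "(\<Union>n. A n) \<in> events" using A_events by blast
      qed
      ultimately show ?thesis by simp
    qed
    then have "prob {s \<in> space M. \<forall>m. \<exists>j\<ge>m. \<kappa> \<le> \<bar>S m j s\<bar>} \<le> 0"
      by (rule dense_ge)
    then show ?thesis by (simp add: measure_le_0_iff)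
  qed
  have "AE s in M. \<exists>m. \<forall>j\<ge>m. \<bar>S m j s\<bar> < inverse (real (Suc p))" for p
  proof -
    have "{s \<in> space M. \<forall>m. \<exists>j\<ge>m. inverse (real (Suc p)) \<le> \<bar>S m j s\<bar>} \<in> null_sets M"
      using small[of "inverse (real (Suc p))"] by (intro null_setsI) (auto simp: emeasure_eq_measure)
    from AE_not_in[OF this] AE_space show ?thesis
    proof eventually_elim
      case (elim s)
      then have "\<not> (\<forall>m. \<exists>j\<ge>m. inverse (real (Suc p)) \<le> \<bar>S m j s\<bar>)" by blast
      then show ?case by (meson not_le)
    qed
  qed
  then have "AE s in M. \<forall>p. \<exists>m. \<forall>j\<ge>m. \<bar>S m j s\<bar> < inverse (real (Suc p))"
    by (simp add: AE_all_countable)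
  then show ?thesis
  proof eventually_elim
    case (elim s)
    show ?case
      unfolding summable_Cauchy
    proof (intro allI impI)
      fix e :: real assume "0 < e"
      then obtain p where p: "inverse (real (Suc p)) < e / 2"
        using reals_Archimedean[of "e / 2"] by auto
      \<comment> \<open>A block is the difference of two partial sums anchored at the same index
        \<open>N\<close>, so a threshold below \<open>e / 2\<close> suffices.\<close>
      obtain N where N: "\<And>j. j \<ge> N \<Longrightarrow> \<bar>S N j s\<bar> < inverse (real (Suc p))" using elim by blast
      show "\<exists>N. \<forall>m\<ge>N. \<forall>n. norm (\<Sum>i\<in>{m..<n}. \<zeta> i s) < e"
      proof (intro exI allI impI)
        fix m n assume "N \<le> m"
        show "norm (\<Sum>i\<in>{m..<n}. \<zeta> i s) < e"
        proof (cases "m \<le> n")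
          case True
          have "S N n s = S N m s + (\<Sum>i\<in>{m..<n}. \<zeta> i s)"
            unfolding S_def using \<open>N \<le> m\<close> True by (simp add: sum.atLeastLessThan_concat)
          then show ?thesis using N[of n] N[of m] p \<open>N \<le> m\<close> True by simp
        qed (use \<open>0 < e\<close> in simp)
      qed
    qed
  qed
qed

section \<open>Weighted averages and Fejer monotone sequences\<close>

text \<open>Comparison with the integral of the power function, carried out as an induction step by
  the mean value theorem. The step from \<open>N = 0\<close> is separate because the power function
  need not be differentiable there.\<close>

lemma sum_powr_le:
  fixes s :: real
  assumes s: "0 \<le> s" "s < 1"
  shows "(\<Sum>k<N. 1 / real (k + 1) powr s) \<le> real N powr (1 - s) / (1 - s)"
proof (induction N)
  case (Suc N)
  define p where "p = 1 - s"
  have p: "0 < p" "p \<le> 1" using s by (auto simp: p_def)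
  have "p * real (N + 1) powr (p - 1) \<le> real (N + 1) powr p - real N powr p"
  proof (cases "N = 0")
    case False
    have "\<exists>z. real N < z \<and> z < real (N + 1) \<and>
        real (N + 1) powr p - real N powr p = (real (N + 1) - real N) * (p * z powr (p - 1))"
      by (rule MVT2) (use False in \<open>auto intro!: derivative_eq_intros\<close>)
    then obtain z where z: "real N < z" "z < real (N + 1)"
      "real (N + 1) powr p - real N powr p = p * z powr (p - 1)" by auto
    have "real (N + 1) powr (p - 1) \<le> z powr (p - 1)"
      using z False p by (intro powr_mono2') auto
    then show ?thesis using z(3) p by (simp add: mult_left_mono)
  qed (use p in simp)
  then have "real (N + 1) powr (p - 1) \<le> (real (N + 1) powr p - real N powr p) / p"
    using p by (simp add: pos_le_divide_eq mult.commute)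
  moreover have "real (N + 1) powr (p - 1) = 1 / real (N + 1) powr s"
    by (simp add: p_def powr_minus_divide)
  ultimately show ?case
    using Suc.IH by (simp add: p_def diff_divide_distrib)
qed (use s in simp)

text \<open>Summation by parts: \<open>D - e k\<close> is nonnegative, so at each step the old
  weight may be raised to the new one, and only the last weight survives.\<close>

lemma sum_telescope_weighted_le:
  fixes w e :: "nat \<Rightarrow> real"
  assumes e: "\<And>k. e k \<le> D" and w: "\<And>k. 0 \<le> w k" "\<And>k. w k \<le> w (Suc k)"
  shows "(\<Sum>k\<le>K. w k * (e k - e (Suc k))) \<le> w K * (D - e (Suc K))"
proof (induction K)
  case 0
  show ?case using e[of 0] w(1)[of 0] by (simp add: mult_left_mono)
next
  case (Suc K)
  have "w K * (D - e (Suc K)) \<le> w (Suc K) * (D - e (Suc K))"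
    using w(2) e by (intro mult_right_mono) (auto simp: algebra_simps)
  then show ?case using Suc.IH by (simp add: algebra_simps)
qed

text \<open>Multiplying the recursion by \<open>\<gamma> k powr (r - 1)\<close> turns its left side
  into the averaging weight \<open>\<gamma> k powr r\<close> times the gap. As \<open>r < 1\<close>
  and the steps decrease, these multipliers increase, which the telescoping bound requires.\<close>

lemma weighted_average_rate:
  fixes \<gamma> \<eta> e F :: "nat \<Rightarrow> real"
  assumes \<gamma>: "\<And>k. \<gamma> k = \<gamma>0 / real (k + 1) powr (1/2)" and \<eta>: "\<And>k. \<eta> k = \<eta>0 / real (k + 1) powr b"
    and pos: "0 < \<gamma>0" "0 \<le> \<eta>0" "0 \<le> b" "0 \<le> r" "r < 1" "r / 2 + b < 1" "0 \<le> \<theta>" "0 \<le> L"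
    and e: "\<And>k. 0 \<le> e k" "\<And>k. e k \<le> D"
    and step: "\<And>k. \<gamma> k * F k \<le> e k - e (Suc k) + (\<gamma> k)\<^sup>2 * \<theta> + \<gamma> k * \<eta> k * L"
  shows "(\<Sum>k\<le>K. \<gamma> k powr r * F k) / (\<Sum>k\<le>K. \<gamma> k powr r)
    \<le> (D / \<gamma>0 + 2 * \<theta> * \<gamma>0 / (1 - r)) * (1 / sqrt (real (K + 1)))
      + \<eta>0 * L / (1 - r / 2 - b) * (1 / real (K + 1) powr b)"
proof -
  define N where "N = real (K + 1)"
  have N: "1 \<le> N" by (simp add: N_def)
  have \<gamma>_pos: "0 < \<gamma> k" for k using pos by (simp add: \<gamma>)
  have D0: "0 \<le> D" using e[of 0] by linarith
  have \<gamma>_powr: "\<gamma> k powr q = \<gamma>0 powr q / real (k + 1) powr (q / 2)" for k q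
    unfolding \<gamma> using pos by (simp add: powr_divide powr_powr)
  have w_mono: "\<gamma> k powr (r - 1) \<le> \<gamma> (Suc k) powr (r - 1)" for k
  proof (rule powr_mono2')
    show "\<gamma> (Suc k) \<le> \<gamma> k"
      unfolding \<gamma> using pos by (intro divide_left_mono powr_mono2) auto
  qed (use pos \<gamma>_pos in auto)
  have bound: "\<gamma> k powr r * F k \<le> \<gamma> k powr (r - 1) * (e k - e (Suc k)) + \<theta> * \<gamma> k powr (r + 1)
      + L * (\<gamma> k powr r * \<eta> k)" for k
  proof -
    have split: "\<gamma> k powr (r - 1) * \<gamma> k = \<gamma> k powr r" "\<gamma> k powr (r - 1) * (\<gamma> k)\<^sup>2 = \<gamma> k powr (r + 1)"
      using \<gamma>_pos[of k] by (simp_all add: powr_diff powr_add power2_eq_square)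
    have "\<gamma> k powr (r - 1) * (\<gamma> k * F k)
        \<le> \<gamma> k powr (r - 1) * (e k - e (Suc k) + (\<gamma> k)\<^sup>2 * \<theta> + \<gamma> k * \<eta> k * L)"
      by (intro mult_left_mono step) simp
    also have "\<dots> = \<gamma> k powr (r - 1) * (e k - e (Suc k)) + \<theta> * (\<gamma> k powr (r - 1) * (\<gamma> k)\<^sup>2)
      + L * ((\<gamma> k powr (r - 1) * \<gamma> k) * \<eta> k)" by (simp add: algebra_simps)
    also have "\<gamma> k powr (r - 1) * (\<gamma> k * F k) = (\<gamma> k powr (r - 1) * \<gamma> k) * F k" by simp
    finally show ?thesis unfolding split .
  qed
  define S where "S = (\<Sum>k\<le>K. \<gamma> k powr r)"
  \<comment> \<open>Each of the \<open>K + 1\<close> weights is at least the last one. The three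
    bounds that follow are written as a rate times \<open>S\<close>, so that the final division is
    immediate.\<close>
  have S_ge: "\<gamma>0 powr r * N powr (1 - r / 2) \<le> S"
  proof -
    have "(\<Sum>k\<le>K. \<gamma>0 powr r * N powr (- (r / 2))) \<le> S"
      unfolding S_def
    proof (intro sum_mono)
      fix k assume "k \<in> {..K}"
      then have "N powr (- (r / 2)) \<le> real (k + 1) powr (- (r / 2))"
        using pos by (intro powr_mono2') (auto simp: N_def)
      then have "\<gamma>0 powr r * N powr (- (r / 2)) \<le> \<gamma>0 powr r * real (k + 1) powr (- (r / 2))"
        by (intro mult_left_mono) auto
      then show "\<gamma>0 powr r * N powr (- (r / 2)) \<le> \<gamma> k powr r"
        by (simp add: \<gamma>_powr powr_minus_divide)
    qed
    moreover have "N * N powr (- (r / 2)) = N powr (1 - r / 2)"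
      using N by (simp add: powr_diff powr_minus_divide)
    ultimately show ?thesis by (simp add: N_def mult.left_commute)
  qed
  have S_pos: "0 < S" using S_ge pos N by (smt (verit) mult_pos_pos powr_gt_zero)
  have part1: "(\<Sum>k\<le>K. \<gamma> k powr (r - 1) * (e k - e (Suc k))) \<le> D / \<gamma>0 * N powr (- 1 / 2) * S"
  proof -
    have "(\<Sum>k\<le>K. \<gamma> k powr (r - 1) * (e k - e (Suc k))) \<le> \<gamma> K powr (r - 1) * (D - e (Suc K))"
      using w_mono e by (intro sum_telescope_weighted_le) auto
    also have "\<dots> \<le> \<gamma> K powr (r - 1) * D" using e[of "Suc K"] by (intro mult_left_mono) auto
    also have "\<gamma> K powr (r - 1) = 1 / \<gamma>0 * N powr (- 1 / 2) * (\<gamma>0 powr r * N powr (1 - r / 2))"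
    proof -
      have "N powr (- 1 / 2) * N powr (1 - r / 2) = N powr (- ((r - 1) / 2))"
        unfolding powr_add[symmetric] by (auto simp: diff_divide_distrib add_divide_distrib)
      then have N_eq: "N powr (- 1 / 2) * N powr (1 - r / 2) = 1 / N powr ((r - 1) / 2)"
        by (simp only: powr_minus_divide)
      have \<gamma>0_eq: "\<gamma>0 powr (r - 1) = 1 / \<gamma>0 * \<gamma>0 powr r" using pos by (simp add: powr_diff)
      have "1 / \<gamma>0 * N powr (- 1 / 2) * (\<gamma>0 powr r * N powr (1 - r / 2))
          = 1 / \<gamma>0 * \<gamma>0 powr r * (N powr (- 1 / 2) * N powr (1 - r / 2))" by (simp only: mult_ac)
      then show ?thesis unfolding \<gamma>_powr N_def[symmetric] \<gamma>0_eq N_eq by simp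
    qed
    also have "\<dots> * D \<le> 1 / \<gamma>0 * N powr (- 1 / 2) * S * D"
      using S_ge D0 pos by (intro mult_right_mono mult_left_mono) auto
    finally show ?thesis by (simp add: mult_ac)
  qed
  have part2: "(\<Sum>k\<le>K. \<gamma> k powr (r + 1)) \<le> 2 * \<gamma>0 / (1 - r) * N powr (- 1 / 2) * S"
  proof -
    have "(\<Sum>k\<le>K. \<gamma> k powr (r + 1)) = \<gamma>0 powr (r + 1) * (\<Sum>k<K + 1. 1 / real (k + 1) powr ((r + 1) / 2))"
      unfolding \<gamma>_powr sum_distrib_left by (simp add: lessThan_Suc_atMost)
    \<comment> \<open>The distance of the exponent \<open>(r + 1) / 2\<close> from one is
      \<open>(1 - r) / 2\<close>, whose reciprocal is the factor \<open>2 / (1 - r)\<close>.\<close>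
    also have "\<dots> \<le> \<gamma>0 powr (r + 1) * (real (K + 1) powr (1 - (r + 1) / 2) / (1 - (r + 1) / 2))"
      using pos by (intro mult_left_mono sum_powr_le) auto
    also have "\<dots> = 2 * \<gamma>0 / (1 - r) * N powr (- 1 / 2) * (\<gamma>0 powr r * N powr (1 - r / 2))"
    proof -
      have N_eq: "N powr (- 1 / 2) * N powr (1 - r / 2) = N powr ((1 - r) / 2)"
        unfolding powr_add[symmetric] by (auto simp: diff_divide_distrib add_divide_distrib)
      have \<gamma>0_eq: "\<gamma>0 powr (r + 1) = \<gamma>0 * \<gamma>0 powr r" using pos by (simp add: powr_add)
      have r_eq: "1 - (r + 1) / 2 = (1 - r) / 2"
        by (auto simp: diff_divide_distrib add_divide_distrib)
      show ?thesis unfolding N_def[symmetric] \<gamma>0_eq r_eq N_eq[symmetric] by simp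
    qed
    also have "\<dots> \<le> 2 * \<gamma>0 / (1 - r) * N powr (- 1 / 2) * S"
      using S_ge pos by (intro mult_left_mono) auto
    finally show ?thesis .
  qed
  have part3: "(\<Sum>k\<le>K. \<gamma> k powr r * \<eta> k) \<le> \<eta>0 / (1 - r / 2 - b) * N powr (- b) * S"
  proof -
    have "(\<Sum>k\<le>K. \<gamma> k powr r * \<eta> k) = \<gamma>0 powr r * \<eta>0 * (\<Sum>k<K + 1. 1 / real (k + 1) powr (r / 2 + b))"
      unfolding \<gamma>_powr \<eta> sum_distrib_left by (simp add: lessThan_Suc_atMost powr_add)
    also have "\<dots> \<le> \<gamma>0 powr r * \<eta>0 * (real (K + 1) powr (1 - (r / 2 + b)) / (1 - (r / 2 + b)))"
      using pos by (intro mult_left_mono sum_powr_le) auto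
    also have "\<dots> = \<eta>0 / (1 - r / 2 - b) * N powr (- b) * (\<gamma>0 powr r * N powr (1 - r / 2))"
    proof -
      have N_eq: "N powr (- b) * N powr (1 - r / 2) = N powr (1 - r / 2 - b)"
        unfolding powr_add[symmetric] by (auto simp: diff_divide_distrib add_divide_distrib)
      have r_eq: "1 - (r / 2 + b) = 1 - r / 2 - b" by linarith
      show ?thesis unfolding N_def[symmetric] r_eq N_eq[symmetric] by simp
    qed
    also have "\<dots> \<le> \<eta>0 / (1 - r / 2 - b) * N powr (- b) * S"
      using S_ge pos by (intro mult_left_mono) auto
    finally show ?thesis .
  qed
  have "(\<Sum>k\<le>K. \<gamma> k powr r * F k)
      \<le> (\<Sum>k\<le>K. \<gamma> k powr (r - 1) * (e k - e (Suc k)) + \<theta> * \<gamma> k powr (r + 1) + L * (\<gamma> k powr r * \<eta> k))"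
    by (intro sum_mono bound)
  also have "\<dots> = (\<Sum>k\<le>K. \<gamma> k powr (r - 1) * (e k - e (Suc k))) + \<theta> * (\<Sum>k\<le>K. \<gamma> k powr (r + 1))
      + L * (\<Sum>k\<le>K. \<gamma> k powr r * \<eta> k)"
    by (simp add: sum.distrib sum_distrib_left)
  also have "\<dots> \<le> D / \<gamma>0 * N powr (- 1 / 2) * S + \<theta> * (2 * \<gamma>0 / (1 - r) * N powr (- 1 / 2) * S)
      + L * (\<eta>0 / (1 - r / 2 - b) * N powr (- b) * S)"
    using part1 part2 part3 pos by (intro add_mono mult_left_mono) auto
  also have "\<dots> = ((D / \<gamma>0 + 2 * \<theta> * \<gamma>0 / (1 - r)) * N powr (- 1 / 2) + \<eta>0 * L / (1 - r / 2 - b) * N powr (- b)) * S"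
    by (simp add: algebra_simps)
  finally have "(\<Sum>k\<le>K. \<gamma> k powr r * F k) / S
      \<le> (D / \<gamma>0 + 2 * \<theta> * \<gamma>0 / (1 - r)) * N powr (- 1 / 2) + \<eta>0 * L / (1 - r / 2 - b) * N powr (- b)"
    using S_pos by (simp add: pos_divide_le_eq)
  moreover have "N powr (- 1 / 2) = 1 / sqrt N"
    using N by (simp add: powr_minus_divide powr_half_sqrt)
  ultimately show ?thesis
    by (simp add: S_def N_def powr_minus_divide)
qed

text \<open>A pathwise version of the Robbins-Siegmund lemma. The perturbation contains signed
  martingale increments and may converge only conditionally, so its partial sums are subtracted: the
  compensated sequence decreases, and it is bounded below because convergent partial sums are
  bounded.\<close>

lemma almost_monotone_convergent:
  fixes D q s :: "nat \<Rightarrow> real"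
  assumes D: "\<And>k. 0 \<le> D k" and q: "\<And>k. 0 \<le> q k" and s: "summable s"
    and step: "\<And>k. D (Suc k) \<le> D k - q k + s k"
  shows "convergent D" and "summable q"
proof -
  obtain C where C: "\<And>k. \<bar>\<Sum>i<k. s i\<bar> \<le> C"
    using summable_imp_sums_bounded[OF s] unfolding bounded_iff by auto
  define U where "U k = D k - (\<Sum>i<k. s i)" for k
  have U_step: "U (Suc k) \<le> U k - q k" for k
    using step[of k] by (simp add: U_def)
  have U_ge: "- C \<le> U k" for k
    using C[of k] D[of k] unfolding U_def by linarith
  have "decseq U"
    using U_step q by (intro decseq_SucI) (meson diff_le_eq le_add_same_cancel1 order_trans)
  with U_ge have "convergent U"
    by (metis decseq_convergent convergent_def)
  moreover have "convergent (\<lambda>k. \<Sum>i<k. s i)"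
    using s by (simp add: summable_iff_convergent)
  ultimately have "convergent (\<lambda>k. U k + (\<Sum>i<k. s i))" by (rule convergent_add)
  then show "convergent D" by (simp add: U_def)
  have "(\<Sum>i<k. q i) \<le> U 0 - U k" for k
  proof (induction k)
    case (Suc k)
    then show ?case using U_step[of k] by simp
  qed simp
  then have "(\<Sum>i<k. q i) \<le> U 0 + C" for k using U_ge[of k] by (smt (verit))
  then show "summable q" by (intro summableI_nonneg_bounded[where x = "U 0 + C"] q)
qed

text \<open>As the step sums diverge, a summable weighted gap forces the gap to be small along a
  subsequence, and a cluster point of it is a minimiser. That point need not lie in
  \<open>T\<close>; a nearby element of \<open>T\<close> serves as proxy, since its distance to the
  whole sequence has a limit which the subsequence identifies.\<close>

lemma fejer_convergence:
  fixes x :: "nat \<Rightarrow> 'a::euclidean_space"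
  assumes X: "compact X" and \<phi>: "continuous_on X \<phi>" and x: "\<And>k. x k \<in> X"
    and min: "m \<in> argmin_on X \<phi>" and \<gamma>: "\<And>k. 0 < \<gamma> k" "\<not> summable \<gamma>"
    and summ: "summable (\<lambda>k. \<gamma> k * (\<phi> (x k) - \<phi> m))"
    and T: "argmin_on X \<phi> \<subseteq> closure T"
    and conv: "\<And>z. z \<in> T \<Longrightarrow> convergent (\<lambda>k. norm (x k - z))"
  shows "\<exists>l\<in>argmin_on X \<phi>. x \<longlonglongrightarrow> l"
proof -
  have gap: "0 \<le> \<phi> (x k) - \<phi> m" for k
    using min x[of k] by (auto simp: argmin_on_def)
  have small: "\<exists>k\<ge>N. \<phi> (x k) - \<phi> m < e" if e: "0 < e" for e N
  proof (rule ccontr)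
    assume "\<not> ?thesis"
    then have ge: "\<And>k. N \<le> k \<Longrightarrow> e \<le> \<phi> (x k) - \<phi> m" by (meson not_le)
    have "summable (\<lambda>k. \<gamma> k * e)"
    proof (rule summable_comparison_test'[OF summ])
      fix k assume "N \<le> k"
      then show "norm (\<gamma> k * e) \<le> \<gamma> k * (\<phi> (x k) - \<phi> m)"
        using ge[of k] \<gamma>(1)[of k] e by (simp add: abs_mult mult_left_mono)
    qed
    then have "summable (\<lambda>k. \<gamma> k * e * inverse e)" by (rule summable_mult2)
    moreover have "\<gamma> k * e * inverse e = \<gamma> k" for k using e by simp
    ultimately show False using \<gamma>(2) by simp
  qed
  \<comment> \<open>\<open>r 0\<close> is a dummy; the gap bound holds from \<open>r (Suc 0)\<close>
    on, hence the shift by one in the subsequence.\<close>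
  define r where "r = rec_nat 0 (\<lambda>i j. SOME k. Suc j \<le> k \<and> \<phi> (x k) - \<phi> m < inverse (real (Suc i)))"
  have r: "Suc (r i) \<le> r (Suc i) \<and> \<phi> (x (r (Suc i))) - \<phi> m < inverse (real (Suc i))" for i
  proof -
    have "\<exists>k\<ge>Suc (r i). \<phi> (x k) - \<phi> m < inverse (real (Suc i))" by (rule small) simp
    from someI_ex[OF this] show ?thesis by (simp add: r_def)
  qed
  have "strict_mono (\<lambda>i. r (Suc i))"
    using r by (intro strict_monoI_Suc) (metis Suc_le_eq)
  moreover obtain l \<sigma> where l: "l \<in> X" "strict_mono \<sigma>" "((\<lambda>i. x (r (Suc i))) \<circ> \<sigma>) \<longlonglongrightarrow> l"
    using X x unfolding compact_def by (metis (no_types, lifting))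
  ultimately have sub: "strict_mono (\<lambda>i. r (Suc (\<sigma> i)))"
    by (auto simp: strict_mono_def)
  have lim: "(\<lambda>i. x (r (Suc (\<sigma> i)))) \<longlonglongrightarrow> l" using l(3) by (simp add: o_def)
  have "(\<lambda>i. \<phi> (x (r (Suc (\<sigma> i))))) \<longlonglongrightarrow> \<phi> l"
    using continuous_on_tendsto_compose[OF \<phi> lim l(1)] x by simp
  moreover have "(\<lambda>i. \<phi> (x (r (Suc (\<sigma> i))))) \<longlonglongrightarrow> \<phi> m"
  proof -
    have "(\<lambda>i. \<phi> (x (r (Suc (\<sigma> i)))) - \<phi> m) \<longlonglongrightarrow> 0"
    proof (rule tendsto_sandwich[OF _ _ tendsto_const])
      show "(\<lambda>i. inverse (real (Suc (\<sigma> i)))) \<longlonglongrightarrow> 0"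
        using LIMSEQ_subseq_LIMSEQ[OF LIMSEQ_inverse_real_of_nat l(2)] by (simp add: o_def)
    qed (use r gap in \<open>auto intro!: always_eventually less_imp_le\<close>)
    from tendsto_add[OF this tendsto_const[of "\<phi> m"]] show ?thesis by simp
  qed
  ultimately have "\<phi> l = \<phi> m" by (rule LIMSEQ_unique)
  then have lS: "l \<in> argmin_on X \<phi>" using min l(1) by (simp add: argmin_on_def)
  have "x \<longlonglongrightarrow> l"
  proof (rule metric_LIMSEQ_I)
    fix e :: real assume e: "0 < e"
    then obtain z where z: "z \<in> T" "dist z l < e / 2"
      using lS T closure_approachable[of l T] by (meson half_gt_zero subsetD)
    obtain c where c: "(\<lambda>k. norm (x k - z)) \<longlonglongrightarrow> c"
      using conv[OF z(1)] by (auto simp: convergent_def)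
    have "(\<lambda>i. norm (x (r (Suc (\<sigma> i))) - z)) \<longlonglongrightarrow> c"
      using LIMSEQ_subseq_LIMSEQ[OF c sub] by (simp add: o_def)
    moreover have "(\<lambda>i. norm (x (r (Suc (\<sigma> i))) - z)) \<longlonglongrightarrow> norm (l - z)"
      by (intro tendsto_intros lim)
    ultimately have "c = norm (l - z)" by (rule LIMSEQ_unique)
    then have "c < e / 2" using z(2) by (simp add: dist_norm norm_minus_commute)
    then have "\<forall>\<^sub>F k in sequentially. norm (x k - z) < e / 2" by (rule order_tendstoD(2)[OF c])
    then have "\<forall>\<^sub>F k in sequentially. dist (x k) l < e"
    proof eventually_elim
      case (elim k)
      then show ?case using z(2) dist_triangle[of "x k" l z] by (simp add: dist_norm)
    qed
    then show "\<exists>N. \<forall>k\<ge>N. dist (x k) l < e" by (simp add: eventually_sequentially)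
  qed
  with lS show ?thesis by blast
qed

text \<open>Toeplitz averaging: the total weight is unbounded, so the fixed contribution
  \<open>C\<close> of the first \<open>N\<close> terms is eventually less than \<open>e / 2\<close>
  times the total.\<close>

lemma weighted_mean_tendsto:
  fixes x :: "nat \<Rightarrow> 'a::real_normed_vector"
  assumes x: "x \<longlonglongrightarrow> l" and w: "\<And>k. 0 < w k" "\<not> summable w"
  shows "(\<lambda>k. (\<Sum>j\<le>k. w j *\<^sub>R x j) /\<^sub>R (\<Sum>j\<le>k. w j)) \<longlonglongrightarrow> l"
proof (rule LIMSEQ_I)
  fix e :: real assume e: "0 < e"
  define S where "S k = (\<Sum>j\<le>k. w j)" for k
  have S_pos: "0 < S k" for k unfolding S_def by (intro sum_pos w) auto
  obtain N where N: "\<And>j. N \<le> j \<Longrightarrow> norm (x j - l) < e / 2"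
    using LIMSEQ_D[OF x, of "e / 2"] e by auto
  define C where "C = (\<Sum>j<N. w j * norm (x j - l))"
  have "\<exists>K. 2 * C / e < S K"
  proof (rule ccontr)
    assume "\<not> ?thesis"
    then have "\<And>k. (\<Sum>j\<le>k. w j) \<le> 2 * C / e" by (auto simp: S_def not_less)
    then have "summable w"
      using w(1) by (intro bounded_imp_summable[of w "2 * C / e"]) (auto intro: less_imp_le)
    with w(2) show False ..
  qed
  then obtain K where K: "2 * C / e < S K" ..
  show "\<exists>K. \<forall>k\<ge>K. norm ((\<Sum>j\<le>k. w j *\<^sub>R x j) /\<^sub>R (\<Sum>j\<le>k. w j) - l) < e"
  proof (intro exI allI impI)
    fix k assume k: "max N K \<le> k"
    have "S K \<le> S k" unfolding S_def using k w(1) by (intro sum_mono2) (auto intro: less_imp_le)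
    then have "2 * C / e < S k" using K by simp
    then have Sk: "C < e / 2 * S k" using e by (simp add: pos_divide_less_eq mult.commute)
    have "(\<Sum>j\<le>k. w j *\<^sub>R x j) - S k *\<^sub>R l = (\<Sum>j\<le>k. w j *\<^sub>R (x j - l))"
      by (simp add: S_def scaleR_sum_left scaleR_diff_right sum_subtractf)
    also have "norm \<dots> \<le> (\<Sum>j\<le>k. w j * norm (x j - l))"
      using w(1) by (intro sum_norm_le) (simp add: less_imp_le)
    also have "\<dots> = C + (\<Sum>j\<in>{N..k}. w j * norm (x j - l))"
    proof -
      have eq: "{..k} = {..<N} \<union> {N..k}" using k by auto
      show ?thesis unfolding C_def eq by (rule sum.union_disjoint) auto
    qed
    also have "(\<Sum>j\<in>{N..k}. w j * norm (x j - l)) \<le> (\<Sum>j\<in>{N..k}. w j * (e / 2))"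
      using N w(1) by (intro sum_mono mult_left_mono) (auto intro: less_imp_le)
    also have "\<dots> \<le> S k * (e / 2)"
      unfolding S_def sum_distrib_right using w(1) e by (intro sum_mono2) (auto intro: less_imp_le)
    finally have "norm ((\<Sum>j\<le>k. w j *\<^sub>R x j) - S k *\<^sub>R l) < e * S k"
      using Sk by (simp add: algebra_simps)
    moreover have "(\<Sum>j\<le>k. w j *\<^sub>R x j) /\<^sub>R S k - l = ((\<Sum>j\<le>k. w j *\<^sub>R x j) - S k *\<^sub>R l) /\<^sub>R S k"
      using S_pos[of k] by (simp add: scaleR_diff_right)
    ultimately show "norm ((\<Sum>j\<le>k. w j *\<^sub>R x j) /\<^sub>R (\<Sum>j\<le>k. w j) - l) < e"
      unfolding S_def[symmetric] using S_pos[of k] by (simp add: pos_divide_less_eq divide_inverse[symmetric] mult.commute[of "inverse _"])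
  qed
qed

text \<open>The invariant is that \<open>S k *\<^sub>R xb k\<close> equals the running weighted sum.
  The recursive average thus becomes an explicit convex combination, open to Jensen and to Toeplitz
  averaging.\<close>

lemma weighted_mean_recursion:
  fixes x xb :: "nat \<Rightarrow> 'a::real_vector"
  assumes w: "\<And>k. 0 < w k" and S: "S 0 = w 0" "\<And>k. S (Suc k) = S k + w (Suc k)"
    and xb: "xb 0 = x 0" "\<And>k. xb (Suc k) = (S k *\<^sub>R xb k + w (Suc k) *\<^sub>R x (Suc k)) /\<^sub>R S (Suc k)"
  shows "S k = (\<Sum>j\<le>k. w j)" and "xb k = (\<Sum>j\<le>k. w j *\<^sub>R x j) /\<^sub>R (\<Sum>j\<le>k. w j)"
proof -
  show S_eq: "S k = (\<Sum>j\<le>k. w j)" for k by (induction k) (simp_all add: S)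
  have pos: "0 < (\<Sum>j\<le>k. w j)" for k by (intro sum_pos w) auto
  show "xb k = (\<Sum>j\<le>k. w j *\<^sub>R x j) /\<^sub>R (\<Sum>j\<le>k. w j)"
  proof (induction k)
    case 0
    show ?case using w[of 0] by (simp add: xb(1))
  next
    case (Suc k)
    have "S k *\<^sub>R xb k = (\<Sum>j\<le>k. w j *\<^sub>R x j)"
      using pos[of k] by (simp add: S_eq Suc.IH)
    then show ?case unfolding xb(2) S_eq by simp
  qed
qed

section \<open>The stochastic scheme\<close>

lemma (in prob_space) AE_summable_of_summable_expectation:
  fixes h :: "nat \<Rightarrow> 'a \<Rightarrow> real"
  assumes h: "\<And>k. integrable M (h k)" "\<And>k s. s \<in> space M \<Longrightarrow> 0 \<le> h k s"
    and summ: "summable (\<lambda>k. \<integral>s. h k s \<partial>M)"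
  shows "AE s in M. summable (\<lambda>k. h k s)"
proof -
  have [measurable]: "h k \<in> borel_measurable M" for k using h by simp
  have "(\<integral>\<^sup>+s. (\<Sum>k. ennreal (h k s)) \<partial>M) = (\<Sum>k. \<integral>\<^sup>+s. ennreal (h k s) \<partial>M)"
    by (rule nn_integral_suminf) simp
  also have "\<dots> = (\<Sum>k. ennreal (\<integral>s. h k s \<partial>M))"
    using h by (intro suminf_cong nn_integral_eq_integral) auto
  also have "\<dots> = ennreal (\<Sum>k. \<integral>s. h k s \<partial>M)"
    using summ h by (intro suminf_ennreal2 integral_nonneg_AE) auto
  finally have "(\<integral>\<^sup>+s. (\<Sum>k. ennreal (h k s)) \<partial>M) \<noteq> \<infinity>" by simp
  then have "AE s in M. (\<Sum>k. ennreal (h k s)) \<noteq> \<infinity>"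
    by (intro nn_integral_PInf_AE) auto
  with AE_space show ?thesis
  proof eventually_elim
    case (elim s)
    then show ?case using h(2)[of s] by (intro summable_suminf_not_top) auto
  qed
qed

text \<open>The operator is random and is evaluated at random iterates, so the hypothesis asks for
  measurability after substituting a measurable point, not for fixed arguments.\<close>

lemma proj_iter_measurable:
  fixes Y :: "'b::euclidean_space set"
  assumes Y: "Y \<noteq> {}" "closed Y" "convex Y"
    and F: "\<And>p. p \<in> borel_measurable K \<Longrightarrow> (\<lambda>s. F s (p s)) \<in> borel_measurable K"
    and h: "h \<in> borel_measurable K"
  shows "(\<lambda>s. proj_iter Y \<alpha> (F s) (h s) k) \<in> borel_measurable K"
proof (induction k)
  case (Suc k)
  have [measurable]: "closest_point Y \<in> borel_measurable borel"
    by (rule borel_measurable_continuous_onI) (rule continuous_on_closest_point[OF Y(3,2,1)])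
  note Suc.IH[measurable] F[OF Suc.IH, measurable]
  show ?case by simp
qed (use h in simp)

text \<open>The lower level enters through the geometric error bound \<open>lower\<close>, and the
  schedules through positivity and \<open>\<eta> k \<le> \<eta>\<^sub>0\<close>. The rates and the
  almost sure convergence, which use different exponents, can thus share one descent
  inequality.\<close>

locale zeroth_order_scheme =
  M: prob_space M + Q: prob_space Q
  for M :: "'w measure" and Q :: "'s measure" +
  fixes X :: "'a::euclidean_space set" and Y :: "'b::euclidean_space set"
    and f :: "'a \<Rightarrow> 'b \<Rightarrow> 'w \<Rightarrow> real" and G :: "'a \<Rightarrow> 'b \<Rightarrow> 'w \<Rightarrow> 'b"
    and ysol :: "'a \<Rightarrow> 'w \<Rightarrow> 'b" and fimp :: "'a \<Rightarrow> real" and Lw Ltw :: "'w \<Rightarrow> real"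
    and n L\<^sub>0 Lt\<^sub>0 \<eta>\<^sub>0 \<alpha> B dt :: real and \<gamma> \<eta> :: "nat \<Rightarrow> real" and t :: "nat \<Rightarrow> nat"
    and v g x :: "nat \<Rightarrow> 's \<Rightarrow> 'a" and \<omega> :: "nat \<Rightarrow> 's \<Rightarrow> 'w"
    and y\<^sub>0 yeps :: "nat \<Rightarrow> 'a \<Rightarrow> 'w \<Rightarrow> 'b" and x\<^sub>0 :: 'a
  assumes n: "n = real DIM('a)"
    and f_meas: "(\<lambda>(x, y, w). f x y w) \<in> borel_measurable (borel \<Otimes>\<^sub>M borel \<Otimes>\<^sub>M M)"
    and G_meas: "(\<lambda>(x, y, w). G x y w) \<in> borel_measurable (borel \<Otimes>\<^sub>M borel \<Otimes>\<^sub>M M)"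
    and ysol_in: "\<And>x w. x \<in> X + cball 0 \<eta>\<^sub>0 \<Longrightarrow> w \<in> space M \<Longrightarrow> ysol x w \<in> Y"
    and lower: "\<And>x w z k. x \<in> X + cball 0 \<eta>\<^sub>0 \<Longrightarrow> w \<in> space M \<Longrightarrow> z \<in> Y \<Longrightarrow>
      (norm (proj_iter Y \<alpha> (\<lambda>y. G x y w) z k - ysol x w))\<^sup>2 \<le> B * dt ^ k"
    and dt: "0 \<le> dt" "dt < 1" and B: "0 \<le> B"
    and f_int: "\<And>x. x \<in> X \<Longrightarrow> integrable M (\<lambda>w. f x (ysol x w) w)"
    and fimp: "\<And>x. fimp x = (\<integral>w. f x (ysol x w) w \<partial>M)"
    and eta0: "0 < \<eta>\<^sub>0"
    and L_lip: "\<And>w. w \<in> space M \<Longrightarrow> (Lw w)-lipschitz_on (X + cball 0 \<eta>\<^sub>0) (\<lambda>x. f x (ysol x w) w)"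
    and L_meas [measurable]: "Lw \<in> borel_measurable M"
    and L_int: "integrable M (\<lambda>w. (Lw w)\<^sup>2)"
    and L0: "L\<^sub>0 = sqrt (\<integral>w. (Lw w)\<^sup>2 \<partial>M)"
    and Lt_lip: "\<And>w x. w \<in> space M \<Longrightarrow> x \<in> X + cball 0 \<eta>\<^sub>0 \<Longrightarrow> (Ltw w)-lipschitz_on Y (\<lambda>y. f x y w)"
    and Lt_meas [measurable]: "Ltw \<in> borel_measurable M"
    and Lt_int: "integrable M (\<lambda>w. (Ltw w)\<^sup>2)"
    and Lt0: "Lt\<^sub>0 = sqrt (\<integral>w. (Ltw w)\<^sup>2 \<partial>M)"
    and X: "X \<noteq> {}" "closed X" "bounded X" "convex X"
    and Y: "Y \<noteq> {}" "closed Y" "convex Y"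
    and conv: "convex_on (X + cball 0 \<eta>\<^sub>0) fimp"
    and v_indep: "Q.indep_vars (\<lambda>_. borel) v UNIV"
    and v_distr: "\<And>k. distr Q borel (v k) = uniform_sphere (\<eta> k)"
    and w_indep: "Q.indep_vars (\<lambda>_. M) \<omega> UNIV"
    and w_distr: "\<And>k. distr Q M (\<omega> k) = M"
    and vw_indep: "Q.indep_set
          (sets (vimage_algebra (space Q) (\<lambda>s k. v k s) (\<Pi>\<^sub>M k\<in>UNIV. borel)))
          (sets (vimage_algebra (space Q) (\<lambda>s k. \<omega> k s) (\<Pi>\<^sub>M k\<in>UNIV. M)))"
    and gamma: "\<And>k. 0 < \<gamma> k"
    and eta: "\<And>k. 0 < \<eta> k" "\<And>k. \<eta> k \<le> \<eta>\<^sub>0"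
    and y0: "\<And>k x w. y\<^sub>0 k x w \<in> Y" "\<And>k. (\<lambda>(x, w). y\<^sub>0 k x w) \<in> borel_measurable (borel \<Otimes>\<^sub>M M)"
    and yeps: "\<And>k x w. yeps k x w = proj_iter Y \<alpha> (\<lambda>y. G x y w) (y\<^sub>0 k x w) (t k)"
    and g: "\<And>k s. g k s =
        (n * (f (x k s + v k s) (yeps k (x k s + v k s) (\<omega> k s)) (\<omega> k s)
              - f (x k s) (yeps k (x k s) (\<omega> k s)) (\<omega> k s))
          / (norm (v k s) * \<eta> k)) *\<^sub>R v k s"
    and x0: "x\<^sub>0 \<in> X" "\<And>s. x 0 s = x\<^sub>0"
    and x_Suc: "\<And>k s. x (Suc k) s = closest_point X (x k s - \<gamma> k *\<^sub>R g k s)"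
begin

abbreviation "C \<equiv> X + cball 0 \<eta>\<^sub>0"
abbreviation "Xstar \<equiv> argmin_on X fimp"
abbreviation "N \<equiv> (borel :: 'a measure) \<Otimes>\<^sub>M M"

definition Z where "Z k s = (v k s, \<omega> k s)"

abbreviation "P \<equiv> past Q N Z"

section \<open>The enlarged domain and measurable versions of solution map and objective\<close>

lemma n_nonneg [simp]: "0 \<le> n"
  by (simp add: n)

lemma CI: "p \<in> X \<Longrightarrow> norm u \<le> \<eta>\<^sub>0 \<Longrightarrow> p + u \<in> C"
  by (auto intro: set_plus_intro)

lemma X_sub_C: "p \<in> X \<Longrightarrow> p \<in> C"
  using CI[of p 0] eta0 by simp

lemma cball_sub_C:
  assumes "p \<in> X" "e \<le> \<eta>\<^sub>0"
  shows "cball p e \<subseteq> C"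
proof
  fix u assume "u \<in> cball p e"
  then have "p + (u - p) \<in> C"
    using assms by (intro CI) (auto simp: dist_norm norm_minus_commute)
  then show "u \<in> C" by simp
qed

lemma closed_C: "closed C"
proof -
  have "compact {p + q |p q. p \<in> X \<and> q \<in> cball 0 \<eta>\<^sub>0}"
    using X by (intro compact_sums) (auto simp: compact_eq_bounded_closed)
  moreover have "{p + q |p q. p \<in> X \<and> q \<in> cball 0 \<eta>\<^sub>0} = C"
    unfolding set_plus_def by blast
  ultimately show ?thesis by (auto intro: compact_imp_closed)
qed

lemma f_comp [measurable (raw)]:
  assumes [measurable]: "p \<in> borel_measurable K" "q \<in> borel_measurable K" "c \<in> measurable K M"
  shows "(\<lambda>s. f (p s) (q s) (c s)) \<in> borel_measurable K"
  using measurable_compose[OF _ f_meas, of "\<lambda>s. (p s, q s, c s)" K] by simp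

lemma G_comp [measurable (raw)]:
  assumes [measurable]: "p \<in> borel_measurable K" "q \<in> borel_measurable K" "c \<in> measurable K M"
  shows "(\<lambda>s. G (p s) (q s) (c s)) \<in> borel_measurable K"
  using measurable_compose[OF _ G_meas, of "\<lambda>s. (p s, q s, c s)" K] by simp

lemma y0_comp [measurable (raw)]:
  assumes [measurable]: "p \<in> borel_measurable K" "c \<in> measurable K M"
  shows "(\<lambda>s. y\<^sub>0 k (p s) (c s)) \<in> borel_measurable K"
  using measurable_compose[OF _ y0(2), of "\<lambda>s. (p s, c s)" K] by simp

lemma yeps_comp [measurable (raw)]:
  assumes [measurable]: "p \<in> borel_measurable K" "c \<in> measurable K M"
  shows "(\<lambda>s. yeps k (p s) (c s)) \<in> borel_measurable K"
  unfolding yeps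
proof (rule proj_iter_measurable[OF Y])
  fix q :: "_ \<Rightarrow> 'b" assume [measurable]: "q \<in> borel_measurable K"
  show "(\<lambda>s. G (p s) (q s) (c s)) \<in> borel_measurable K" by measurable
qed measurable

text \<open>The solution map is only characterised on \<^term>\<open>C\<close>; there it agrees with this limit of
  projection iterates, which is jointly measurable on the whole space.\<close>

definition ylim where
  "ylim p w = lim (\<lambda>k. proj_iter Y \<alpha> (\<lambda>y. G p y w) (SOME y. y \<in> Y) k)"

lemma ylim_comp [measurable (raw)]:
  assumes [measurable]: "p \<in> borel_measurable K" "c \<in> measurable K M"
  shows "(\<lambda>s. ylim (p s) (c s)) \<in> borel_measurable K"
  unfolding ylim_def
proof (rule borel_measurable_lim_metric, rule proj_iter_measurable[OF Y])
  fix q :: "_ \<Rightarrow> 'b" assume [measurable]: "q \<in> borel_measurable K"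
  show "(\<lambda>s. G (p s) (q s) (c s)) \<in> borel_measurable K" by measurable
qed measurable

lemma ylim_eq:
  assumes "p \<in> C" "w \<in> space M"
  shows "ylim p w = ysol p w"
  unfolding ylim_def
proof (rule limI)
  let ?y = "\<lambda>k. proj_iter Y \<alpha> (\<lambda>y. G p y w) (SOME y. y \<in> Y) k"
  have y: "(SOME y. y \<in> Y) \<in> Y" using Y(1) by (simp add: some_in_eq)
  have "(\<lambda>k. (norm (?y k - ysol p w))\<^sup>2) \<longlonglongrightarrow> 0"
  proof (rule tendsto_sandwich[OF _ _ tendsto_const])
    show "(\<lambda>k. B * dt ^ k) \<longlonglongrightarrow> 0"
      using dt by (intro tendsto_mult_right_zero LIMSEQ_realpow_zero) auto
  qed (use lower[OF assms y] in auto)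
  then have "(\<lambda>k. norm (?y k - ysol p w)) \<longlonglongrightarrow> 0"
    using tendsto_real_sqrt by fastforce
  then show "?y \<longlonglongrightarrow> ysol p w"
    by (simp add: LIM_zero_iff tendsto_norm_zero_iff)
qed

definition fw where "fw p w = f p (ylim p w) w"

lemma fw_comp [measurable (raw)]:
  assumes [measurable]: "p \<in> borel_measurable K" "c \<in> measurable K M"
  shows "(\<lambda>s. fw (p s) (c s)) \<in> borel_measurable K"
  unfolding fw_def by measurable

lemma fw_eq: "p \<in> C \<Longrightarrow> w \<in> space M \<Longrightarrow> fw p w = f p (ysol p w) w"
  by (simp add: fw_def ylim_eq)

lemma fw_lipschitz:
  assumes "p \<in> C" "q \<in> C" "w \<in> space M"
  shows "\<bar>fw p w - fw q w\<bar> \<le> Lw w * norm (p - q)"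
  using lipschitz_onD[OF L_lip[OF assms(3)] assms(1,2)] assms by (simp add: fw_eq dist_norm)

lemma Lw_nonneg: "w \<in> space M \<Longrightarrow> 0 \<le> Lw w"
  using L_lip lipschitz_on_nonneg by blast

lemma Ltw_nonneg: "w \<in> space M \<Longrightarrow> 0 \<le> Ltw w"
  using Lt_lip X(1) X_sub_C lipschitz_on_nonneg by (metis all_not_in_conv)

lemma Lw_integrable: "integrable M Lw"
  using L_int by (auto intro: M.square_integrable_imp_integrable)

lemma L0_nonneg: "0 \<le> L\<^sub>0"
  by (auto simp: L0 intro!: integral_nonneg_AE)

lemma L0_sq: "L\<^sub>0\<^sup>2 = (\<integral>w. (Lw w)\<^sup>2 \<partial>M)" and Lt0_sq: "Lt\<^sub>0\<^sup>2 = (\<integral>w. (Ltw w)\<^sup>2 \<partial>M)"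
  by (auto simp: L0 Lt0 intro!: integral_nonneg_AE)

lemma Lw_expectation: "(\<integral>w. Lw w \<partial>M) \<le> L\<^sub>0"
proof -
  have "0 \<le> M.variance Lw" by (rule M.variance_positive)
  also have "\<dots> = L\<^sub>0\<^sup>2 - (\<integral>w. Lw w \<partial>M)\<^sup>2"
    using Lw_integrable L_int by (simp add: M.variance_eq L0_sq)
  finally have "(\<integral>w. Lw w \<partial>M)\<^sup>2 \<le> L\<^sub>0\<^sup>2" by simp
  then show ?thesis using L0_nonneg by (rule power2_le_imp_le)
qed

text \<open>Integrability is assumed on \<open>X\<close> only. It spreads to \<open>C\<close> by
  comparison with one point of \<open>X\<close>, the difference being dominated by a multiple of the
  integrable modulus \<open>Lw\<close>.\<close>

lemma fw_integrable:
  assumes p: "p \<in> C"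
  shows "integrable M (fw p)"
proof -
  obtain q where q: "q \<in> X" using X by auto
  have "integrable M (fw q) \<longleftrightarrow> integrable M (\<lambda>w. f q (ysol q w) w)"
    by (intro Bochner_Integration.integrable_cong) (auto simp: fw_eq X_sub_C q)
  then have "integrable M (fw q)" using f_int[OF q] by simp
  moreover have "integrable M (\<lambda>w. fw p w - fw q w)"
  proof (rule Bochner_Integration.integrable_bound)
    show "integrable M (\<lambda>w. Lw w * norm (p - q))" using Lw_integrable by simp
    show "AE w in M. norm (fw p w - fw q w) \<le> norm (Lw w * norm (p - q))"
      using fw_lipschitz[OF p X_sub_C[OF q]] by (intro AE_I2) (auto intro: order_trans[OF _ abs_ge_self])
  qed measurable
  ultimately have "integrable M (\<lambda>w. (fw p w - fw q w) + fw q w)" by (rule Bochner_Integration.integrable_add[rotated])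
  then show ?thesis by simp
qed

text \<open>Agrees with \<open>fimp\<close> on \<open>C\<close> and is Borel on the whole space, as
  integration against the sphere law requires.\<close>

definition \<phi> where "\<phi> p = (\<integral>w. fw p w \<partial>M)"

lemma \<phi>_measurable [measurable]: "\<phi> \<in> borel_measurable borel"
  unfolding \<phi>_def by measurable

lemma \<phi>_eq: "p \<in> C \<Longrightarrow> \<phi> p = fimp p"
  unfolding \<phi>_def fimp by (intro Bochner_Integration.integral_cong) (auto simp: fw_eq)

lemma \<phi>_lipschitz: "L\<^sub>0-lipschitz_on C \<phi>"
proof (rule lipschitz_onI[OF _ L0_nonneg])
  fix p q assume pq: "p \<in> C" "q \<in> C"
  have "\<bar>\<phi> p - \<phi> q\<bar> = \<bar>\<integral>w. fw p w - fw q w \<partial>M\<bar>"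
    unfolding \<phi>_def using fw_integrable pq by simp
  also have "\<dots> \<le> (\<integral>w. \<bar>fw p w - fw q w\<bar> \<partial>M)" by (rule integral_abs_bound)
  also have "\<dots> \<le> (\<integral>w. Lw w * norm (p - q) \<partial>M)"
    using fw_lipschitz pq fw_integrable Lw_integrable by (intro integral_mono) auto
  also have "\<dots> \<le> L\<^sub>0 * norm (p - q)" using Lw_expectation by (simp add: mult_right_mono)
  finally show "dist (\<phi> p) (\<phi> q) \<le> L\<^sub>0 * dist p q" by (simp add: dist_norm)
qed

lemma \<phi>_convex: "convex_on C \<phi>"
  using conv \<phi>_eq unfolding convex_on_def by (metis convexD)

lemma fimp_continuous: "continuous_on X fimp"
proof (rule continuous_on_eq)
  show "continuous_on X \<phi>"
    using lipschitz_on_continuous_on[OF \<phi>_lipschitz] X_sub_C continuous_on_subset by blast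
qed (simp add: \<phi>_eq X_sub_C)

section \<open>The set of minimisers\<close>

lemma compact_X: "compact X"
  using X by (simp add: compact_eq_bounded_closed)

lemma Xstar_nonempty: "Xstar \<noteq> {}"
  using continuous_attains_inf[OF compact_X X(1) fimp_continuous] by (auto simp: argmin_on_def)

lemma Xstar_sub: "Xstar \<subseteq> X"
  by (auto simp: argmin_on_def)

lemma fimp_Xstar:
  assumes "z \<in> Xstar"
  shows "(INF p\<in>X. fimp p) = fimp z" and "p \<in> X \<Longrightarrow> fimp z \<le> fimp p"
proof -
  show "(INF p\<in>X. fimp p) = fimp z"
    using assms by (intro cInf_eq_minimum) (auto simp: argmin_on_def)
qed (use assms in \<open>auto simp: argmin_on_def\<close>)

lemma Xstar_alt: "z \<in> Xstar \<Longrightarrow> Xstar = {p \<in> X. fimp p \<le> fimp z}"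
  by (auto simp: argmin_on_def intro: order_trans)

lemma closed_Xstar: "closed Xstar"
proof -
  obtain z where z: "z \<in> Xstar" using Xstar_nonempty by blast
  have "closed (X \<inter> fimp -` {..fimp z})"
    using fimp_continuous X(2) by (intro continuous_closed_preimage) auto
  also have "X \<inter> fimp -` {..fimp z} = Xstar"
    unfolding Xstar_alt[OF z] by auto
  finally show ?thesis .
qed

lemma convex_Xstar: "convex Xstar"
proof -
  obtain z where z: "z \<in> Xstar" using Xstar_nonempty by blast
  show ?thesis
    unfolding Xstar_alt[OF z]
  proof (rule convexI)
    fix p q and a b :: real
    assume p: "p \<in> {p \<in> X. fimp p \<le> fimp z}" and q: "q \<in> {p \<in> X. fimp p \<le> fimp z}"
      and ab: "0 \<le> a" "0 \<le> b" "a + b = 1"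
    have "fimp (a *\<^sub>R p + b *\<^sub>R q) \<le> a * fimp p + b * fimp q"
      using conv p q ab X_sub_C unfolding convex_on_def by auto
    also have "\<dots> \<le> a * fimp z + b * fimp z"
      using p q ab by (intro add_mono mult_left_mono) auto
    also have "\<dots> = fimp z" using ab by (simp add: distrib_right[symmetric])
    finally show "a *\<^sub>R p + b *\<^sub>R q \<in> {p \<in> X. fimp p \<le> fimp z}"
      using convexD[OF X(4) _ _ ab] p q by auto
  qed
qed

section \<open>The noise, its filtration and the gradient estimate\<close>

lemma v_measurable [measurable]: "v k \<in> borel_measurable Q"
  and w_measurable [measurable]: "\<omega> k \<in> measurable Q M"
  using v_indep w_indep by (auto simp: Q.indep_vars_def)

lemma Z_measurable [measurable]: "Z k \<in> measurable Q N"
  unfolding Z_def by measurable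

lemma Z_indep: "Q.indep_vars (\<lambda>_. N) Z UNIV"
  using Q.indep_vars_Pair(1)[OF v_indep w_indep vw_indep] unfolding Z_def[abs_def] .

lemma Z_distr: "distr Q N (Z k) = uniform_sphere (\<eta> k) \<Otimes>\<^sub>M M"
  using Q.indep_vars_Pair(2)[OF v_indep w_indep vw_indep, of k] unfolding Z_def[abs_def] v_distr w_distr .

lemma AE_norm_v: "AE s in Q. norm (v k s) = \<eta> k"
proof (rule AE_distrD[of "v k" Q borel "\<lambda>u. norm u = \<eta> k"])
  show "v k \<in> measurable Q borel" by simp
  show "AE u in distr Q borel (v k). norm u = \<eta> k"
    unfolding v_distr using eta(1)[of k] by (intro AE_uniform_sphere_norm) simp
qed

lemma integral_w:
  assumes [measurable]: "h \<in> borel_measurable M"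
  shows "(\<integral>s. h (\<omega> k s) \<partial>Q) = (\<integral>w. h w \<partial>M :: real)"
    and "integrable Q (\<lambda>s. h (\<omega> k s)) \<longleftrightarrow> integrable M h"
  using integral_distr[of "\<omega> k" Q M h] integrable_distr_eq[of "\<omega> k" Q M h] by (simp_all add: w_distr)

lemma w_space: "s \<in> space Q \<Longrightarrow> \<omega> k s \<in> space M"
  using measurable_space[OF w_measurable] .

lemma x_in: "x k s \<in> X"
  by (cases k) (use x0 closest_point_in_set[OF X(2,1)] in \<open>auto simp: x_Suc\<close>)

lemma sub_P: "subalgebra Q (P k)"
  by (intro subalgebra_past Z_measurable)

lemma closest_point_measurable:
  fixes S :: "'a set"
  assumes "closed S" "convex S" "S \<noteq> {}"
  shows "closest_point S \<in> borel_measurable borel"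
  by (rule borel_measurable_continuous_onI) (rule continuous_on_closest_point[OF assms(2,1,3)])

lemma vw_past:
  assumes "i < k"
  shows "v i \<in> borel_measurable (P k)" "\<omega> i \<in> measurable (P k) M"
proof -
  have "Z i \<in> measurable (P k) N" using assms by (intro past_measurable Z_measurable)
  from measurable_compose[OF this measurable_fst] measurable_compose[OF this measurable_snd]
  show "v i \<in> borel_measurable (P k)" "\<omega> i \<in> measurable (P k) M" by (simp_all add: Z_def)
qed

lemma P_mono:
  assumes "h \<in> borel_measurable (P k)" "k \<le> l"
  shows "h \<in> borel_measurable (P l)"
proof (rule measurable_from_subalg[OF _ assms(1)])
  show "subalgebra (P l) (P k)"
    using past_mono[of Z Q N k l] assms(2) by (auto simp: subalgebra_def)
qed

lemma x_past: "x k \<in> borel_measurable (P k)"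
proof (induction k)
  case 0
  have "x 0 = (\<lambda>s. x\<^sub>0)" using x0 by auto
  then show ?case by simp
next
  case (Suc k)
  have [measurable]: "x k \<in> borel_measurable (P (Suc k))" "v k \<in> borel_measurable (P (Suc k))"
    "\<omega> k \<in> measurable (P (Suc k)) M"
    using P_mono[OF Suc.IH] vw_past[of k "Suc k"] by auto
  have [measurable]: "closest_point X \<in> borel_measurable borel"
    using X by (intro closest_point_measurable)
  have "(\<lambda>s. closest_point X (x k s - \<gamma> k *\<^sub>R g k s)) \<in> borel_measurable (P (Suc k))"
    unfolding g by measurable
  then show ?case by (simp add: x_Suc[abs_def, symmetric])
qed

lemma x_measurable [measurable]: "x k \<in> borel_measurable Q"
  by (rule measurable_from_subalg[OF sub_P x_past])

text \<open>The estimate with exact lower-level solutions. Iterate, direction and sample are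
  separate arguments, so that the iterate can be frozen while the noise is integrated.\<close>

definition gbar where
  "gbar k p u w = (n * (fw (p + u) w - fw p w) / (norm u * \<eta> k)) *\<^sub>R u"

lemma gbar_comp [measurable (raw)]:
  assumes [measurable]: "p \<in> borel_measurable K" "u \<in> borel_measurable K" "c \<in> measurable K M"
  shows "(\<lambda>s. gbar k (p s) (u s) (c s)) \<in> borel_measurable K"
  unfolding gbar_def by measurable

lemma gbar_bound:
  assumes "p \<in> X" "norm u = \<eta> k" "w \<in> space M"
  shows "norm (gbar k p u w) \<le> n * Lw w"
proof -
  have "\<bar>fw (p + u) w - fw p w\<bar> \<le> Lw w * \<eta> k"
    using fw_lipschitz[of "p + u" p w] assms eta(2)[of k] CI X_sub_C by simp
  then have "n * \<bar>fw (p + u) w - fw p w\<bar> / \<eta> k \<le> n * (Lw w * \<eta> k) / \<eta> k"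
    using eta(1)[of k] n_nonneg by (intro divide_right_mono mult_left_mono) auto
  then show ?thesis using assms eta(1)[of k] by (simp add: gbar_def abs_mult)
qed

text \<open>Each of the two function values is off by at most \<open>Ltw\<close> times the root of
  the lower-level bound. The factor 4 is the square of the two errors added, and the difference
  quotient amplifies the square by \<open>1 / (\<eta> k)\<^sup>2\<close>.\<close>

lemma g_error:
  assumes s: "s \<in> space Q" and v: "norm (v k s) = \<eta> k"
  shows "(norm (g k s - gbar k (x k s) (v k s) (\<omega> k s)))\<^sup>2
    \<le> 4 * n\<^sup>2 * (B * dt ^ t k / (\<eta> k)\<^sup>2) * (Ltw (\<omega> k s))\<^sup>2"
proof -
  define w where "w = \<omega> k s"
  define E where "E = B * dt ^ t k"
  have E: "0 \<le> E" using B dt by (simp add: E_def)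
  have w: "w \<in> space M" using s w_space by (simp add: w_def)
  have C: "x k s \<in> C" "x k s + v k s \<in> C" using x_in v eta(2)[of k] by (auto intro: X_sub_C CI)
  have err: "\<bar>f p (yeps k p w) w - fw p w\<bar> \<le> Ltw w * sqrt E" if "p \<in> C" for p
  proof -
    have "yeps k p w \<in> Y" unfolding yeps by (intro proj_iter_in Y y0)
    then have "\<bar>f p (yeps k p w) w - fw p w\<bar> \<le> Ltw w * norm (yeps k p w - ysol p w)"
      using lipschitz_onD[OF Lt_lip[OF w that], of "yeps k p w" "ysol p w"] ysol_in[OF that w]
      by (simp add: fw_eq[OF that w] dist_norm)
    also have "\<dots> \<le> Ltw w * sqrt E"
      using lower[OF that w y0(1), of k p w "t k"] Ltw_nonneg[OF w]
      by (intro mult_left_mono real_le_rsqrt) (auto simp: yeps E_def)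
    finally show ?thesis .
  qed
  define d where "d = (f (x k s + v k s) (yeps k (x k s + v k s) w) w - f (x k s) (yeps k (x k s) w) w)
      - (fw (x k s + v k s) w - fw (x k s) w)"
  have d: "\<bar>d\<bar> \<le> 2 * (Ltw w * sqrt E)"
    using err[OF C(1)] err[OF C(2)] unfolding d_def by linarith
  have "g k s - gbar k (x k s) (v k s) w = (n * d / (norm (v k s) * \<eta> k)) *\<^sub>R v k s"
    unfolding g gbar_def w_def[symmetric] d_def scaleR_left_diff_distrib[symmetric]
    by (simp add: diff_divide_distrib[symmetric] right_diff_distrib[symmetric])
  then have "norm (g k s - gbar k (x k s) (v k s) w) = n * \<bar>d\<bar> / \<eta> k"
    using v eta(1)[of k] by (simp add: abs_mult)
  then have "(norm (g k s - gbar k (x k s) (v k s) w))\<^sup>2 = n\<^sup>2 / (\<eta> k)\<^sup>2 * \<bar>d\<bar>\<^sup>2"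
    by (simp add: power_divide power_mult_distrib)
  also have "\<dots> \<le> n\<^sup>2 / (\<eta> k)\<^sup>2 * (2 * (Ltw w * sqrt E))\<^sup>2"
    using d by (intro mult_left_mono power_mono) auto
  also have "\<dots> = 4 * n\<^sup>2 * (E / (\<eta> k)\<^sup>2) * (Ltw w)\<^sup>2"
    using E by (simp add: power_mult_distrib)
  finally show ?thesis by (simp add: w_def E_def)
qed

text \<open>The estimate is split into the exact part \<open>h\<close> and the error
  \<open>e\<close>. The cross term of \<open>e\<close> costs \<open>(norm e)\<^sup>2\<close> plus
  \<open>c\<^sup>2 * (norm d)\<^sup>2\<close>, and the latter is the origin of the summand
  \<open>DX\<close> in \<open>\<theta>\<^sub>0\<close>. Inserting
  \<open>(norm e)\<^sup>2 \<le> 4 * q\<close> and halving turns \<open>1 + 3 / 2 * c\<^sup>2\<close>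
  into \<open>2 + 3 * c\<^sup>2\<close>.\<close>

lemma descent:
  assumes s: "s \<in> space Q" and v: "norm (v k s) = \<eta> k" and p: "p \<in> X"
  shows "(norm (x (Suc k) s - p))\<^sup>2 / 2 \<le> (norm (x k s - p))\<^sup>2 / 2
      - \<gamma> k * (gbar k (x k s) (v k s) (\<omega> k s) \<bullet> (x k s - p)) + (\<gamma> k)\<^sup>2 * ((norm (x k s - p))\<^sup>2 / 2)
      + (2 + 3 * (\<gamma> k)\<^sup>2) * n\<^sup>2 * (B * dt ^ t k / (\<eta> k)\<^sup>2) * (Ltw (\<omega> k s))\<^sup>2
      + 3 / 2 * (\<gamma> k)\<^sup>2 * n\<^sup>2 * (Lw (\<omega> k s))\<^sup>2"
proof -
  define d where "d = x k s - p"
  define h where "h = gbar k (x k s) (v k s) (\<omega> k s)"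
  define e where "e = g k s - h"
  define c where "c = \<gamma> k"
  have c: "0 < c" using gamma by (simp add: c_def)
  have g_eq: "g k s = h + e" by (simp add: e_def)
  have "norm (x (Suc k) s - p) = dist (closest_point X (x k s - c *\<^sub>R g k s)) (closest_point X p)"
    using p by (simp add: x_Suc dist_norm closest_point_self c_def)
  also have "\<dots> \<le> norm (d - c *\<^sub>R (h + e))"
    using closest_point_lipschitz[OF X(4,2,1), of "x k s - c *\<^sub>R g k s" p]
    by (simp add: dist_norm d_def g_eq algebra_simps)
  finally have "(norm (x (Suc k) s - p))\<^sup>2 \<le> (norm (d - c *\<^sub>R (h + e)))\<^sup>2"
    by (intro power_mono) auto
  also have "\<dots> = (norm d)\<^sup>2 - 2 * c * (h \<bullet> d) - 2 * c * (e \<bullet> d) + c\<^sup>2 * (norm (h + e))\<^sup>2"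
    by (simp only: power2_norm_eq_inner inner_diff_left inner_diff_right inner_scaleR_left
        inner_scaleR_right inner_add_left inner_add_right inner_commute[of d h] inner_commute[of d e])
      (simp add: algebra_simps power2_eq_square)
  finally have expand: "(norm (x (Suc k) s - p))\<^sup>2
      \<le> (norm d)\<^sup>2 - 2 * c * (h \<bullet> d) - 2 * c * (e \<bullet> d) + c\<^sup>2 * (norm (h + e))\<^sup>2" .
  have cross: "- (2 * c * (e \<bullet> d)) \<le> (norm e)\<^sup>2 + c\<^sup>2 * (norm d)\<^sup>2"
  proof -
    have "0 \<le> (norm (e + c *\<^sub>R d))\<^sup>2" by simp
    also have "\<dots> = (norm e)\<^sup>2 + 2 * c * (e \<bullet> d) + c\<^sup>2 * (norm d)\<^sup>2"
      by (simp only: power2_norm_eq_inner inner_scaleR_left inner_scaleR_right inner_add_left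
          inner_add_right inner_commute[of d e]) (simp add: algebra_simps power2_eq_square)
    finally show ?thesis by simp
  qed
  \<comment> \<open>Before multiplication by \<open>c\<^sup>2\<close>, the right side exceeds the
    left by half of \<open>(norm (2 *\<^sub>R h - e))\<^sup>2\<close>. This uneven split is
    responsible for the constants \<open>1.5\<close> and \<open>3 * \<gamma>\<^sub>0\<^sup>2\<close>
    in \<open>\<theta>\<^sub>0\<close>.\<close>
  have square: "c\<^sup>2 * (norm (h + e))\<^sup>2 \<le> c\<^sup>2 * (3 * (norm h)\<^sup>2 + 3 / 2 * (norm e)\<^sup>2)"
  proof (intro mult_left_mono)
    have "0 \<le> (norm (2 *\<^sub>R h - e))\<^sup>2" by simp
    also have "(norm (2 *\<^sub>R h - e))\<^sup>2 = 4 * (norm h)\<^sup>2 - 4 * (h \<bullet> e) + (norm e)\<^sup>2"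
      by (simp only: power2_norm_eq_inner inner_scaleR_left inner_scaleR_right inner_diff_left
          inner_diff_right inner_commute[of e h]) (simp add: algebra_simps)
    moreover have "(norm (h + e))\<^sup>2 = (norm h)\<^sup>2 + 2 * (h \<bullet> e) + (norm e)\<^sup>2"
      by (simp only: power2_norm_eq_inner inner_add_left inner_add_right inner_commute[of e h])
    ultimately show "(norm (h + e))\<^sup>2 \<le> 3 * (norm h)\<^sup>2 + 3 / 2 * (norm e)\<^sup>2" by simp
  qed simp
  have main: "(norm (x (Suc k) s - p))\<^sup>2 \<le> (norm d)\<^sup>2 - 2 * c * (h \<bullet> d) + ((norm e)\<^sup>2 + c\<^sup>2 * (norm d)\<^sup>2)
      + c\<^sup>2 * (3 * (norm h)\<^sup>2 + 3 / 2 * (norm e)\<^sup>2)"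
    using expand cross square by linarith
  define q where "q = n\<^sup>2 * (B * dt ^ t k / (\<eta> k)\<^sup>2) * (Ltw (\<omega> k s))\<^sup>2"
  have "(norm e)\<^sup>2 \<le> 4 * q"
    using g_error[OF s v] by (simp add: e_def h_def q_def)
  then have "(1 + 3 / 2 * c\<^sup>2) * (norm e)\<^sup>2 \<le> (1 + 3 / 2 * c\<^sup>2) * (4 * q)"
    by (intro mult_left_mono) auto
  moreover have "(2 + 3 * c\<^sup>2) * n\<^sup>2 * (B * dt ^ t k / (\<eta> k)\<^sup>2) * (Ltw (\<omega> k s))\<^sup>2 = (2 + 3 * c\<^sup>2) * q"
    by (simp add: q_def)
  moreover have "c\<^sup>2 * (norm h)\<^sup>2 \<le> c\<^sup>2 * (n * Lw (\<omega> k s))\<^sup>2"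
    using gbar_bound[OF x_in v w_space[OF s]] by (intro mult_left_mono power_mono) (auto simp: h_def)
  ultimately show ?thesis
    using main unfolding d_def[symmetric] h_def[symmetric] c_def[symmetric]
    by (simp add: algebra_simps power_mult_distrib)
qed

text \<open>With the iterate in place of \<open>p\<close> this is the conditional expectation, given
  the past, of the inner product that drives the descent.\<close>

definition mean_drift where "mean_drift k p z = (\<integral>q. gbar k p (fst q) (snd q) \<bullet> (p - z) \<partial>distr Q N (Z k))"

lemma mean_drift_integrable:
  assumes p: "p \<in> X"
  shows "integrable (distr Q N (Z k)) (\<lambda>q. gbar k p (fst q) (snd q) \<bullet> (p - z))"
    and "\<bar>mean_drift k p z\<bar> \<le> n * L\<^sub>0 * norm (p - z)"
proof -
  have bound: "AE s in Q. \<bar>gbar k p (v k s) (\<omega> k s) \<bullet> (p - z)\<bar> \<le> n * norm (p - z) * Lw (\<omega> k s)"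
    using AE_norm_v[of k] AE_space
  proof eventually_elim
    case (elim s)
    have "\<bar>gbar k p (v k s) (\<omega> k s) \<bullet> (p - z)\<bar> \<le> norm (gbar k p (v k s) (\<omega> k s)) * norm (p - z)"
      by (rule Cauchy_Schwarz_ineq2)
    also have "\<dots> \<le> n * Lw (\<omega> k s) * norm (p - z)"
      using gbar_bound[OF p] elim w_space by (intro mult_right_mono) auto
    finally show ?case by (simp add: mult_ac)
  qed
  have int_L: "integrable Q (\<lambda>s. n * norm (p - z) * Lw (\<omega> k s))"
    using Lw_integrable by (simp add: integral_w)
  have int: "integrable Q (\<lambda>s. gbar k p (v k s) (\<omega> k s) \<bullet> (p - z))"
    by (rule Bochner_Integration.integrable_bound[OF int_L]) (use bound in \<open>auto elim!: eventually_mono\<close>)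
  then show "integrable (distr Q N (Z k)) (\<lambda>q. gbar k p (fst q) (snd q) \<bullet> (p - z))"
    by (subst integrable_distr_eq) (simp_all add: Z_def)
  have "mean_drift k p z = (\<integral>s. gbar k p (v k s) (\<omega> k s) \<bullet> (p - z) \<partial>Q)"
    unfolding mean_drift_def by (subst integral_distr) (simp_all add: Z_def)
  also have "\<bar>\<dots>\<bar> \<le> (\<integral>s. \<bar>gbar k p (v k s) (\<omega> k s) \<bullet> (p - z)\<bar> \<partial>Q)" by (rule integral_abs_bound)
  also have "\<dots> \<le> (\<integral>s. n * norm (p - z) * Lw (\<omega> k s) \<partial>Q)"
    using int int_L bound by (intro integral_mono_AE) auto
  also have "\<dots> = n * norm (p - z) * (\<integral>w. Lw w \<partial>M)" by (simp add: integral_w)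
  also have "\<dots> \<le> n * norm (p - z) * L\<^sub>0" by (intro mult_left_mono Lw_expectation mult_nonneg_nonneg) auto
  finally show "\<bar>mean_drift k p z\<bar> \<le> n * L\<^sub>0 * norm (p - z)" by (simp add: mult_ac)
qed

text \<open>Convexity is available only after averaging over the sample. Fubini therefore puts
  \<omega> inside and the direction outside; the inner integral replaces the random integrand by
  \<phi>, to which the sphere inequality applies.\<close>

lemma mean_drift_ge:
  assumes p: "p \<in> X" and z: "z \<in> X"
  shows "fimp p - fimp z - \<eta> k * L\<^sub>0 \<le> mean_drift k p z"
proof -
  interpret U: prob_space "uniform_sphere (\<eta> k) :: 'a measure" by (rule prob_space_uniform_sphere)
  interpret UM: pair_sigma_finite "uniform_sphere (\<eta> k) :: 'a measure" M ..
  have "fimp p - fimp z - \<eta> k * L\<^sub>0 = \<phi> p - \<phi> z - \<eta> k * L\<^sub>0"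
    using p z by (simp add: \<phi>_eq X_sub_C)
  also have "\<dots> \<le> (\<integral>u. n * (\<phi> (p + u) - \<phi> p) / (norm u * \<eta> k) * (u \<bullet> (p - z)) \<partial>uniform_sphere (\<eta> k))"
    using p z eta unfolding n by (intro uniform_sphere_mean_subgradient[OF _ \<phi>_convex \<phi>_lipschitz closed_C] cball_sub_C) auto
  also have "\<dots> = (\<integral>u. (\<integral>w. gbar k p u w \<bullet> (p - z) \<partial>M) \<partial>uniform_sphere (\<eta> k))"
  proof (rule integral_cong_AE)
    have "AE u in (uniform_sphere (\<eta> k) :: 'a measure). norm u = \<eta> k"
      using eta(1)[of k] by (intro AE_uniform_sphere_norm) simp
    then show "AE u in uniform_sphere (\<eta> k). n * (\<phi> (p + u) - \<phi> p) / (norm u * \<eta> k) * (u \<bullet> (p - z))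
        = (\<integral>w. gbar k p u w \<bullet> (p - z) \<partial>M)"
    proof eventually_elim
      case (elim u)
      then have C: "p \<in> C" "p + u \<in> C" using p eta(2)[of k] by (auto intro: X_sub_C CI)
      have "\<phi> (p + u) - \<phi> p = (\<integral>w. fw (p + u) w - fw p w \<partial>M)"
        unfolding \<phi>_def using C by (simp add: fw_integrable)
      then have "n * (\<phi> (p + u) - \<phi> p) / (norm u * \<eta> k) * (u \<bullet> (p - z))
        = (\<integral>w. n * (fw (p + u) w - fw p w) / (norm u * \<eta> k) * (u \<bullet> (p - z)) \<partial>M)" by simp
      then show ?case by (simp add: gbar_def)
    qed
  qed measurable
  also have "\<dots> = mean_drift k p z"
    using UM.integral_fst'[of "\<lambda>q. gbar k p (fst q) (snd q) \<bullet> (p - z)"] mean_drift_integrable(1)[OF p, of k z]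
    by (simp add: mean_drift_def Z_distr)
  finally show ?thesis .
qed

definition gdot where
  "gdot k z s = gbar k (x k s) (v k s) (\<omega> k s) \<bullet> (x k s - z s)"

lemma gdot_measurable [measurable]: "z \<in> borel_measurable Q \<Longrightarrow> gdot k z \<in> borel_measurable Q"
  unfolding gdot_def[abs_def] by measurable

text \<open>The reference point may be random but must be decided by the past: the projection of the
  iterate onto the minimisers serves the rates, a constant serves the almost sure statement. The
  second moment bound does not depend on \<open>k\<close>, so square-summable steps give
  square-summable martingale terms.\<close>

lemma drift:
  fixes z :: "'s \<Rightarrow> 'a"
  assumes z [measurable]: "z \<in> borel_measurable (P k)" and zX: "\<And>s. z s \<in> X"
  shows "integrable Q (\<lambda>s. (gdot k z s)\<^sup>2)"
    and "integrable Q (gdot k z)"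
    and "integrable Q (\<lambda>s. mean_drift k (x k s) (z s))"
    and "(\<lambda>s. mean_drift k (x k s) (z s)) \<in> borel_measurable (P k)"
    and "(\<integral>s. gdot k z s \<partial>Q) = (\<integral>s. mean_drift k (x k s) (z s) \<partial>Q)"
    and "AE s in Q. real_cond_exp Q (P k) (gdot k z) s
        = mean_drift k (x k s) (z s)"
    and "(\<integral>s. (gdot k z s)\<^sup>2 \<partial>Q) \<le> (n * L\<^sub>0 * diameter X)\<^sup>2"
proof -
  note x_past[measurable]
  have [measurable]: "z \<in> borel_measurable Q" by (rule measurable_from_subalg[OF sub_P z])
  define R where "R = diameter X"
  have R: "norm (x k s - z s) \<le> R" for s
    using diameter_bounded_bound[OF X(3) x_in zX] by (simp add: R_def dist_norm)
  have R0: "0 \<le> R" using R norm_ge_zero order_trans by blast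
  have bound: "AE s in Q. (gdot k z s)\<^sup>2 \<le> (n * R)\<^sup>2 * (Lw (\<omega> k s))\<^sup>2"
    using AE_norm_v[of k] AE_space
  proof eventually_elim
    case (elim s)
    have "\<bar>gdot k z s\<bar> \<le> norm (gbar k (x k s) (v k s) (\<omega> k s)) * norm (x k s - z s)"
      unfolding gdot_def by (rule Cauchy_Schwarz_ineq2)
    also have "\<dots> \<le> (n * Lw (\<omega> k s)) * R"
      using gbar_bound[OF x_in] elim w_space R Lw_nonneg by (intro mult_mono mult_nonneg_nonneg) auto
    finally have "\<bar>gdot k z s\<bar>\<^sup>2 \<le> (n * Lw (\<omega> k s) * R)\<^sup>2"
      by (intro power_mono) auto
    then show ?case by (simp add: power_mult_distrib mult_ac)
  qed
  have int_L: "integrable Q (\<lambda>s. (n * R)\<^sup>2 * (Lw (\<omega> k s))\<^sup>2)"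
    using L_int integral_w(2)[of "\<lambda>w. (Lw w)\<^sup>2" k] by simp
  show sq: "integrable Q (\<lambda>s. (gdot k z s)\<^sup>2)"
    by (rule Bochner_Integration.integrable_bound[OF int_L]) (use bound in \<open>auto elim!: eventually_mono\<close>)
  then show int: "integrable Q (gdot k z)"
    by (rule Q.square_integrable_imp_integrable[rotated]) measurable
  have "(\<integral>s. (gdot k z s)\<^sup>2 \<partial>Q) \<le> (\<integral>s. (n * R)\<^sup>2 * (Lw (\<omega> k s))\<^sup>2 \<partial>Q)"
    by (rule integral_mono_AE[OF sq int_L bound])
  also have "\<dots> = (n * L\<^sub>0 * R)\<^sup>2"
    using integral_w(1)[of "\<lambda>w. (Lw w)\<^sup>2" k] by (simp add: L0_sq power_mult_distrib mult_ac)
  finally show "(\<integral>s. (gdot k z s)\<^sup>2 \<partial>Q) \<le> (n * L\<^sub>0 * diameter X)\<^sup>2"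
    by (simp add: R_def)
  define \<Phi> where "\<Phi> q = gbar k (x k (fst q)) (fst (snd q)) (snd (snd q)) \<bullet> (x k (fst q) - z (fst q))" for q
  have \<Phi>_meas: "\<Phi> \<in> borel_measurable (P k \<Otimes>\<^sub>M N)" unfolding \<Phi>_def by measurable
  have \<Phi>_Z: "\<Phi> (s, Z k s) = gdot k z s" for s
    by (simp add: \<Phi>_def Z_def gdot_def)
  have \<Phi>_drift: "(\<integral>q. \<Phi> (s, q) \<partial>distr Q N (Z k)) = mean_drift k (x k s) (z s)" for s
    by (simp add: \<Phi>_def mean_drift_def)
  have ind: "distr Q (P k \<Otimes>\<^sub>M N) (\<lambda>s. (s, Z k s)) = distr Q (P k) (\<lambda>s. s) \<Otimes>\<^sub>M distr Q N (Z k)"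
    by (rule Q.distr_past_pair[OF Z_indep])
  have int': "integrable Q (\<lambda>s. \<Phi> (s, Z k s))" unfolding \<Phi>_Z by (rule int)
  note fub = Q.integrable_fubini_past[OF ind sub_P Z_measurable \<Phi>_meas int']
    Q.integral_fubini_past[OF ind sub_P Z_measurable \<Phi>_meas int']
    Q.cond_exp_fubini_past[OF ind sub_P Z_measurable \<Phi>_meas int']
  show "integrable Q (\<lambda>s. mean_drift k (x k s) (z s))"
    "(\<integral>s. gdot k z s \<partial>Q) = (\<integral>s. mean_drift k (x k s) (z s) \<partial>Q)"
    "AE s in Q. real_cond_exp Q (P k) (gdot k z) s
        = mean_drift k (x k s) (z s)"
    using fub unfolding \<Phi>_Z \<Phi>_drift by auto
  interpret D: prob_space "distr Q N (Z k)" by (rule Q.prob_space_distr) simp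
  have "(\<lambda>s. \<integral>q. \<Phi> (s, q) \<partial>distr Q N (Z k)) \<in> borel_measurable (P k)"
    using \<Phi>_meas by (intro D.borel_measurable_lebesgue_integral) simp
  then show "(\<lambda>s. mean_drift k (x k s) (z s)) \<in> borel_measurable (P k)" unfolding \<Phi>_drift .
qed

end

section \<open>Descent in expectation and along almost every path\<close>

lemma infdist_closest_point:
  fixes S :: "'a::euclidean_space set"
  assumes "closed S" "S \<noteq> {}"
  shows "infdist p S = norm (p - closest_point S p)"
proof (rule antisym)
  show "infdist p S \<le> norm (p - closest_point S p)"
    using infdist_le[OF closest_point_in_set[OF assms], of p p] by (simp add: dist_norm)
  have "dist p (closest_point S p) \<le> infdist p S"
    unfolding infdist_notempty[OF assms(2)]
    using assms closest_point_le by (intro cINF_greatest) auto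
  then show "norm (p - closest_point S p) \<le> infdist p S" by (simp add: dist_norm)
qed

context zeroth_order_scheme
begin

abbreviation "DX \<equiv> (1 / 2) * (SUP p\<in>X. (infdist p Xstar)\<^sup>2)"

text \<open>A real supremum dominates its family only if that family is bounded; the diameter of
  \<open>X\<close> supplies the bound.\<close>

lemma infdist_le_DX:
  assumes p: "p \<in> X"
  shows "(infdist p Xstar)\<^sup>2 / 2 \<le> DX"
proof -
  obtain z where z: "z \<in> Xstar" using Xstar_nonempty by blast
  have "bdd_above ((\<lambda>p. (infdist p Xstar)\<^sup>2) ` X)"
  proof (rule bdd_aboveI2)
    fix q assume "q \<in> X"
    then have "infdist q Xstar \<le> diameter X"
      using z Xstar_sub diameter_bounded_bound[OF X(3)] by (intro infdist_le2[OF z]) auto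
    then show "(infdist q Xstar)\<^sup>2 \<le> (diameter X)\<^sup>2"
      by (intro power_mono infdist_nonneg)
  qed
  from cSUP_upper[OF p this] show ?thesis by simp
qed

lemma DX_nonneg: "0 \<le> DX"
  using infdist_le_DX[OF x0(1)] zero_le_power2[of "infdist x\<^sub>0 Xstar"] by linarith

lemma fimp_integrable:
  assumes [measurable]: "h \<in> borel_measurable Q" and hX: "\<And>s. h s \<in> X"
  shows "integrable Q (\<lambda>s. fimp (h s))"
proof -
  have "bounded (fimp ` X)"
    using compact_continuous_image[OF fimp_continuous compact_X] by (rule compact_imp_bounded)
  then obtain c where c: "\<And>p. p \<in> X \<Longrightarrow> \<bar>fimp p\<bar> \<le> c" by (auto simp: bounded_iff)
  have "integrable Q (\<lambda>s. \<phi> (h s))"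
  proof (rule Q.integrable_const_bound[where B = c])
    show "AE s in Q. norm (\<phi> (h s)) \<le> c" using c hX by (simp add: \<phi>_eq X_sub_C)
  qed measurable
  then show ?thesis using hX by (simp add: \<phi>_eq X_sub_C)
qed

definition gap where "gap k = (\<integral>s. fimp (x k s) \<partial>Q) - (INF p\<in>X. fimp p)"

definition mdist where "mdist k = (\<integral>s. (infdist (x k s) Xstar)\<^sup>2 / 2 \<partial>Q)"

lemma infdist_measurable [measurable]: "(\<lambda>p. infdist p Xstar) \<in> borel_measurable borel"
  by (intro borel_measurable_continuous_onI continuous_intros)

lemma mdist_integrable: "integrable Q (\<lambda>s. (infdist (x k s) Xstar)\<^sup>2 / 2)"
proof (rule Q.integrable_const_bound)
  show "AE s in Q. norm ((infdist (x k s) Xstar)\<^sup>2 / 2) \<le> DX"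
    using infdist_le_DX[OF x_in] by (intro AE_I2) simp
qed measurable

lemma mdist_bounds: "0 \<le> mdist k" "mdist k \<le> DX"
proof -
  show "0 \<le> mdist k" unfolding mdist_def by (intro integral_nonneg_AE) auto
  have "mdist k \<le> (\<integral>s. DX \<partial>Q)"
    unfolding mdist_def using infdist_le_DX[OF x_in] mdist_integrable
    by (intro integral_mono) auto
  then show "mdist k \<le> DX" by (simp add: Q.prob_space)
qed

text \<open>The projection of the current iterate onto the minimisers is kept as comparison point
  for the next one: it realises the current distance, can only overestimate the next distance, and
  is known from the past.\<close>

lemma expected_descent:
  "\<gamma> k * gap k \<le> mdist k - mdist (Suc k) + (\<gamma> k)\<^sup>2 * (DX + 3 / 2 * n\<^sup>2 * L\<^sub>0\<^sup>2)
    + (2 + 3 * (\<gamma> k)\<^sup>2) * n\<^sup>2 * (B * dt ^ t k / (\<eta> k)\<^sup>2) * Lt\<^sub>0\<^sup>2 + \<gamma> k * \<eta> k * L\<^sub>0"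
proof -
  define p where "p s = closest_point Xstar (x k s)" for s
  define h where "h = gdot k p"
  define A where "A = (2 + 3 * (\<gamma> k)\<^sup>2) * n\<^sup>2 * (B * dt ^ t k / (\<eta> k)\<^sup>2)"
  have pS: "p s \<in> Xstar" for s
    unfolding p_def by (rule closest_point_in_set[OF closed_Xstar Xstar_nonempty])
  then have pX: "p s \<in> X" for s using Xstar_sub by blast
  have p_meas: "p \<in> borel_measurable (P k)"
    unfolding p_def[abs_def]
    by (rule measurable_compose[OF x_past closest_point_measurable[OF closed_Xstar convex_Xstar Xstar_nonempty]])
  note dr = drift[OF p_meas pX, folded h_def]
  have inf_eq: "infdist (x k s) Xstar = norm (x k s - p s)" for s
    unfolding p_def by (rule infdist_closest_point[OF closed_Xstar Xstar_nonempty])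
  have path: "AE s in Q. (infdist (x (Suc k) s) Xstar)\<^sup>2 / 2 \<le> (infdist (x k s) Xstar)\<^sup>2 / 2 - \<gamma> k * h s
      + (\<gamma> k)\<^sup>2 * DX + A * (Ltw (\<omega> k s))\<^sup>2 + 3 / 2 * (\<gamma> k)\<^sup>2 * n\<^sup>2 * (Lw (\<omega> k s))\<^sup>2"
    using AE_norm_v[of k] AE_space
  proof eventually_elim
    case (elim s)
    have "infdist (x (Suc k) s) Xstar \<le> norm (x (Suc k) s - p s)"
      using infdist_le[OF pS, of "x (Suc k) s" s] by (simp add: dist_norm)
    then have "(infdist (x (Suc k) s) Xstar)\<^sup>2 \<le> (norm (x (Suc k) s - p s))\<^sup>2"
      by (intro power_mono infdist_nonneg)
    moreover have "(\<gamma> k)\<^sup>2 * ((infdist (x k s) Xstar)\<^sup>2 / 2) \<le> (\<gamma> k)\<^sup>2 * DX"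
      by (intro mult_left_mono infdist_le_DX x_in) simp
    ultimately show ?case
      using descent[OF elim(2,1) pX[of s]] unfolding inf_eq[symmetric] h_def gdot_def A_def[symmetric]
      by linarith
  qed
  have int_w: "integrable Q (\<lambda>s. (Ltw (\<omega> k s))\<^sup>2)" "integrable Q (\<lambda>s. (Lw (\<omega> k s))\<^sup>2)"
    using integral_w(2)[of "\<lambda>w. (Ltw w)\<^sup>2" k] integral_w(2)[of "\<lambda>w. (Lw w)\<^sup>2" k] Lt_int L_int by auto
  have E_w: "(\<integral>s. (Ltw (\<omega> k s))\<^sup>2 \<partial>Q) = Lt\<^sub>0\<^sup>2" "(\<integral>s. (Lw (\<omega> k s))\<^sup>2 \<partial>Q) = L\<^sub>0\<^sup>2"
    using integral_w(1)[of "\<lambda>w. (Ltw w)\<^sup>2" k] integral_w(1)[of "\<lambda>w. (Lw w)\<^sup>2" k] by (auto simp: L0_sq Lt0_sq)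
  have i1: "integrable Q (\<lambda>s. (infdist (x k s) Xstar)\<^sup>2 / 2 - \<gamma> k * h s)"
    using mdist_integrable dr(2) by (intro Bochner_Integration.integrable_diff integrable_mult_right)
  then have i2: "integrable Q (\<lambda>s. (infdist (x k s) Xstar)\<^sup>2 / 2 - \<gamma> k * h s + (\<gamma> k)\<^sup>2 * DX)"
    by (intro Bochner_Integration.integrable_add Q.integrable_const)
  then have i3: "integrable Q (\<lambda>s. (infdist (x k s) Xstar)\<^sup>2 / 2 - \<gamma> k * h s + (\<gamma> k)\<^sup>2 * DX + A * (Ltw (\<omega> k s))\<^sup>2)"
    by (rule Bochner_Integration.integrable_add[OF _ integrable_mult_right[OF int_w(1)]])
  have "mdist (Suc k) \<le> (\<integral>s. (infdist (x k s) Xstar)\<^sup>2 / 2 - \<gamma> k * h s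
      + (\<gamma> k)\<^sup>2 * DX + A * (Ltw (\<omega> k s))\<^sup>2 + 3 / 2 * (\<gamma> k)\<^sup>2 * n\<^sup>2 * (Lw (\<omega> k s))\<^sup>2 \<partial>Q)"
    unfolding mdist_def
    by (rule integral_mono_AE[OF mdist_integrable
          Bochner_Integration.integrable_add[OF i3 integrable_mult_right[OF int_w(2)]] path])
  also have "\<dots> = mdist k - \<gamma> k * (\<integral>s. h s \<partial>Q) + (\<gamma> k)\<^sup>2 * DX + A * Lt\<^sub>0\<^sup>2 + 3 / 2 * (\<gamma> k)\<^sup>2 * n\<^sup>2 * L\<^sub>0\<^sup>2"
    using i1 i2 i3 int_w mdist_integrable dr(2)
    by (simp only: Bochner_Integration.integral_add Bochner_Integration.integral_diff integrable_mult_right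
          Q.integrable_const integral_mult_right_zero E_w mdist_def lebesgue_integral_const Q.prob_space scaleR_one)
  also have "(\<integral>s. h s \<partial>Q) = (\<integral>s. mean_drift k (x k s) (p s) \<partial>Q)" by (rule dr(5))
  finally have main: "\<gamma> k * (\<integral>s. mean_drift k (x k s) (p s) \<partial>Q)
     \<le> mdist k - mdist (Suc k) + (\<gamma> k)\<^sup>2 * DX + A * Lt\<^sub>0\<^sup>2 + 3 / 2 * (\<gamma> k)\<^sup>2 * n\<^sup>2 * L\<^sub>0\<^sup>2" by linarith
  have "gap k - \<eta> k * L\<^sub>0 = (\<integral>s. fimp (x k s) - (INF p\<in>X. fimp p) - \<eta> k * L\<^sub>0 \<partial>Q)"
    unfolding gap_def using fimp_integrable[OF x_measurable x_in, of k] by (simp add: Q.prob_space)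
  also have "\<dots> \<le> (\<integral>s. mean_drift k (x k s) (p s) \<partial>Q)"
  proof (rule integral_mono)
    show "fimp (x k s) - (INF p\<in>X. fimp p) - \<eta> k * L\<^sub>0 \<le> mean_drift k (x k s) (p s)" for s
      using mean_drift_ge[OF x_in pX] fimp_Xstar(1)[OF pS[of s]] by simp
  qed (use fimp_integrable[OF x_measurable x_in, of k] dr(3) in auto)
  finally have "\<gamma> k * (gap k - \<eta> k * L\<^sub>0) \<le> \<gamma> k * (\<integral>s. mean_drift k (x k s) (p s) \<partial>Q)"
    using gamma[of k] by (intro mult_left_mono) auto
  then show ?thesis using main unfolding A_def[symmetric] by (simp add: algebra_simps)
qed

lemma average_in:
  assumes "\<And>k. 0 < w k"
  shows "(\<Sum>j\<le>K. w j *\<^sub>R x j s) /\<^sub>R (\<Sum>j\<le>K. w j) \<in> X"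
    and "fimp ((\<Sum>j\<le>K. w j *\<^sub>R x j s) /\<^sub>R (\<Sum>j\<le>K. w j)) \<le> (\<Sum>j\<le>K. w j * fimp (x j s)) / (\<Sum>j\<le>K. w j)"
proof -
  define W where "W = (\<Sum>j\<le>K. w j)"
  have W: "0 < W" unfolding W_def using assms by (intro sum_pos) auto
  have one: "(\<Sum>j\<le>K. w j / W) = 1" using W by (simp add: sum_divide_distrib[symmetric] W_def[symmetric])
  have nonneg: "0 \<le> w j / W" for j using assms[of j] W by simp
  have eq: "(\<Sum>j\<le>K. w j *\<^sub>R x j s) /\<^sub>R W = (\<Sum>j\<le>K. (w j / W) *\<^sub>R x j s)"
    by (simp add: scaleR_sum_right divide_inverse mult.commute)
  show "(\<Sum>j\<le>K. w j *\<^sub>R x j s) /\<^sub>R (\<Sum>j\<le>K. w j) \<in> X"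
    unfolding W_def[symmetric] eq using one nonneg x_in by (intro convex_sum X) auto
  have "fimp (\<Sum>j\<le>K. (w j / W) *\<^sub>R x j s) \<le> (\<Sum>j\<le>K. w j / W * fimp (x j s))"
    using one nonneg x_in X_sub_C by (intro convex_on_sum[OF _ _ conv]) auto
  then show "fimp ((\<Sum>j\<le>K. w j *\<^sub>R x j s) /\<^sub>R (\<Sum>j\<le>K. w j)) \<le> (\<Sum>j\<le>K. w j * fimp (x j s)) / (\<Sum>j\<le>K. w j)"
    unfolding W_def[symmetric] eq by (simp add: sum_divide_distrib)
qed

lemma average_gap:
  assumes w: "\<And>k. 0 < w k"
  shows "(\<integral>s. fimp ((\<Sum>j\<le>K. w j *\<^sub>R x j s) /\<^sub>R (\<Sum>j\<le>K. w j)) \<partial>Q) - (INF p\<in>X. fimp p)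
    \<le> (\<Sum>j\<le>K. w j * gap j) / (\<Sum>j\<le>K. w j)"
proof -
  define W where "W = (\<Sum>j\<le>K. w j)"
  have W: "0 < W" unfolding W_def using w by (intro sum_pos) auto
  have int: "integrable Q (\<lambda>s. fimp (x j s))" for j by (rule fimp_integrable[OF x_measurable x_in])
  have "(\<integral>s. fimp ((\<Sum>j\<le>K. w j *\<^sub>R x j s) /\<^sub>R (\<Sum>j\<le>K. w j)) \<partial>Q)
      \<le> (\<integral>s. (\<Sum>j\<le>K. w j * fimp (x j s)) / W \<partial>Q)"
    unfolding W_def using average_in[OF w] int x_in
    by (intro integral_mono fimp_integrable integrable_divide Bochner_Integration.integrable_sum integrable_mult_right) auto
  also have "\<dots> = (\<Sum>j\<le>K. w j * (\<integral>s. fimp (x j s) \<partial>Q)) / W"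
    using int by (simp add: Bochner_Integration.integral_sum)
  also have "\<dots> = (\<Sum>j\<le>K. w j * gap j + w j * (INF p\<in>X. fimp p)) / W"
    by (simp add: gap_def algebra_simps)
  also have "\<dots> = (\<Sum>j\<le>K. w j * gap j) / W + (INF p\<in>X. fimp p)"
    using W by (simp add: sum.distrib sum_distrib_right[symmetric] W_def[symmetric] add_divide_distrib)
  finally show ?thesis by (simp add: W_def)
qed

text \<open>For a fixed minimiser the descent consists of the gap, a martingale difference, the bias
  \<open>\<gamma> k * \<eta> k * L\<^sub>0\<close>, and terms of order
  \<open>(\<gamma> k)\<^sup>2\<close> with a random factor. All but the gap are summable on almost
  every path.\<close>

lemma distance_converges:
  assumes sq: "summable (\<lambda>k. (\<gamma> k)\<^sup>2)" and smooth: "summable (\<lambda>k. \<gamma> k * \<eta> k)"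
    and inexact: "\<And>k. B * dt ^ t k / (\<eta> k)\<^sup>2 \<le> c * (\<gamma> k)\<^sup>2" and bdd: "\<And>k. \<gamma> k \<le> \<Gamma>"
    and z: "z \<in> Xstar"
  shows "AE s in Q. convergent (\<lambda>k. norm (x k s - z)) \<and> summable (\<lambda>k. \<gamma> k * (fimp (x k s) - fimp z))"
proof -
  have zX: "z \<in> X" using z Xstar_sub by blast
  define R where "R = diameter X"
  have R: "norm (x k s - z) \<le> R" for k s
    using diameter_bounded_bound[OF X(3) x_in zX] by (simp add: R_def dist_norm)
  have R0: "0 \<le> R" using R norm_ge_zero order_trans by blast
  define b where "b = n * L\<^sub>0 * R"
  have b0: "0 \<le> b" unfolding b_def using L0_nonneg R0 by simp
  define h where "h k = gdot k (\<lambda>s. z)" for k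
  define m where "m k s = mean_drift k (x k s) z" for k s
  define \<zeta> where "\<zeta> k s = \<gamma> k * (h k s - m k s)" for k s
  have z_past: "(\<lambda>s. z) \<in> borel_measurable (P k)" for k by simp
  note dr = drift[OF z_past zX, folded h_def m_def]
  have m_bound: "\<bar>m k s\<bar> \<le> b" for k s
  proof -
    have "\<bar>m k s\<bar> \<le> n * L\<^sub>0 * norm (x k s - z)" unfolding m_def by (rule mean_drift_integrable(2)[OF x_in])
    also have "\<dots> \<le> n * L\<^sub>0 * R" using R L0_nonneg by (intro mult_left_mono) auto
    finally show ?thesis by (simp add: b_def)
  qed
  have [measurable]: "h k \<in> borel_measurable Q" "m k \<in> borel_measurable Q" for k
    using borel_measurable_integrable[OF dr(2)] borel_measurable_integrable[OF dr(3)] by simp_all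
  have \<zeta>_past: "\<zeta> k \<in> borel_measurable (P (Suc k))" for k
  proof -
    have [measurable]: "x k \<in> borel_measurable (P (Suc k))" "v k \<in> borel_measurable (P (Suc k))"
      "\<omega> k \<in> measurable (P (Suc k)) M" "m k \<in> borel_measurable (P (Suc k))"
      using P_mono[OF x_past] P_mono[OF dr(4)] vw_past[of k "Suc k"] by auto
    show ?thesis unfolding \<zeta>_def h_def gdot_def by measurable
  qed
  have \<zeta>_sq_le: "(\<zeta> k s)\<^sup>2 \<le> (\<gamma> k)\<^sup>2 * (2 * (h k s)\<^sup>2 + 2 * b\<^sup>2)" for k s
  proof -
    have "0 \<le> (h k s + m k s)\<^sup>2" by simp
    then have "(h k s - m k s)\<^sup>2 \<le> 2 * (h k s)\<^sup>2 + 2 * (m k s)\<^sup>2" by (simp add: power2_sum power2_diff)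
    also have "(m k s)\<^sup>2 \<le> b\<^sup>2" using power_mono[OF m_bound[of k s], of 2] by simp
    finally show ?thesis unfolding \<zeta>_def power_mult_distrib by (intro mult_left_mono) auto
  qed
  have dom: "integrable Q (\<lambda>s. (\<gamma> k)\<^sup>2 * (2 * (h k s)\<^sup>2 + 2 * b\<^sup>2))" for k
    using dr(1) by (intro integrable_mult_right Bochner_Integration.integrable_add) auto
  have \<zeta>_sq: "integrable Q (\<lambda>s. (\<zeta> k s)\<^sup>2)" for k
    by (rule Bochner_Integration.integrable_bound[OF dom[of k]])
      (use \<zeta>_sq_le in \<open>auto simp: \<zeta>_def[abs_def] intro!: AE_I2 intro: order_trans[OF _ abs_ge_self]\<close>)
  have "AE s in Q. summable (\<lambda>k. \<zeta> k s)"
  proof (rule Q.martingale_difference_series_summable[where F = P])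
    show "subalgebra Q (P k)" "sets (P k) \<subseteq> sets (P (Suc k))" "\<zeta> k \<in> borel_measurable (P (Suc k))"
      "integrable Q (\<lambda>s. (\<zeta> k s)\<^sup>2)" for k
      using sub_P past_mono[OF Z_measurable] \<zeta>_past \<zeta>_sq by auto
    show "AE s in Q. real_cond_exp Q (P k) (\<zeta> k) s = 0" for k
    proof -
      interpret S: finite_measure_subalgebra Q "P k" by unfold_locales (rule sub_P)
      have "AE s in Q. real_cond_exp Q (P k) (\<lambda>s. \<gamma> k * (h k s - m k s)) s
          = \<gamma> k * real_cond_exp Q (P k) (\<lambda>s. h k s - m k s) s"
        using dr(2,3) by (intro S.real_cond_exp_cmult) auto
      moreover have "AE s in Q. real_cond_exp Q (P k) (\<lambda>s. h k s - m k s) s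
          = real_cond_exp Q (P k) (h k) s - real_cond_exp Q (P k) (m k) s"
        using dr(2,3) by (intro S.real_cond_exp_diff) auto
      moreover have "AE s in Q. real_cond_exp Q (P k) (m k) s = m k s"
        using dr(3,4) by (intro S.real_cond_exp_F_meas) auto
      moreover note dr(6)[of k]
      ultimately show ?thesis unfolding \<zeta>_def[abs_def] by eventually_elim simp
    qed
    show "summable (\<lambda>k. \<integral>s. (\<zeta> k s)\<^sup>2 \<partial>Q)"
    proof (rule summable_comparison_test'[where N = 0])
      show "summable (\<lambda>k. (\<gamma> k)\<^sup>2 * (4 * b\<^sup>2))" using sq by (rule summable_mult2)
      fix k
      have "(\<integral>s. (\<zeta> k s)\<^sup>2 \<partial>Q) \<le> (\<integral>s. (\<gamma> k)\<^sup>2 * (2 * (h k s)\<^sup>2 + 2 * b\<^sup>2) \<partial>Q)"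
        by (rule integral_mono[OF \<zeta>_sq dom \<zeta>_sq_le])
      also have "\<dots> = (\<gamma> k)\<^sup>2 * (2 * (\<integral>s. (h k s)\<^sup>2 \<partial>Q) + 2 * b\<^sup>2)"
        using dr(1) by (simp add: Q.prob_space)
      also have "\<dots> \<le> (\<gamma> k)\<^sup>2 * (4 * b\<^sup>2)"
        using dr(7)[of k] by (intro mult_left_mono) (auto simp: b_def R_def)
      finally show "norm (\<integral>s. (\<zeta> k s)\<^sup>2 \<partial>Q) \<le> (\<gamma> k)\<^sup>2 * (4 * b\<^sup>2)" by simp
    qed
  qed
  moreover
  \<comment> \<open>Collects the terms of second order in the step. \<open>inexact\<close> and
    \<open>\<gamma> k \<le> \<Gamma>\<close> bring the lower-level error to this form; the mean of
    \<open>W (\<omega> k s)\<close> is the same for all \<open>k\<close> because the samples are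
    identically distributed.\<close>
  define W where "W w = R\<^sup>2 / 2 + (2 + 3 * \<Gamma>\<^sup>2) * n\<^sup>2 * c * (Ltw w)\<^sup>2 + 3 / 2 * n\<^sup>2 * (Lw w)\<^sup>2" for w
  have c0: "0 \<le> c"
  proof -
    have "0 \<le> B * dt ^ t 0 / (\<eta> 0)\<^sup>2" using B dt by simp
    then have "0 \<le> c * (\<gamma> 0)\<^sup>2" using inexact[of 0] by linarith
    then show ?thesis using gamma[of 0] by (simp add: zero_le_mult_iff)
  qed
  have W0: "0 \<le> W w" for w using c0 by (simp add: W_def)
  have W_int: "integrable M W"
    unfolding W_def using L_int Lt_int
    by (intro Bochner_Integration.integrable_add integrable_mult_right M.integrable_const) auto
  have [measurable]: "W \<in> borel_measurable M" using W_int by simp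
  have "AE s in Q. summable (\<lambda>k. (\<gamma> k)\<^sup>2 * W (\<omega> k s))"
  proof (rule Q.AE_summable_of_summable_expectation)
    show "integrable Q (\<lambda>s. (\<gamma> k)\<^sup>2 * W (\<omega> k s))" for k
      using W_int integral_w(2)[of W k] by simp
    have eq: "(\<integral>s. (\<gamma> k)\<^sup>2 * W (\<omega> k s) \<partial>Q) = (\<gamma> k)\<^sup>2 * (\<integral>w. W w \<partial>M)" for k
      using integral_w(1)[of W k] by simp
    show "summable (\<lambda>k. \<integral>s. (\<gamma> k)\<^sup>2 * W (\<omega> k s) \<partial>Q)"
      unfolding eq by (rule summable_mult2[OF sq])
  qed (use W0 in simp)
  moreover have "AE s in Q. \<forall>k. norm (v k s) = \<eta> k"
    using AE_norm_v by (simp add: AE_all_countable)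
  ultimately show ?thesis using AE_space
  proof eventually_elim
    case (elim s)
    define D where "D k = (norm (x k s - z))\<^sup>2 / 2" for k
    define q where "q k = \<gamma> k * (fimp (x k s) - fimp z)" for k
    define e where "e k = \<gamma> k * \<eta> k * L\<^sub>0 - \<zeta> k s + (\<gamma> k)\<^sup>2 * W (\<omega> k s)" for k
    have D0: "0 \<le> D k" for k by (simp add: D_def)
    have q0: "0 \<le> q k" for k
      using fimp_Xstar(2)[OF z x_in, of k s] gamma[of k] by (simp add: q_def)
    have e_sum: "summable e"
      unfolding e_def[abs_def] using elim smooth
      by (intro summable_add summable_diff summable_mult2) auto
    have step: "D (Suc k) \<le> D k - q k + e k" for k
    proof -
      have s: "s \<in> space Q" "norm (v k s) = \<eta> k" using elim by auto
      have "(2 + 3 * (\<gamma> k)\<^sup>2) * (B * dt ^ t k / (\<eta> k)\<^sup>2) \<le> (2 + 3 * \<Gamma>\<^sup>2) * (c * (\<gamma> k)\<^sup>2)"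
        using inexact[of k] bdd[of k] gamma[of k] B dt by (intro mult_mono) (auto intro!: power_mono)
      then have "(2 + 3 * (\<gamma> k)\<^sup>2) * (B * dt ^ t k / (\<eta> k)\<^sup>2) * (n\<^sup>2 * (Ltw (\<omega> k s))\<^sup>2)
          \<le> (2 + 3 * \<Gamma>\<^sup>2) * (c * (\<gamma> k)\<^sup>2) * (n\<^sup>2 * (Ltw (\<omega> k s))\<^sup>2)"
        by (rule mult_right_mono) simp
      moreover have "(\<gamma> k)\<^sup>2 * D k \<le> (\<gamma> k)\<^sup>2 * (R\<^sup>2 / 2)"
        using power_mono[OF R[of k s], of 2] by (intro mult_left_mono) (auto simp: D_def)
      moreover have "\<gamma> k * (fimp (x k s) - fimp z - \<eta> k * L\<^sub>0) \<le> \<gamma> k * m k s"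
        unfolding m_def using gamma[of k] by (intro mult_left_mono mean_drift_ge x_in zX) auto
      moreover have "\<gamma> k * h k s = \<zeta> k s + \<gamma> k * m k s" by (simp add: \<zeta>_def algebra_simps)
      moreover have "h k s = gbar k (x k s) (v k s) (\<omega> k s) \<bullet> (x k s - z)" by (simp add: h_def gdot_def)
      moreover note descent[OF s zX, folded D_def]
      ultimately show ?thesis
        unfolding q_def e_def W_def by (simp add: algebra_simps)
    qed
    note conv = almost_monotone_convergent[OF D0 q0 e_sum step]
    then obtain l where "D \<longlonglongrightarrow> l" by (auto simp: convergent_def)
    then have "(\<lambda>k. sqrt (2 * D k)) \<longlonglongrightarrow> sqrt (2 * l)" by (intro tendsto_intros)
    moreover have "sqrt (2 * D k) = norm (x k s - z)" for k by (simp add: D_def)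
    ultimately show ?case using conv(2) by (auto simp: convergent_def q_def)
  qed
qed

lemma iterates_converge:
  assumes sq: "summable (\<lambda>k. (\<gamma> k)\<^sup>2)" and smooth: "summable (\<lambda>k. \<gamma> k * \<eta> k)"
    and div: "\<not> summable \<gamma>"
    and inexact: "\<And>k. B * dt ^ t k / (\<eta> k)\<^sup>2 \<le> c * (\<gamma> k)\<^sup>2" and bdd: "\<And>k. \<gamma> k \<le> \<Gamma>"
  shows "AE s in Q. \<exists>l\<in>Xstar. (\<lambda>k. x k s) \<longlonglongrightarrow> l"
proof -
  obtain m where m: "m \<in> Xstar" using Xstar_nonempty by blast
  \<comment> \<open>The exceptional null set depends on the minimiser, so only countably many can be
    treated at once.\<close>
  obtain T where T: "countable T" "T \<subseteq> Xstar" "Xstar \<subseteq> closure T"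
    using separable by blast
  have "AE s in Q. \<forall>z\<in>T. convergent (\<lambda>k. norm (x k s - z))"
    unfolding AE_ball_countable[OF T(1)]
    using distance_converges[OF sq smooth inexact bdd] T(2) by (auto elim!: eventually_mono)
  moreover have "AE s in Q. summable (\<lambda>k. \<gamma> k * (fimp (x k s) - fimp m))"
    using distance_converges[OF sq smooth inexact bdd m] by (auto elim!: eventually_mono)
  ultimately show ?thesis
  proof eventually_elim
    case (elim s)
    then show ?case
      using fejer_convergence[OF compact_X fimp_continuous, of "\<lambda>k. x k s" m \<gamma> T] x_in m gamma div T(3)
      by auto
  qed
qed

end

section \<open>Rates and complexity\<close>

lemma powr_neg_summable:
  fixes q :: real
  shows "summable (\<lambda>k. 1 / real (k + 1) powr q) \<longleftrightarrow> 1 < q"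
proof -
  have "summable (\<lambda>k. 1 / real (k + 1) powr q) \<longleftrightarrow> summable (\<lambda>k. real (Suc k) powr (- q))"
    by (simp add: powr_minus_divide)
  also have "\<dots> \<longleftrightarrow> summable (\<lambda>k. real k powr (- q))"
    by (rule summable_Suc_iff)
  also have "\<dots> \<longleftrightarrow> 1 < q"
    using summable_real_powr_iff[of "- q"] by simp
  finally show ?thesis .
qed

text \<open>Rounding up helps because \<open>ln d < 0\<close>, and the condition on \<tau> amounts
  to \<open>\<tau> * ln d \<le> - q\<close>.\<close>

lemma power_decay:
  fixes d :: real
  assumes d: "0 < d" "d < 1" and \<tau>: "- q / ln d \<le> \<tau>"
  shows "d ^ nat \<lceil>\<tau> * ln (real (k + 1))\<rceil> \<le> 1 / real (k + 1) powr q"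
proof -
  have ln_d: "ln d < 0" using d by simp
  have "- q / ln d * ln d \<ge> \<tau> * ln d"
    using \<tau> ln_d by (intro mult_right_mono_neg) auto
  then have \<tau>_ln: "\<tau> * ln d \<le> - q" using ln_d by simp
  have "\<tau> * ln (real (k + 1)) \<le> real (nat \<lceil>\<tau> * ln (real (k + 1))\<rceil>)" by linarith
  then have "real (nat \<lceil>\<tau> * ln (real (k + 1))\<rceil>) * ln d \<le> \<tau> * ln (real (k + 1)) * ln d"
    using ln_d by (intro mult_right_mono_neg) auto
  also have "\<dots> = ln (real (k + 1)) * (\<tau> * ln d)" by simp
  also have "\<dots> \<le> ln (real (k + 1)) * (- q)"
    using \<tau>_ln by (intro mult_left_mono) auto
  finally have "exp (real (nat \<lceil>\<tau> * ln (real (k + 1))\<rceil>) * ln d) \<le> exp (ln (real (k + 1)) * (- q))"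
    by simp
  moreover have "exp (real (nat \<lceil>\<tau> * ln (real (k + 1))\<rceil>) * ln d) = d ^ nat \<lceil>\<tau> * ln (real (k + 1))\<rceil>"
    using d by (simp add: exp_of_nat_mult)
  moreover have "exp (ln (real (k + 1)) * (- q)) = 1 / real (k + 1) powr q"
    by (simp add: powr_def exp_minus divide_inverse mult.commute)
  ultimately show ?thesis by (simp only:)
qed

text \<open>The predecessor \<open>j\<close> of a positive least index misses the target, and
  \<open>j + 1\<close> in the rate bound is the least index itself, so no additive constant is
  lost.\<close>

lemma least_index_bound:
  fixes h :: "nat \<Rightarrow> real"
  assumes h: "\<And>K. h K \<le> c / sqrt (real (K + 1))" and "0 \<le> c" "0 < \<epsilon>"
  shows "h (LEAST K. h K \<le> \<epsilon>) \<le> \<epsilon>" and "real (LEAST K. h K \<le> \<epsilon>) \<le> (c / \<epsilon>)\<^sup>2"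
proof -
  obtain m where m: "(c / \<epsilon>)\<^sup>2 < real m" using reals_Archimedean2 by blast
  then have "sqrt ((c / \<epsilon>)\<^sup>2) \<le> sqrt (real (m + 1))" by (intro real_sqrt_le_mono) simp
  then have "c / \<epsilon> \<le> sqrt (real (m + 1))"
    using assms(2,3) by (simp add: real_sqrt_abs)
  then have "c / sqrt (real (m + 1)) \<le> \<epsilon>"
    using assms(3) by (simp add: pos_divide_le_eq mult.commute)
  then have "h m \<le> \<epsilon>" using h[of m] by linarith
  then show "h (LEAST K. h K \<le> \<epsilon>) \<le> \<epsilon>" by (rule LeastI)
  show "real (LEAST K. h K \<le> \<epsilon>) \<le> (c / \<epsilon>)\<^sup>2"
  proof (cases "(LEAST K. h K \<le> \<epsilon>)")
    case (Suc j)
    then have "\<not> h j \<le> \<epsilon>" using not_less_Least[of j "\<lambda>K. h K \<le> \<epsilon>"] by simp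
    then have "\<epsilon> < c / sqrt (real (j + 1))" using h[of j] by linarith
    then have "sqrt (real (j + 1)) \<le> c / \<epsilon>" using assms(3) by (simp add: field_simps)
    then have "(sqrt (real (j + 1)))\<^sup>2 \<le> (c / \<epsilon>)\<^sup>2" by (intro power_mono) auto
    then show ?thesis using Suc by simp
  qed simp
qed

lemma hidden_const_nonneg:
  assumes "0 < l" "0 < c1" "0 \<le> c2" "0 \<le> \<eta>0" "0 \<le> D" "0 \<le> B"
  shows "0 \<le> hidden_const l c1 c2 \<eta>0 D B"
  unfolding hidden_const_def using assms by simp

text \<open>The six terms of the expanded left side are matched one by one with those of
  \<open>hidden_const\<close>. Missing factors are supplied by \<open>\<nu> \<ge> 1\<close> and
  \<open>\<rho> \<ge> 1\<close>, and \<open>\<gamma>0\<close> is traded for \<open>L\<close> through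
  \<open>1 / \<gamma>0 \<le> L / c1\<close> and
  \<open>\<gamma>0 \<le> c2 / L \<le> c2 * L / l\<^sup>2\<close>.\<close>

lemma rate_constant_le_hidden_const:
  fixes n :: real
  assumes l: "0 < l" "l \<le> L" "l \<le> Lt" and c: "0 < c1" "c1 / L \<le> \<gamma>0" "\<gamma>0 \<le> c2 / L"
    and pos: "0 < \<gamma>0" "0 < \<eta>0" "0 \<le> D" "0 \<le> B" and n: "1 \<le> n"
    and \<theta>: "\<theta> = D + (2 + 3 * \<gamma>0\<^sup>2) * n\<^sup>2 * Lt\<^sup>2 * B / (\<eta>0\<^sup>2 * \<gamma>0\<^sup>2) + 1.5 * n\<^sup>2 * L\<^sup>2"
  shows "2 * (D / \<gamma>0 + 2 * \<theta> * \<gamma>0 + 2 * \<eta>0 * L) \<le> hidden_const l c1 c2 \<eta>0 D B * (n\<^sup>2 * L * Lt\<^sup>2)"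
proof -
  have L: "0 < L" "0 < Lt" using l by auto
  have c2_pos: "0 < c2" using c(3) pos(1) L by (smt (verit) divide_nonpos_pos)
  define \<nu> where "\<nu> = n\<^sup>2"
  define \<rho> where "\<rho> = Lt\<^sup>2 / l\<^sup>2"
  have \<nu>: "1 \<le> \<nu>" unfolding \<nu>_def using n by simp
  have \<rho>: "1 \<le> \<rho>" unfolding \<rho>_def using l by (simp add: power_mono)
  have inv_\<gamma>: "1 / \<gamma>0 \<le> L / c1" using c(1,2) pos(1) L by (simp add: field_simps)
  have inv_L: "1 / L \<le> L / l\<^sup>2"
  proof -
    have "l * l \<le> L * L" using l by (intro mult_mono) auto
    then show ?thesis using l L by (simp add: field_simps power2_eq_square)
  qed
  have "c2 * (1 / L) \<le> c2 * (L / l\<^sup>2)" using inv_L c2_pos by (intro mult_left_mono) auto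
  then have \<gamma>_le: "\<gamma>0 \<le> c2 * L / l\<^sup>2" using c(3) by simp
  have \<nu>\<rho>: "1 \<le> \<nu> * \<rho>" using mult_mono[OF \<nu> \<rho>] \<nu> by simp
  have scale: "u \<le> w * \<rho>" if "u \<le> w" "0 \<le> w" for u w
    using that mult_left_mono[OF \<rho>, of w] by simp
  have T1: "2 * D / \<gamma>0 \<le> (2 * D * L / c1) * (\<nu> * \<rho>)"
  proof -
    have "2 * D * (1 / \<gamma>0) \<le> 2 * D * (L / c1)" using inv_\<gamma> pos by (intro mult_left_mono) auto
    also have "\<dots> \<le> 2 * D * (L / c1) * (\<nu> * \<rho>)"
      using mult_left_mono[OF \<nu>\<rho>, of "2 * D * (L / c1)"] pos L c by simp
    finally show ?thesis by simp
  qed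
  have T2: "4 * D * \<gamma>0 \<le> (4 * D * c2 * L / l\<^sup>2) * (\<nu> * \<rho>)"
  proof -
    have "4 * D * \<gamma>0 \<le> 4 * D * (c2 * L / l\<^sup>2)" using \<gamma>_le pos by (intro mult_left_mono) auto
    also have "\<dots> \<le> 4 * D * (c2 * L / l\<^sup>2) * (\<nu> * \<rho>)"
      using mult_left_mono[OF \<nu>\<rho>, of "4 * D * (c2 * L / l\<^sup>2)"] pos L c2_pos by simp
    finally show ?thesis by simp
  qed
  have T3: "8 * \<nu> * Lt\<^sup>2 * B / \<eta>0\<^sup>2 * (1 / \<gamma>0) \<le> 8 * \<nu> * Lt\<^sup>2 * B / \<eta>0\<^sup>2 * (L / c1)"
    using inv_\<gamma> pos \<nu> by (intro mult_left_mono) auto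
  have T4: "12 * \<nu> * Lt\<^sup>2 * B / \<eta>0\<^sup>2 * \<gamma>0 \<le> 12 * \<nu> * Lt\<^sup>2 * B / \<eta>0\<^sup>2 * (c2 * L / l\<^sup>2)"
    using \<gamma>_le pos \<nu> by (intro mult_left_mono) auto
  have T5: "6 * \<nu> * L\<^sup>2 * \<gamma>0 \<le> 6 * \<nu> * L * c2 * \<rho>"
  proof -
    have "6 * \<nu> * L\<^sup>2 * \<gamma>0 \<le> 6 * \<nu> * L\<^sup>2 * (c2 / L)" using c(3) \<nu> by (intro mult_left_mono) auto
    also have "\<dots> = 6 * \<nu> * L * c2" using L by (simp add: power2_eq_square)
    also have "\<dots> \<le> 6 * \<nu> * L * c2 * \<rho>" using \<nu> L c2_pos by (intro scale) auto
    finally show ?thesis .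
  qed
  have T6: "4 * \<eta>0 * L \<le> 4 * \<eta>0 * L * (\<nu> * \<rho>)"
    using mult_left_mono[OF \<nu>\<rho>, of "4 * \<eta>0 * L"] pos L by simp
  \<comment> \<open>Multiplied by \<open>\<gamma>0\<close>, the quotient in \<theta> splits into a
    part with \<open>2 / \<gamma>0\<close> and a part with \<open>3 * \<gamma>0\<close>; hence both
    the lower and the upper bound on \<open>\<gamma>0\<close> enter.\<close>
  have "2 * (D / \<gamma>0 + 2 * \<theta> * \<gamma>0 + 2 * \<eta>0 * L)
    = 2 * D / \<gamma>0 + 4 * D * \<gamma>0 + 8 * \<nu> * Lt\<^sup>2 * B / \<eta>0\<^sup>2 * (1 / \<gamma>0)
      + 12 * \<nu> * Lt\<^sup>2 * B / \<eta>0\<^sup>2 * \<gamma>0 + 6 * \<nu> * L\<^sup>2 * \<gamma>0 + 4 * \<eta>0 * L"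
    unfolding \<theta> \<nu>_def using pos by (simp add: field_simps power2_eq_square)
  also have "\<dots> \<le> (2 * D * L / c1) * (\<nu> * \<rho>) + (4 * D * c2 * L / l\<^sup>2) * (\<nu> * \<rho>)
      + 8 * \<nu> * Lt\<^sup>2 * B / \<eta>0\<^sup>2 * (L / c1) + 12 * \<nu> * Lt\<^sup>2 * B / \<eta>0\<^sup>2 * (c2 * L / l\<^sup>2)
      + 6 * \<nu> * L * c2 * \<rho> + 4 * \<eta>0 * L * (\<nu> * \<rho>)"
    using T1 T2 T3 T4 T5 T6 by linarith
  also have "\<dots> = hidden_const l c1 c2 \<eta>0 D B * (n\<^sup>2 * L * Lt\<^sup>2)"
    unfolding hidden_const_def \<rho>_def \<nu>_def using l c pos
    by (simp add: field_simps power2_eq_square power4_eq_xxxx)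
  finally show ?thesis .
qed

text \<open>Every inner run before \<open>K\<close> costs at most \<open>\<tau> * ln K + 1\<close>,
  and \<open>ln K\<close> is at most twice \<open>\<bar>ln H\<bar> + ln Z\<close>. The part without
  \<open>ln Z\<close> is absorbed by \<open>1 \<le> ln Z / ln z\<close>, which is why the argument
  of the logarithm is kept away from one.\<close>

lemma lower_projections_le:
  assumes t: "\<And>k. t k = nat \<lceil>\<tau> * ln (real (k + 1))\<rceil>" and \<tau>: "0 \<le> \<tau>"
    and H: "0 \<le> H" and z: "1 < z" "z \<le> Z" and K: "real K \<le> (H * Z)\<^sup>2"
  shows "real (lower_projections t K) \<le> 2 * H\<^sup>2 * (2 * \<tau> + (2 * \<tau> * \<bar>ln H\<bar> + 1) / ln z) * (Z\<^sup>2 * ln Z)"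
proof (cases "K = 0")
  case True
  have "0 \<le> 2 * H\<^sup>2 * (2 * \<tau> + (2 * \<tau> * \<bar>ln H\<bar> + 1) / ln z) * (Z\<^sup>2 * ln Z)"
    using z \<tau> by (intro mult_nonneg_nonneg add_nonneg_nonneg divide_nonneg_nonneg) auto
  then show ?thesis using True by (simp add: lower_projections_def)
next
  case False
  then have K1: "1 \<le> real K" by simp
  have H_pos: "0 < H"
  proof (rule ccontr)
    assume "\<not> 0 < H"
    then have "H = 0" using H by simp
    then show False using K K1 by simp
  qed
  have Z: "1 < Z" "0 < ln z" "ln z \<le> ln Z" using z by auto
  have "ln (real K) \<le> ln ((H * Z)\<^sup>2)" using K K1 by (intro ln_mono) auto
  also have "\<dots> = 2 * (ln H + ln Z)"
    using H_pos Z by (simp add: ln_realpow ln_mult)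
  also have "\<dots> \<le> 2 * \<bar>ln H\<bar> + 2 * ln Z" using abs_ge_self[of "ln H"] by simp
  finally have ln_K: "\<tau> * ln (real K) \<le> \<tau> * (2 * \<bar>ln H\<bar> + 2 * ln Z)"
    using \<tau> by (rule mult_left_mono)
  define c where "c = 2 * \<tau> * \<bar>ln H\<bar> + 1"
  have c: "0 \<le> c" using \<tau> by (simp add: c_def)
  have t_le: "real (t k) \<le> 2 * \<tau> * ln Z + c" if "k < K" for k
  proof -
    have "0 \<le> \<tau> * ln (real (k + 1))" using \<tau> by simp
    then have "real (t k) \<le> \<tau> * ln (real (k + 1)) + 1" unfolding t by linarith
    also have "\<tau> * ln (real (k + 1)) \<le> \<tau> * ln (real K)"
      using that \<tau> by (intro mult_left_mono ln_mono) auto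
    finally show ?thesis using ln_K by (simp add: c_def algebra_simps)
  qed
  have "c = c * 1" by simp
  also have "\<dots> \<le> c * (ln Z / ln z)" using Z c by (intro mult_left_mono) auto
  finally have c_le: "c \<le> c / ln z * ln Z" by simp
  have "real (lower_projections t K) = (\<Sum>k<K. 2 * real (t k))" by (simp add: lower_projections_def)
  also have "\<dots> \<le> (\<Sum>k<K. 2 * (2 * \<tau> * ln Z + c))"
    by (intro sum_mono mult_left_mono t_le) auto
  also have "\<dots> = real K * (2 * (2 * \<tau> * ln Z + c))" by simp
  also have "\<dots> \<le> (H * Z)\<^sup>2 * (2 * (2 * \<tau> * ln Z + c / ln z * ln Z))"
    using K c_le c \<tau> Z by (intro mult_mono) auto
  also have "\<dots> = 2 * H\<^sup>2 * (2 * \<tau> + c / ln z) * (Z\<^sup>2 * ln Z)"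
    by (simp add: algebra_simps power_mult_distrib)
  finally show ?thesis by (simp add: c_def)
qed

text \<open>The second stage is also solved at \<open>x k + v k\<close>, which may leave
  \<open>X\<close>; hence Lipschitz continuity, monotonicity and convexity refer to the enlarged
  set. The strict bound \<open>\<mu>F * \<alpha> < 1\<close> makes the logarithm in the condition on
  \<tau> that of a positive number. In the last clause the minimiser is a random variable, as
  different paths may select different minimisers.\<close>

theorem theorem3:
  fixes M :: "'w measure" and Q :: "'s measure"
    and X :: "'a::euclidean_space set" and Y :: "'b::euclidean_space set"
    and f :: "'a \<Rightarrow> 'b \<Rightarrow> 'w \<Rightarrow> real" and G :: "'a \<Rightarrow> 'b \<Rightarrow> 'w \<Rightarrow> 'b"
    and ysol :: "'a \<Rightarrow> 'w \<Rightarrow> 'b" and fimp :: "'a \<Rightarrow> real"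
    and Lw Ltw \<mu>w LFw :: "'w \<Rightarrow> real"
    and n L\<^sub>0 Lt\<^sub>0 \<mu>F LF fstar DX :: real and Xstar :: "'a set"
    and \<gamma>\<^sub>0 \<eta>\<^sub>0 a b r \<alpha> \<tau> dt B \<theta>\<^sub>0 :: real
    and \<gamma> \<eta> S :: "nat \<Rightarrow> real" and t :: "nat \<Rightarrow> nat"
    and v g x xbar :: "nat \<Rightarrow> 's \<Rightarrow> 'a" and \<omega> :: "nat \<Rightarrow> 's \<Rightarrow> 'w"
    and y\<^sub>0 yeps :: "nat \<Rightarrow> 'a \<Rightarrow> 'w \<Rightarrow> 'b" and x\<^sub>0 :: 'a
  assumes n: "n = real DIM('a)"
    \<comment> \<open>the two-stage implicit problem\<close>
    and prob: "prob_space M" "prob_space Q"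
    and f_meas: "(\<lambda>(x, y, w). f x y w) \<in> borel_measurable (borel \<Otimes>\<^sub>M borel \<Otimes>\<^sub>M M)"
    and G_meas: "(\<lambda>(x, y, w). G x y w) \<in> borel_measurable (borel \<Otimes>\<^sub>M borel \<Otimes>\<^sub>M M)"
    and ysol: "\<And>x w. x \<in> X + cball 0 \<eta>\<^sub>0 \<Longrightarrow> w \<in> space M \<Longrightarrow> VI_sol Y (\<lambda>y. G x y w) = {ysol x w}"
    and f_int: "\<And>x. x \<in> X \<Longrightarrow> integrable M (\<lambda>w. f x (ysol x w) w)"
    and fimp: "\<And>x. fimp x = (\<integral>w. f x (ysol x w) w \<partial>M)"
    and Xstar: "Xstar = argmin_on X fimp"
    and fstar: "fstar = (INF x\<in>X. fimp x)"
    and DX: "DX = (1/2) * (SUP x\<in>X. (infdist x Xstar)\<^sup>2)"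
    \<comment> \<open>(B1)\<close>
    and eta0: "\<eta>\<^sub>0 > 0"
    and L_lip: "\<And>w. w \<in> space M \<Longrightarrow> (Lw w)-lipschitz_on (X + cball 0 \<eta>\<^sub>0) (\<lambda>x. f x (ysol x w) w)"
    and L_meas: "Lw \<in> borel_measurable M"
    and L_int: "integrable M (\<lambda>w. (Lw w)\<^sup>2)"
    and L0: "L\<^sub>0 = sqrt (\<integral>w. (Lw w)\<^sup>2 \<partial>M)"
    and Lt_lip: "\<And>w x. w \<in> space M \<Longrightarrow> x \<in> X + cball 0 \<eta>\<^sub>0 \<Longrightarrow> (Ltw w)-lipschitz_on Y (\<lambda>y. f x y w)"
    and Lt_meas: "Ltw \<in> borel_measurable M"
    and Lt_int: "integrable M (\<lambda>w. (Ltw w)\<^sup>2)"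
    and Lt0: "Lt\<^sub>0 = sqrt (\<integral>w. (Ltw w)\<^sup>2 \<partial>M)"
    \<comment> \<open>(B2)\<close>
    and X: "X \<noteq> {}" "closed X" "bounded X" "convex X"
    and Y: "Y \<noteq> {}" "closed Y" "bounded Y" "convex Y"
    \<comment> \<open>(B3)\<close>
    and mono: "\<And>w x. w \<in> space M \<Longrightarrow> x \<in> X + cball 0 \<eta>\<^sub>0 \<Longrightarrow>
                 strongly_monotone_on Y (\<mu>w w) (\<lambda>y. G x y w)"
    and G_lip: "\<And>w x. w \<in> space M \<Longrightarrow> x \<in> X + cball 0 \<eta>\<^sub>0 \<Longrightarrow>
                 (LFw w)-lipschitz_on Y (\<lambda>y. G x y w)"
    and muF: "0 < \<mu>F" "\<And>w. w \<in> space M \<Longrightarrow> \<mu>F \<le> \<mu>w w"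
    and LF: "0 < LF" "\<And>w. w \<in> space M \<Longrightarrow> LFw w \<le> LF"
    \<comment> \<open>(C)\<close>
    and conv: "convex_on (X + cball 0 \<eta>\<^sub>0) fimp"
    \<comment> \<open>(U)\<close>
    and v_indep: "prob_space.indep_vars Q (\<lambda>_. borel) v UNIV"
    and v_distr: "\<And>k. distr Q borel (v k) = uniform_sphere (\<eta> k)"
    and w_indep: "prob_space.indep_vars Q (\<lambda>_. M) \<omega> UNIV"
    and w_distr: "\<And>k. distr Q M (\<omega> k) = M"
    and vw_indep: "prob_space.indep_set Q
          (sets (vimage_algebra (space Q) (\<lambda>s k. v k s) (\<Pi>\<^sub>M k\<in>UNIV. borel)))
          (sets (vimage_algebra (space Q) (\<lambda>s k. \<omega> k s) (\<Pi>\<^sub>M k\<in>UNIV. M)))"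
    \<comment> \<open>parameters\<close>
    and params: "0 < \<gamma>\<^sub>0" "0 < a" "0 < b" "0 \<le> r" "r < 1"
    and gamma: "\<And>k. \<gamma> k = \<gamma>\<^sub>0 / real (k + 1) powr a"
    and eta: "\<And>k. \<eta> k = \<eta>\<^sub>0 / real (k + 1) powr b"
    and alpha: "0 < \<alpha>" "\<alpha> \<le> \<mu>F / LF\<^sup>2" "\<mu>F * \<alpha> < 1"
    and tau: "-2 * (a + b) / ln (1 - \<mu>F * \<alpha>) \<le> \<tau>"
    and t: "\<And>k. t k = nat \<lceil>\<tau> * ln (real (k + 1))\<rceil>"
    \<comment> \<open>the inexact scheme\<close>
    and y0: "\<And>k x w. y\<^sub>0 k x w \<in> Y" "\<And>k. (\<lambda>(x, w). y\<^sub>0 k x w) \<in> borel_measurable (borel \<Otimes>\<^sub>M M)"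
    and yeps: "\<And>k x w. yeps k x w = proj_iter Y \<alpha> (\<lambda>y. G x y w) (y\<^sub>0 k x w) (t k)"
    and g: "\<And>k s. g k s =
        (n * (f (x k s + v k s) (yeps k (x k s + v k s) (\<omega> k s)) (\<omega> k s)
              - f (x k s) (yeps k (x k s) (\<omega> k s)) (\<omega> k s))
          / (norm (v k s) * \<eta> k)) *\<^sub>R v k s"
    and x0: "x\<^sub>0 \<in> X" "\<And>s. x 0 s = x\<^sub>0"
    and x_Suc: "\<And>k s. x (Suc k) s = closest_point X (x k s - \<gamma> k *\<^sub>R g k s)"
    and S: "S 0 = \<gamma>\<^sub>0 powr r" "\<And>k. S (Suc k) = S k + \<gamma> (Suc k) powr r"
    and xbar: "\<And>s. xbar 0 s = x\<^sub>0"
      "\<And>k s. xbar (Suc k) s =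
         (S k *\<^sub>R xbar k s + (\<gamma> (Suc k) powr r) *\<^sub>R x (Suc k) s) /\<^sub>R S (Suc k)"
    \<comment> \<open>the constants of the bounds\<close>
    and dt: "dt = 1 - \<mu>F * \<alpha>"
    and B: "B = lower_level_const Y"
    and theta0: "\<theta>\<^sub>0 = DX + (2 + 3 * \<gamma>\<^sub>0\<^sup>2) * n\<^sup>2 * Lt\<^sub>0\<^sup>2 * B / (\<eta>\<^sub>0\<^sup>2 * \<gamma>\<^sub>0\<^sup>2) + 1.5 * n\<^sup>2 * L\<^sub>0\<^sup>2"
  shows
    "\<comment> \<open>(a)\<close>
     (dt < 1 \<and> 0 < B \<and>
       (\<forall>k. \<forall>xh \<in> X + cball 0 (\<eta> k). \<forall>w \<in> space M. \<forall>z \<in> Y. 1 \<le> t k \<longrightarrow>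
         (norm (proj_iter Y \<alpha> (\<lambda>y. G xh y w) z (t k) - ysol xh w))\<^sup>2 \<le> B * dt ^ t k)) \<and>
     \<comment> \<open>(b)\<close>
     (a = 1/2 \<and> 1/2 \<le> b \<and> b < 1 \<and> r < 2 * (1 - b) \<longrightarrow>
       (\<forall>K. 2 powr (1 / (1 - r)) - 1 \<le> real K \<longrightarrow>
         (\<integral>s. fimp (xbar K s) \<partial>Q) - fstar
           \<le> (2 - r) * (DX / \<gamma>\<^sub>0 + 2 * \<theta>\<^sub>0 * \<gamma>\<^sub>0 / (1 - r)) * (1 / sqrt (real (K + 1)))
             + (2 - r) * (\<eta>\<^sub>0 * L\<^sub>0 / (1 - 0.5 * r - b)) * (1 / real (K + 1) powr b))) \<and>
     (\<forall>\<delta>. a = 1/2 \<and> 0 < \<delta> \<and> \<delta> \<le> 1/2 \<and> b = 1 - \<delta> \<and> r = 0 \<longrightarrow>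
       (\<forall>K\<ge>1.
         (\<integral>s. fimp (xbar K s) \<partial>Q) - fstar
           \<le> 2 * (DX / \<gamma>\<^sub>0 + 2 * \<theta>\<^sub>0 * \<gamma>\<^sub>0) * (1 / sqrt (real (K + 1)))
             + (2 * \<eta>\<^sub>0 * L\<^sub>0 / \<delta>) * (1 / real (K + 1) powr (1 - \<delta>)))) \<and>
     \<comment> \<open>(c)\<close>
     (\<forall>l c\<^sub>1 c\<^sub>2 \<epsilon> K\<epsilon>.
       0 < l \<and> l \<le> L\<^sub>0 \<and> l \<le> Lt\<^sub>0 \<and>
       0 < c\<^sub>1 \<and> c\<^sub>1 / L\<^sub>0 \<le> \<gamma>\<^sub>0 \<and> \<gamma>\<^sub>0 \<le> c\<^sub>2 / L\<^sub>0 \<and>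
       a = 1/2 \<and> b = 1/2 \<and> r = 0 \<and> 0 < \<epsilon> \<and>
       K\<epsilon> = (LEAST K. (\<integral>s. fimp (xbar K s) \<partial>Q) - fstar \<le> \<epsilon>) \<longrightarrow>
         (\<integral>s. fimp (xbar K\<epsilon> s) \<partial>Q) - fstar \<le> \<epsilon> \<and>
         real (upper_projections K\<epsilon>)
           \<le> upper_hidden l c\<^sub>1 c\<^sub>2 \<eta>\<^sub>0 DX B * (n^4 * L\<^sub>0^2 * Lt\<^sub>0^4 / \<epsilon>^2) \<and>
         real (upper_samples K\<epsilon>)
           \<le> upper_hidden l c\<^sub>1 c\<^sub>2 \<eta>\<^sub>0 DX B * (n^4 * L\<^sub>0^2 * Lt\<^sub>0^4 / \<epsilon>^2) \<and>
         (\<forall>z>1. z \<le> n^2 * L\<^sub>0 * Lt\<^sub>0^2 / \<epsilon> \<longrightarrow>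
           real (lower_projections t K\<epsilon>)
             \<le> lower_hidden l c\<^sub>1 c\<^sub>2 \<eta>\<^sub>0 DX B \<tau> z
                * (n^4 * L\<^sub>0^2 * Lt\<^sub>0^4 / \<epsilon>^2 * ln (n^2 * L\<^sub>0 * Lt\<^sub>0^2 / \<epsilon>)))) \<and>
     \<comment> \<open>(d)\<close>
     (1/2 < a \<and> a \<le> 1 \<and> 1 - a < b \<longrightarrow>
       (\<exists>xs \<in> borel_measurable Q. AE s in Q.
         xs s \<in> Xstar \<and> (\<lambda>k. (norm (xbar k s - xs s))\<^sup>2) \<longlonglongrightarrow> 0))"
proof -
  have dt01: "0 < dt" "dt < 1" using alpha muF(1) by (auto simp: dt)
  have \<alpha>LF: "\<alpha> * LF\<^sup>2 \<le> \<mu>F" using alpha(2) LF(1) by (simp add: pos_le_divide_eq)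
  have B_pos: "0 < B" unfolding B by (rule lower_level_const_pos)
  have sol_in: "ysol p w \<in> VI_sol Y (\<lambda>y. G p y w)" if "p \<in> X + cball 0 \<eta>\<^sub>0" "w \<in> space M" for p w
    using ysol[OF that] by simp
  then have sol_Y: "ysol p w \<in> Y" if "p \<in> X + cball 0 \<eta>\<^sub>0" "w \<in> space M" for p w
    using that by (auto simp: VI_sol_def)
  \<comment> \<open>Stated for every depth \<open>k\<close>, since letting the depth tend to
    infinity also yields the measurable version of the solution map.\<close>
  have lower: "(norm (proj_iter Y \<alpha> (\<lambda>y. G p y w) z k - ysol p w))\<^sup>2 \<le> B * dt ^ k"
    if "p \<in> X + cball 0 \<eta>\<^sub>0" "w \<in> space M" "z \<in> Y" for p w z k
  proof -
    have "(norm (proj_iter Y \<alpha> (\<lambda>y. G p y w) z k - ysol p w))\<^sup>2 \<le> (norm (z - ysol p w))\<^sup>2 * (1 - \<mu>F * \<alpha>) ^ k"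
    proof (rule proj_iter_contraction[OF Y(1,2,4)])
      show "strongly_monotone_on Y \<mu>F (\<lambda>y. G p y w)"
        using mono[OF that(2,1)] muF(2)[OF that(2)] by (rule strongly_monotone_on_mono)
      show "LF-lipschitz_on Y (\<lambda>y. G p y w)"
        using G_lip[OF that(2,1)] LF(2)[OF that(2)] by (rule lipschitz_on_le)
    qed (use alpha \<alpha>LF sol_in that in auto)
    also have "\<dots> \<le> B * dt ^ k"
      using norm_diff_le_lower_level_const[OF Y(3) that(3) sol_Y[OF that(1,2)]] dt01
      unfolding B dt by (intro mult_right_mono) auto
    finally show ?thesis .
  qed
  have \<gamma>_pos: "0 < \<gamma> k" for k using params by (simp add: gamma)
  have powr_ge1: "1 \<le> real (k + 1) powr q" if "0 < q" for k q
    using that by (intro ge_one_powr_ge_zero) auto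
  have \<eta>_bounds: "0 < \<eta> k" "\<eta> k \<le> \<eta>\<^sub>0" for k
    using params eta0 powr_ge1[of b k] by (auto simp: eta divide_le_eq mult_le_cancel_left1)
  have \<gamma>_le: "\<gamma> k \<le> \<gamma>\<^sub>0" for k
    using params powr_ge1[of a k] by (auto simp: gamma divide_le_eq mult_le_cancel_left1)
  interpret S: zeroth_order_scheme M Q X Y f G ysol fimp Lw Ltw n L\<^sub>0 Lt\<^sub>0 \<eta>\<^sub>0 \<alpha> B dt \<gamma> \<eta> t v g x \<omega> y\<^sub>0 yeps x\<^sub>0
  proof (intro zeroth_order_scheme.intro zeroth_order_scheme_axioms.intro)
    show "0 \<le> dt" "dt < 1" "0 \<le> B" using dt01 B_pos by auto
  qed (fact | rule sol_Y lower f_int L_lip Lt_lip; assumption | rule fimp v_distr w_distr \<gamma>_pos \<eta>_bounds y0 yeps g x0 x_Suc)+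
  have Xstar': "Xstar = S.Xstar" by (simp add: Xstar)
  have DX': "DX = S.DX" by (simp add: DX Xstar)
  have DX0: "0 \<le> DX" unfolding DX' by (rule S.DX_nonneg)
  have n1: "1 \<le> n" unfolding n using DIM_positive[where 'a = 'a] by simp
  \<comment> \<open>The depth makes \<open>dt ^ t k\<close> at most the product of the squared
    relative decays of \<open>\<gamma>\<close> and \<open>\<eta>\<close>. The second cancels the
    division by \<open>(\<eta> k)\<^sup>2\<close>, and this constant collects the initial
    values.\<close>
  define c where "c = B / (\<eta>\<^sub>0\<^sup>2 * \<gamma>\<^sub>0\<^sup>2)"
  have inexact: "B * dt ^ t k / (\<eta> k)\<^sup>2 \<le> c * (\<gamma> k)\<^sup>2" for k
  proof -
    have "dt ^ t k \<le> 1 / real (k + 1) powr (2 * (a + b))"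
      unfolding t using tau dt01 by (intro power_decay) (auto simp: dt)
    then have "B * dt ^ t k / (\<eta> k)\<^sup>2 \<le> B * (1 / real (k + 1) powr (2 * (a + b))) / (\<eta> k)\<^sup>2"
      using B_pos by (intro divide_right_mono mult_left_mono) auto
    also have "\<dots> = c * (\<gamma> k)\<^sup>2"
      using params eta0 unfolding c_def gamma eta
      by (simp add: power_divide powr_power powr_add distrib_left mult.commute[of _ 2])
    finally show ?thesis .
  qed
  have \<theta>0: "0 \<le> \<theta>\<^sub>0" unfolding theta0 using DX0 B_pos by simp
  have w_pos: "0 < \<gamma> k powr r" for k using \<gamma>_pos[of k] by simp
  have S0: "S 0 = \<gamma> 0 powr r" by (simp add: S gamma)
  have xbar_eq: "xbar k s = (\<Sum>j\<le>k. (\<gamma> j powr r) *\<^sub>R x j s) /\<^sub>R (\<Sum>j\<le>k. \<gamma> j powr r)" for k s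
    by (rule weighted_mean_recursion(2)[where S = S, OF w_pos S0 S(2)]) (simp_all add: xbar x0)
  \<comment> \<open>The inexactness is merged into the quadratic step term, which is the middle
    summand of \<open>\<theta>\<^sub>0\<close>.\<close>
  have step: "\<gamma> k * S.gap k \<le> S.mdist k - S.mdist (Suc k) + (\<gamma> k)\<^sup>2 * \<theta>\<^sub>0 + \<gamma> k * \<eta> k * L\<^sub>0" for k
  proof -
    have "(2 + 3 * (\<gamma> k)\<^sup>2) * (B * dt ^ t k / (\<eta> k)\<^sup>2) \<le> (2 + 3 * \<gamma>\<^sub>0\<^sup>2) * (c * (\<gamma> k)\<^sup>2)"
      using inexact[of k] \<gamma>_le[of k] \<gamma>_pos[of k] B_pos dt01
      by (intro mult_mono) (auto intro!: power_mono)
    then have "(2 + 3 * (\<gamma> k)\<^sup>2) * (B * dt ^ t k / (\<eta> k)\<^sup>2) * (n\<^sup>2 * Lt\<^sub>0\<^sup>2)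
        \<le> (2 + 3 * \<gamma>\<^sub>0\<^sup>2) * (c * (\<gamma> k)\<^sup>2) * (n\<^sup>2 * Lt\<^sub>0\<^sup>2)"
      by (rule mult_right_mono) simp
    moreover have "(\<gamma> k)\<^sup>2 * \<theta>\<^sub>0 = (\<gamma> k)\<^sup>2 * (DX + 3 / 2 * n\<^sup>2 * L\<^sub>0\<^sup>2)
        + (2 + 3 * \<gamma>\<^sub>0\<^sup>2) * (c * (\<gamma> k)\<^sup>2) * (n\<^sup>2 * Lt\<^sub>0\<^sup>2)"
      unfolding theta0 c_def by (simp add: algebra_simps)
    moreover note S.expected_descent[of k, folded DX']
    ultimately show ?thesis by (simp only: mult_ac)
  qed
  have rate: "(\<integral>s. fimp (xbar K s) \<partial>Q) - fstar
      \<le> (DX / \<gamma>\<^sub>0 + 2 * \<theta>\<^sub>0 * \<gamma>\<^sub>0 / (1 - r)) * (1 / sqrt (real (K + 1)))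
        + \<eta>\<^sub>0 * L\<^sub>0 / (1 - r / 2 - b) * (1 / real (K + 1) powr b)"
    if "a = 1 / 2" "r / 2 + b < 1" for K
  proof -
    have "(\<integral>s. fimp (xbar K s) \<partial>Q) - fstar \<le> (\<Sum>j\<le>K. \<gamma> j powr r * S.gap j) / (\<Sum>j\<le>K. \<gamma> j powr r)"
      unfolding xbar_eq fstar by (rule S.average_gap[OF w_pos])
    also have "\<dots> \<le> (DX / \<gamma>\<^sub>0 + 2 * \<theta>\<^sub>0 * \<gamma>\<^sub>0 / (1 - r)) * (1 / sqrt (real (K + 1)))
        + \<eta>\<^sub>0 * L\<^sub>0 / (1 - r / 2 - b) * (1 / real (K + 1) powr b)"
    proof (rule weighted_average_rate[where e = S.mdist])
      show "S.mdist k \<le> DX" "0 \<le> S.mdist k" for k using S.mdist_bounds[of k] by (auto simp: DX')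
      show "\<gamma> k * S.gap k \<le> S.mdist k - S.mdist (Suc k) + (\<gamma> k)\<^sup>2 * \<theta>\<^sub>0 + \<gamma> k * \<eta> k * L\<^sub>0" for k
        by (rule step)
    qed (use gamma eta that params eta0 \<theta>0 S.L0_nonneg in auto)
    finally show ?thesis .
  qed
  have part_b: "(\<integral>s. fimp (xbar K s) \<partial>Q) - fstar
      \<le> (2 - r) * (DX / \<gamma>\<^sub>0 + 2 * \<theta>\<^sub>0 * \<gamma>\<^sub>0 / (1 - r)) * (1 / sqrt (real (K + 1)))
        + (2 - r) * (\<eta>\<^sub>0 * L\<^sub>0 / (1 - 0.5 * r - b)) * (1 / real (K + 1) powr b)"
    if "a = 1 / 2" "r < 2 * (1 - b)" for K
  proof -
    have rb: "r / 2 + b < 1" using that by simp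
    \<comment> \<open>Both summands of \<open>rate\<close> are nonnegative and
      \<open>2 - r \<ge> 1\<close>, so the factor may be inserted in each.\<close>
    have grow: "u \<le> (2 - r) * u" if "0 \<le> u" for u :: real
      using that params mult_right_mono[of 1 "2 - r" u] by simp
    have "(DX / \<gamma>\<^sub>0 + 2 * \<theta>\<^sub>0 * \<gamma>\<^sub>0 / (1 - r)) * (1 / sqrt (real (K + 1)))
        \<le> (2 - r) * ((DX / \<gamma>\<^sub>0 + 2 * \<theta>\<^sub>0 * \<gamma>\<^sub>0 / (1 - r)) * (1 / sqrt (real (K + 1))))"
      using DX0 \<theta>0 params by (intro grow mult_nonneg_nonneg add_nonneg_nonneg) auto
    moreover have "\<eta>\<^sub>0 * L\<^sub>0 / (1 - r / 2 - b) * (1 / real (K + 1) powr b)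
        \<le> (2 - r) * (\<eta>\<^sub>0 * L\<^sub>0 / (1 - r / 2 - b) * (1 / real (K + 1) powr b))"
      using eta0 S.L0_nonneg rb by (intro grow mult_nonneg_nonneg divide_nonneg_nonneg) auto
    moreover have "0.5 * r = r / 2" by simp
    ultimately show ?thesis using rate[OF that(1) rb, of K] by (simp only: mult.assoc)
  qed
  have part_c: "(\<integral>s. fimp (xbar K\<epsilon> s) \<partial>Q) - fstar \<le> \<epsilon> \<and>
      real K\<epsilon> \<le> upper_hidden l c\<^sub>1 c\<^sub>2 \<eta>\<^sub>0 DX B * (n^4 * L\<^sub>0^2 * Lt\<^sub>0^4 / \<epsilon>^2) \<and>
      (\<forall>z>1. z \<le> n\<^sup>2 * L\<^sub>0 * Lt\<^sub>0\<^sup>2 / \<epsilon> \<longrightarrow> real (lower_projections t K\<epsilon>)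
        \<le> lower_hidden l c\<^sub>1 c\<^sub>2 \<eta>\<^sub>0 DX B \<tau> z * (n^4 * L\<^sub>0^2 * Lt\<^sub>0^4 / \<epsilon>^2 * ln (n\<^sup>2 * L\<^sub>0 * Lt\<^sub>0\<^sup>2 / \<epsilon>)))"
    if l: "0 < l" "l \<le> L\<^sub>0" "l \<le> Lt\<^sub>0" and c12: "0 < c\<^sub>1" "c\<^sub>1 / L\<^sub>0 \<le> \<gamma>\<^sub>0" "\<gamma>\<^sub>0 \<le> c\<^sub>2 / L\<^sub>0"
      and ab: "a = 1/2" "b = 1/2" "r = 0" and \<epsilon>: "0 < \<epsilon>"
      and K\<epsilon>: "K\<epsilon> = (LEAST K. (\<integral>s. fimp (xbar K s) \<partial>Q) - fstar \<le> \<epsilon>)" for l c\<^sub>1 c\<^sub>2 \<epsilon> K\<epsilon>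
  proof -
    define H where "H = hidden_const l c\<^sub>1 c\<^sub>2 \<eta>\<^sub>0 DX B"
    define Z where "Z = n\<^sup>2 * L\<^sub>0 * Lt\<^sub>0\<^sup>2 / \<epsilon>"
    have L: "0 < L\<^sub>0" "0 < Lt\<^sub>0" using l by auto
    have "0 < c\<^sub>2" using c12(3) params(1) L by (smt (verit) divide_nonpos_pos)
    then have H0: "0 \<le> H"
      unfolding H_def using l c12 eta0 DX0 B_pos by (intro hidden_const_nonneg) auto
    have Z0: "0 \<le> Z" unfolding Z_def using L \<epsilon> by simp
    \<comment> \<open>With \<open>b = 1/2\<close> and \<open>r = 0\<close> the denominator
      \<open>1 - r / 2 - b\<close> equals \<open>1/2\<close> and both parts of the rate decay like
      \<open>1 / sqrt (K + 1)\<close>, so they merge.\<close>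
    define A where "A = DX / \<gamma>\<^sub>0 + 2 * \<theta>\<^sub>0 * \<gamma>\<^sub>0 + 2 * \<eta>\<^sub>0 * L\<^sub>0"
    have A0: "0 \<le> A" unfolding A_def using DX0 \<theta>0 params eta0 L by simp
    have gap_le: "(\<integral>s. fimp (xbar K s) \<partial>Q) - fstar \<le> A / sqrt (real (K + 1))" for K
      using rate[of K] ab by (simp add: A_def powr_half_sqrt add_divide_distrib mult.commute)
    have "2 * A \<le> H * (n\<^sup>2 * L\<^sub>0 * Lt\<^sub>0\<^sup>2)"
      unfolding A_def H_def
      using l c12 params(1) eta0 DX0 B_pos n1 theta0 by (intro rate_constant_le_hidden_const) auto
    then have "A \<le> H * (n\<^sup>2 * L\<^sub>0 * Lt\<^sub>0\<^sup>2)" using A0 by linarith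
    then have "A / \<epsilon> \<le> H * Z" unfolding Z_def using \<epsilon> by (simp add: divide_right_mono)
    then have "(A / \<epsilon>)\<^sup>2 \<le> (H * Z)\<^sup>2" using A0 \<epsilon> by (intro power_mono) auto
    moreover note least = least_index_bound[OF gap_le A0 \<epsilon>, folded K\<epsilon>]
    ultimately have K_le: "real K\<epsilon> \<le> (H * Z)\<^sup>2" by linarith
    have Z_sq: "n^4 * L\<^sub>0^2 * Lt\<^sub>0^4 / \<epsilon>^2 = Z\<^sup>2"
      by (simp add: Z_def power_divide power_mult_distrib power2_eq_square power4_eq_xxxx)
    have upper: "real K\<epsilon> \<le> H\<^sup>2 * Z\<^sup>2" using K_le by (simp add: power_mult_distrib)
    have ln_dt: "ln dt < 0" using dt01 by simp
    have "0 \<le> - 2 * (a + b) / ln dt" using ln_dt ab by (simp add: divide_nonpos_neg)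
    then have \<tau>0: "0 \<le> \<tau>" using tau unfolding dt by linarith
    have low: "real (lower_projections t K\<epsilon>) \<le> lower_hidden l c\<^sub>1 c\<^sub>2 \<eta>\<^sub>0 DX B \<tau> z * (Z\<^sup>2 * ln Z)"
      if "1 < z" "z \<le> Z" for z
      using lower_projections_le[OF t \<tau>0 H0 that K_le]
      by (simp add: lower_hidden_def upper_hidden_def H_def)
    show ?thesis
      unfolding Z_sq Z_def[symmetric]
      using least(1) upper low by (auto simp: upper_hidden_def H_def)
  qed
  have part_d: "\<exists>xs \<in> borel_measurable Q. AE s in Q.
         xs s \<in> Xstar \<and> (\<lambda>k. (norm (xbar k s - xs s))\<^sup>2) \<longlonglongrightarrow> 0"
    if ab: "1/2 < a" "a \<le> 1" "1 - a < b"
  proof -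
    have sq: "summable (\<lambda>k. (\<gamma> k)\<^sup>2)"
    proof -
      have "(\<gamma> k)\<^sup>2 = \<gamma>\<^sub>0\<^sup>2 * (1 / real (k + 1) powr (2 * a))" for k
        unfolding gamma by (simp add: power_divide powr_power mult.commute)
      then show ?thesis using ab powr_neg_summable[of "2 * a"] by (simp only: summable_mult)
    qed
    have smooth: "summable (\<lambda>k. \<gamma> k * \<eta> k)"
    proof -
      have "\<gamma> k * \<eta> k = \<gamma>\<^sub>0 * \<eta>\<^sub>0 * (1 / real (k + 1) powr (a + b))" for k
        unfolding gamma eta by (simp add: powr_add)
      then show ?thesis using ab powr_neg_summable[of "a + b"] by (simp only: summable_mult)
    qed
    \<comment> \<open>Used twice: \<open>q = 1\<close> for the steps in the Fejer argument and
      \<open>q = r\<close> for the averaging weights.\<close>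
    have div: "\<not> summable (\<lambda>k. \<gamma> k powr q)" if q: "0 \<le> q" "q \<le> 1" for q
    proof
      assume "summable (\<lambda>k. \<gamma> k powr q)"
      then have "summable (\<lambda>k. inverse (\<gamma>\<^sub>0 powr q) * \<gamma> k powr q)" by (rule summable_mult)
      moreover have "inverse (\<gamma>\<^sub>0 powr q) * \<gamma> k powr q = 1 / real (k + 1) powr (a * q)" for k
        unfolding gamma using params by (simp add: powr_divide powr_powr)
      ultimately have "1 < a * q" using powr_neg_summable[of "a * q"] by simp
      moreover have "a * q \<le> 1 * 1" using ab q params by (intro mult_mono) auto
      ultimately show False by simp
    qed
    have "\<gamma> k powr 1 = \<gamma> k" for k using \<gamma>_pos[of k] by simp
    then have div\<gamma>: "\<not> summable \<gamma>" using div[of 1] by simp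
    \<comment> \<open>A pointwise \<open>lim\<close> of measurable iterates is measurable outright;
      its values on the null set without convergence are harmless.\<close>
    define xs where "xs s = lim (\<lambda>k. x k s)" for s
    have "xs \<in> borel_measurable Q"
      unfolding xs_def[abs_def] by (intro borel_measurable_lim_metric S.x_measurable)
    moreover have "AE s in Q. xs s \<in> Xstar \<and> (\<lambda>k. (norm (xbar k s - xs s))\<^sup>2) \<longlonglongrightarrow> 0"
      using S.iterates_converge[OF sq smooth div\<gamma> inexact \<gamma>_le]
    proof eventually_elim
      case (elim s)
      then obtain m where m: "m \<in> Xstar" "(\<lambda>k. x k s) \<longlonglongrightarrow> m" unfolding Xstar' by blast
      then have xs: "xs s = m" unfolding xs_def by (intro limI)
      have "(\<lambda>k. xbar k s) \<longlonglongrightarrow> m"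
        unfolding xbar_eq using m(2) w_pos div[of r] params by (intro weighted_mean_tendsto) auto
      then have "(\<lambda>k. norm (xbar k s - m)) \<longlonglongrightarrow> 0"
        by (simp add: LIM_zero_iff tendsto_norm_zero_iff)
      then have "(\<lambda>k. (norm (xbar k s - m))\<^sup>2) \<longlonglongrightarrow> 0\<^sup>2" by (rule tendsto_power)
      then show ?case using m(1) xs by simp
    qed
    ultimately show ?thesis by blast
  qed
  show ?thesis
  proof (intro conjI allI ballI impI, goal_cases)
    case (3 k xh w z)
    have "X + cball 0 (\<eta> k) \<subseteq> X + cball 0 \<eta>\<^sub>0"
      using \<eta>_bounds(2)[of k] by (intro set_plus_mono2) auto
    with 3 show ?case using lower by blast
  next
    case (4 K)
    then show ?case using part_b by blast
  next
    \<comment> \<open>Here \<open>1 - b = \<delta>\<close> turns the second denominator into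
      \<delta>, and \<open>r < 2 * (1 - b)\<close> becomes \<open>0 < 2 * \<delta>\<close>.\<close>
    case (5 \<delta> K)
    then show ?case using part_b[of K] by (simp add: mult.assoc)
  next
    case (6 l c\<^sub>1 c\<^sub>2 \<epsilon> K\<epsilon>)
    then show ?case using part_c by blast
  next
    case (7 l c\<^sub>1 c\<^sub>2 \<epsilon> K\<epsilon>)
    then show ?case using part_c by (simp add: upper_projections_def)
  next
    case (8 l c\<^sub>1 c\<^sub>2 \<epsilon> K\<epsilon>)
    then show ?case using part_c by (simp add: upper_samples_def)
  next
    case (9 l c\<^sub>1 c\<^sub>2 \<epsilon> K\<epsilon> z)
    then show ?case using part_c by blast
  next
    case 10
    then show ?case using part_d by blast
  qed (fact dt01 B_pos)+
qed

end
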